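(* There exist an absolute constant $c>0$ and a fixed polynomial $\mathrm{poly}(\cdot)$ such that the following holds for any $\delta\in(0,1]$, any positive integers $S,A,O,H,K$ and any $\alpha>0$. Run the OMLE algorithm (defined in the context) for $K$ episodes with inputs $\alpha$ and $$\beta = c\left(H(S^2A+SO)\log(SAOHK)+\log(K/\delta)\right).$$ Then for any POMDP with $S$ states, $A$ actions, $O$ observations and horizon $H$ whose emission matrices satisfy $\min_{h\in[H]}\sigma_S(\mathbb{O}_h)\ge\alpha$, with probability at least $1-\delta$, $$\mathrm{Regret}(k)=\sum_{t=1}^k\left(V^\star-V^{\pi^t}\right)\le \mathrm{poly}\left(S,A,O,H,\alpha^{-1},\log(\delta^{-1}K)\right)\cdot\sqrt{k}\qquad\text{for all }k\in[K],$$ where $\pi^t$ is the policy executed by OMLE in episode $t$.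
   Context: Notation: $[n]=\{1,\dots,n\}$; $\Delta_X$ is the set of probability distributions on a finite set $X$; $\sigma_j(M)$ is the $j$-th largest singular value of $M$ (equal to $0$ if $M$ has fewer than $j$ rows or columns). POMDP: a tuple $(\mathscr S,\mathscr A,\mathscr O;H,\mu_1,\mathbb T,\mathbb O;r)$ with finite sets of states, actions, observations of sizes $S,A,O$; horizon $H$; initial state distribution $\mu_1\in\Delta_{\mathscr S}$; transition matrices $\mathbb T_{h,a}\in\mathbb R^{S\times S}$ ($h\in[H-1],a\in\mathscr A$), where $\mathbb T_{h,a}(\cdot\mid s)$ (column $s$) is the distribution of the next state; emission matrices $\mathbb O_h\in\mathbb R^{O\times S}$ ($h\in[H]$), where $\mathbb O_h(\cdot\mid s)$ (column $s$) is the distribution of the observation; known rewards $r_h:\mathscr O\to[0,1]$. In an episode $s_1\sim\mu_1$; at step $h$ the learner sees $o_h\sim\mathbb O_h(\cdot\mid s_h)$, receives $r_h(o_h)$, takes $a_h$, and $s_{h+1}\sim\mathbb T_{h,a_h}(\cdot\mid s_h)$; the episode ends after $a_H$. States are never observed. A policy is $\pi=\{\pi_h\}_{h=1}^H$ with $\pi_h:(\mathscr O\times\mathscr A)^{h-1}\times\mathscr O\to\Delta_{\mathscr A}$. $V^\pi=\mathbb E_\pi[\sum_{h=1}^H r_h(o_h)]$, $V^\star=\sup_\pi V^\pi$. Values without a model argument refer to the true POMDP. Models: $\theta=(\mathbb T,\mathbb O,\mu_1)$, and $\Theta$ is the set of all such parameters for the given $S,A,O,H$; $V^\pi(\theta)$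 is the value of $\pi$ under $\theta$, $\mathbb O_h(\theta)$ its emission matrices, and $\mathbb P^\pi_\theta(\tau)$ the probability of the full trajectory $\tau=(o_1,a_1,\dots,o_H,a_H)$ under $\pi$ and $\theta$. OMLE algorithm with inputs $\alpha,\beta$: set $\mathcal B^1=\{\hat\theta\in\Theta:\min_h\sigma_S(\mathbb O_h(\hat\theta))\ge\alpha\}$ and $\mathcal D=\emptyset$. For $k=1,\dots,K$: compute $(\theta^k,\pi^k)\in\arg\max_{\hat\theta\in\mathcal B^k,\pi}V^\pi(\hat\theta)$ (ties broken by a fixed deterministic rule; if $\mathcal B^k=\emptyset$ the choice is arbitrary); execute $\pi^k$ in the true POMDP for one episode to collect a trajectory $\tau^k$; add $(\pi^k,\tau^k)$ to $\mathcal D$ and set $$\mathcal B^{k+1}=\Big\{\hat\theta\in\Theta:\sum_{(\pi,\tau)\in\mathcal D}\log\mathbb P^\pi_{\hat\theta}(\tau)\ge\max_{\theta'\in\Theta}\sum_{(\pi,\tau)\in\mathcal D}\log\mathbb P^\pi_{\theta'}(\tau)-\beta\Big\}\cap\mathcal B^1.$$ *)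

theory Defs
  imports "HOL-Probability.Probability" "Jordan_Normal_Form.Char_Poly"
begin

section \<open>Singular values\<close>

text \<open>
  Square roots of the eigenvalues of \<open>M\<^sup>T M\<close> with algebraic multiplicity, in decreasing order; all
  roots of the characteristic polynomial of this symmetric matrix are real and nonnegative.
\<close>

definition singular_values :: "real mat \<Rightarrow> real list" where
  "singular_values M =
     rev (sorted_list_of_multiset (image_mset sqrt (proots (char_poly (transpose_mat M * M)))))"

definition singular_value :: "nat \<Rightarrow> real mat \<Rightarrow> real" where
  "singular_value j M =
     (if 1 \<le> j \<and> j \<le> dim_row M \<and> j \<le> dim_col M then singular_values M ! (j - 1) else 0)"


section \<open>POMDPs\<close>

text \<open>
  The numbers of states, actions and observations are quantified inside the theorem, so the finite
  sets are represented by initial segments \<open>{..<S}\<close>, \<open>{..<A}\<close>, \<open>{..<Ob}\<close> of the naturals, whereas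
  time steps run through \<open>{1..H}\<close>.  The columns of the stochastic matrices are represented by
  probability mass functions: \<open>trans \<theta> h a s\<close> is column \<open>s\<close> of the transition matrix for step \<open>h\<close> and
  action \<open>a\<close>, and \<open>emit \<theta> h s\<close> is column \<open>s\<close> of the emission matrix of step \<open>h\<close>.
\<close>

record model =
  init :: "nat pmf"
  trans :: "nat \<Rightarrow> nat \<Rightarrow> nat \<Rightarrow> nat pmf"
  emit :: "nat \<Rightarrow> nat \<Rightarrow> nat pmf"

definition models :: "nat \<Rightarrow> nat \<Rightarrow> nat \<Rightarrow> nat \<Rightarrow> model set" where
  "models S A Ob H =
     {\<theta>. set_pmf (init \<theta>) \<subseteq> {..<S} \<and>
         (\<forall>h\<in>{1..<H}. \<forall>a<A. \<forall>s<S. set_pmf (trans \<theta> h a s) \<subseteq> {..<S}) \<and>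
         (\<forall>h\<in>{1..H}. \<forall>s<S. set_pmf (emit \<theta> h s) \<subseteq> {..<Ob})}"

definition emission_matrix :: "nat \<Rightarrow> nat \<Rightarrow> model \<Rightarrow> nat \<Rightarrow> real mat" where
  "emission_matrix S Ob \<theta> h = Matrix.mat Ob S (\<lambda>(ob, s). pmf (emit \<theta> h s) ob)"

definition rewards :: "nat \<Rightarrow> nat \<Rightarrow> (nat \<Rightarrow> nat \<Rightarrow> real) set" where
  "rewards Ob H = {r. \<forall>h\<in>{1..H}. \<forall>ob<Ob. 0 \<le> r h ob \<and> r h ob \<le> 1}"

text \<open>A (partial) trajectory is the list of the observation-action pairs seen so far.\<close>

type_synonym trajectory = "(nat \<times> nat) list"

text \<open>
  A policy maps the past observation-action pairs and the current observation to a distribution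
  over actions; the step is one plus the length of the history.
\<close>

type_synonym policy = "trajectory \<Rightarrow> nat \<Rightarrow> nat pmf"

definition trajectories :: "nat \<Rightarrow> nat \<Rightarrow> nat \<Rightarrow> trajectory set" where
  "trajectories A Ob n = {\<tau>. length \<tau> = n \<and> set \<tau> \<subseteq> {..<Ob} \<times> {..<A}}"

definition policies :: "nat \<Rightarrow> nat \<Rightarrow> nat \<Rightarrow> policy set" where
  "policies A Ob H =
     {\<pi>. \<forall>h\<in>{1..H}. \<forall>\<tau>\<in>trajectories A Ob (h - 1). \<forall>ob<Ob. set_pmf (\<pi> \<tau> ob) \<subseteq> {..<A}}"

text \<open>
  \<open>rollout \<theta> \<pi> n h s \<tau>\<close> plays the last \<open>n\<close> steps of an episode, starting with step \<open>h\<close> in the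
  hidden state \<open>s\<close> after the history \<open>\<tau>\<close>.  There is no transition after the last action.
\<close>

primrec rollout ::
  "model \<Rightarrow> policy \<Rightarrow> nat \<Rightarrow> nat \<Rightarrow> nat \<Rightarrow> trajectory \<Rightarrow> trajectory pmf" where
  "rollout \<theta> \<pi> 0 h s \<tau> = return_pmf \<tau>"
| "rollout \<theta> \<pi> (Suc n) h s \<tau> =
     bind_pmf (emit \<theta> h s) (\<lambda>ob.
     bind_pmf (\<pi> \<tau> ob) (\<lambda>a.
       if n = 0 then return_pmf (\<tau> @ [(ob, a)])
       else bind_pmf (trans \<theta> h a s) (\<lambda>s'. rollout \<theta> \<pi> n (Suc h) s' (\<tau> @ [(ob, a)]))))"

definition episode :: "nat \<Rightarrow> model \<Rightarrow> policy \<Rightarrow> trajectory pmf" where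
  "episode H \<theta> \<pi> = bind_pmf (init \<theta>) (\<lambda>s. rollout \<theta> \<pi> H 1 s [])"

definition policy_value ::
  "nat \<Rightarrow> (nat \<Rightarrow> nat \<Rightarrow> real) \<Rightarrow> model \<Rightarrow> policy \<Rightarrow> real" where
  "policy_value H r \<theta> \<pi> =
     measure_pmf.expectation (episode H \<theta> \<pi>) (\<lambda>\<tau>. \<Sum>h=1..H. r h (fst (\<tau> ! (h - 1))))"

definition optimal_value ::
  "nat \<Rightarrow> nat \<Rightarrow> nat \<Rightarrow> (nat \<Rightarrow> nat \<Rightarrow> real) \<Rightarrow> model \<Rightarrow> real" where
  "optimal_value A Ob H r \<theta> = (SUP \<pi>\<in>policies A Ob H. policy_value H r \<theta> \<pi>)"


section \<open>The OMLE algorithm\<close>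

type_synonym dataset = "(policy \<times> trajectory) list"

text \<open>The library sets \<open>ln 0 = 0\<close>; for log-likelihoods the value has to be \<open>-\<infinity>\<close>.\<close>

definition elog :: "real \<Rightarrow> ereal" where
  "elog x = (if x \<le> 0 then -\<infinity> else ereal (ln x))"

definition log_likelihood :: "nat \<Rightarrow> dataset \<Rightarrow> model \<Rightarrow> ereal" where
  "log_likelihood H D \<theta> = (\<Sum>(\<pi>, \<tau>)\<leftarrow>D. elog (pmf (episode H \<theta> \<pi>) \<tau>))"

definition initial_models :: "nat \<Rightarrow> nat \<Rightarrow> nat \<Rightarrow> nat \<Rightarrow> real \<Rightarrow> model set" where
  "initial_models S A Ob H \<alpha> =
     {\<theta> \<in> models S A Ob H. (MIN h\<in>{1..H}. singular_value S (emission_matrix S Ob \<theta> h)) \<ge> \<alpha>}"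

text \<open>
  The model set used in the episode that follows the data \<open>D\<close>.  The supremum of the log-likelihood
  is attained, as the likelihood is continuous on the compact set of models.
\<close>

definition confidence_set ::
  "nat \<Rightarrow> nat \<Rightarrow> nat \<Rightarrow> nat \<Rightarrow> real \<Rightarrow> real \<Rightarrow> dataset \<Rightarrow> model set" where
  "confidence_set S A Ob H \<alpha> \<beta> D =
     (if D = [] then initial_models S A Ob H \<alpha>
      else {\<theta> \<in> models S A Ob H.
              log_likelihood H D \<theta> \<ge>
                (SUP \<theta>'\<in>models S A Ob H. log_likelihood H D \<theta>') - ereal \<beta>}
           \<inter> initial_models S A Ob H \<alpha>)"

text \<open>
  A deterministic rule for the optimistic planning step, as a function of the data collected so
  far.  It resolves ties in the maximisation, and chooses arbitrarily if the confidence set is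
  empty.
\<close>

definition omle_rule ::
  "nat \<Rightarrow> nat \<Rightarrow> nat \<Rightarrow> nat \<Rightarrow> (nat \<Rightarrow> nat \<Rightarrow> real) \<Rightarrow> real \<Rightarrow> real
     \<Rightarrow> (dataset \<Rightarrow> model \<times> policy) \<Rightarrow> bool" where
  "omle_rule S A Ob H r \<alpha> \<beta> choice \<longleftrightarrow>
     (\<forall>D\<in>lists (policies A Ob H \<times> trajectories A Ob H).
        choice D \<in> models S A Ob H \<times> policies A Ob H \<and>
        (confidence_set S A Ob H \<alpha> \<beta> D \<noteq> {} \<longrightarrow>
           is_arg_max (\<lambda>(\<theta>, \<pi>). policy_value H r \<theta> \<pi>)
             (\<lambda>x. x \<in> confidence_set S A Ob H \<alpha> \<beta> D \<times> policies A Ob H) (choice D)))"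

text \<open>
  The law of the data after \<open>k\<close> episodes under the true model \<open>\<theta>\<close>; entry \<open>t - 1\<close> is the policy
  executed in episode \<open>t\<close> together with the trajectory observed.
\<close>

primrec omle ::
  "nat \<Rightarrow> model \<Rightarrow> (dataset \<Rightarrow> model \<times> policy) \<Rightarrow> nat \<Rightarrow> dataset pmf" where
  "omle H \<theta> choice 0 = return_pmf []"
| "omle H \<theta> choice (Suc k) =
     bind_pmf (omle H \<theta> choice k) (\<lambda>D.
     bind_pmf (episode H \<theta> (snd (choice D))) (\<lambda>\<tau>.
       return_pmf (D @ [(snd (choice D), \<tau>)])))"

definition regret ::
  "nat \<Rightarrow> nat \<Rightarrow> nat \<Rightarrow> (nat \<Rightarrow> nat \<Rightarrow> real) \<Rightarrow> model \<Rightarrow> dataset \<Rightarrow> nat \<Rightarrow> real" where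
  "regret A Ob H r \<theta> D k =
     (\<Sum>t=1..k. optimal_value A Ob H r \<theta> - policy_value H r \<theta> (fst (D ! (t - 1))))"

end

theory Submission
  imports Defs
begin

text \<open>
  The predictions of a model \<open>\<theta>\<close> whose emission matrices have left inverses \<open>L h\<close> determine its
  unnormalised belief vectors.  Feeding the predictions of the true model \<open>\<theta>'\<close> into \<open>L h\<close> gives
  pseudo-beliefs that satisfy the dynamics of \<open>\<theta>\<close> up to residuals; these residuals are linear in the
  \<open>S\<close>-dimensional beliefs of \<open>\<theta>'\<close>, with coefficients that depend on \<open>\<theta>\<close> only.  The total variation
  distance between the trajectory laws of \<open>\<theta>\<close> and \<open>\<theta>'\<close> is at most the sum of the residuals under
  the policy, and conversely it bounds each of them.

  A likelihood ratio argument over a finite net of models shows that with high probability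
  every confidence set contains the true model, and all its members are close to the true model, in
  squared total variation summed over the policies executed so far.  By the converse bound, the
  residual functionals of the current optimistic model are small on past beliefs; the elliptical potential
  lemma then bounds the sum of the residuals on the current beliefs by \<open>\<surd>k\<close> up to a polynomial factor.
  Optimism turns this into the regret bound.
\<close>

section \<open>Linear algebra\<close>

text \<open>Hidden states of two models have no common labelling, so only predictions of
  observations can be compared; this is why pseudo-beliefs appear. The obstacle is that histories
  are exponentially many in \<open>H\<close>, and a polynomial bound must never count them. Two
  facts avoid this. Residuals are weighted by the policy and propagated by maps that contract the L1
  norm, so that they add up instead of multiplying; a factor \<open>S / \<alpha>\<close> is paid
  only in the converse bound. And given the step, the observation, the action and the coordinate,
  one functional on \<open>S\<close>-dimensional vectors serves all histories, so the potential
  argument runs in dimension \<open>S\<close>. The net is one-sided: every model is dominated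
  pointwise by a member of the net up to the factor \<open>exp (1 / K)\<close>. A two-sided
  approximation of log-likelihoods would break down where probabilities vanish. The constant 7 in
  \<beta> is 4 + 3: the logarithm of the size of the net costs four times the main term, and 3
  absorbs the \<open>1 + ln 2\<close> left over from the net error and from the threshold in
  Markov's inequality.\<close>

lemma size_proots_real_roots:
  fixes p :: "real poly"
  assumes "p \<noteq> 0" and "\<And>z. poly (map_poly complex_of_real p) z = 0 \<Longrightarrow> z \<in> \<real>"
  shows "size (proots p) = degree p"
  using assms
proof (induction "degree p" arbitrary: p)
  case 0
  then have "size (proots p) \<le> 0" using size_proots_le[of p] by simp
  with 0 show ?case by simp
next
  case (Suc n)
  interpret hom: map_poly_comm_ring_hom complex_of_real ..
  have deg: "degree (map_poly complex_of_real p) = Suc n"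
    using Suc(2) by simp
  then have "\<not> constant (poly (map_poly complex_of_real p))"
    by (simp add: constant_degree)
  then obtain z where z: "poly (map_poly complex_of_real p) z = 0"
    using fundamental_theorem_of_algebra by blast
  then obtain x where x: "z = of_real x" using Suc.prems(2)[OF z] by (auto elim: Reals_cases)
  have "poly p x = 0"
    using z unfolding x of_real_hom.poly_map_poly by simp
  then obtain q where q: "p = [:-x, 1:] * q"
    using poly_eq_0_iff_dvd by (metis dvdE)
  with Suc.prems have q0: "q \<noteq> 0" by auto
  have dq: "n = degree q" using Suc(2) q0 unfolding q by (subst (asm) degree_mult_eq) auto
  have "size (proots q) = degree q"
  proof (rule Suc(1)[OF dq q0])
    fix w assume "poly (map_poly complex_of_real q) w = 0"
    then show "w \<in> \<real>"
      unfolding q by (intro Suc.prems(2)) (simp only: q hom.hom_mult poly_mult mult_zero_right)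
  qed
  moreover have "proots p = add_mset x (proots q)"
    unfolding q using q0 by (subst proots_mult) auto
  ultimately show ?case using Suc(2) dq by simp
qed

text \<open>For a complex eigenvector \<open>v\<close> the number \<open>q = v* A v\<close> equals
  its own conjugate by symmetry, and it also equals \<open>z\<close> times the squared norm of
  \<open>v\<close>, which is a positive real.\<close>

lemma symmetric_char_poly_root_real:
  fixes A :: "real mat"
  assumes A: "A \<in> carrier_mat n n" and sym: "\<And>i j. i < n \<Longrightarrow> j < n \<Longrightarrow> A $$ (i, j) = A $$ (j, i)"
    and root: "poly (map_poly complex_of_real (char_poly A)) z = 0"
  shows "z \<in> \<real>"
proof -
  let ?C = "map_mat complex_of_real A"
  have C: "?C \<in> carrier_mat n n" using A by simp
  have "char_poly ?C = map_poly complex_of_real (char_poly A)"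
    by (rule of_real_hom.char_poly_hom[OF A])
  then have "eigenvalue ?C z"
    using root eigenvalue_root_char_poly[OF C] by simp
  then obtain v where v: "v \<in> carrier_vec n" "v \<noteq> 0\<^sub>v n" and ev: "?C *\<^sub>v v = z \<cdot>\<^sub>v v"
    using A unfolding eigenvalue_def eigenvector_def by auto
  have row: "(\<Sum>j<n. of_real (A $$ (i, j)) * v $ j) = z * v $ i" if "i < n" for i
  proof -
    have "(?C *\<^sub>v v) $ i = (\<Sum>j<n. of_real (A $$ (i, j)) * v $ j)"
      using that A v by (simp add: scalar_prod_def atLeast0LessThan)
    with ev that v show ?thesis by simp
  qed
  define q where "q = (\<Sum>i<n. \<Sum>j<n. cnj (v $ i) * (of_real (A $$ (i, j)) * v $ j))"
  have "cnj q = (\<Sum>j<n. \<Sum>i<n. cnj (v $ j) * (of_real (A $$ (i, j)) * v $ i))"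
    unfolding q_def cnj_sum by (subst sum.swap) (simp add: mult_ac)
  also have "\<dots> = q"
    unfolding q_def by (intro sum.cong refl) (simp add: sym)
  finally have qr: "q \<in> \<real>" by (simp add: Reals_cnj_iff)
  have "q = (\<Sum>i<n. cnj (v $ i) * (z * v $ i))"
    unfolding q_def by (simp add: sum_distrib_left[symmetric] row)
  also have "\<dots> = z * of_real (\<Sum>i<n. (cmod (v $ i))\<^sup>2)"
    by (simp add: sum_distrib_left of_real_sum complex_norm_square mult_ac del: of_real_power)
  finally have qz: "q = z * of_real (\<Sum>i<n. (cmod (v $ i))\<^sup>2)" .
  obtain i where i: "i < n" "v $ i \<noteq> 0" using v by (metis carrier_vecD eq_vecI index_zero_vec)
  have "(\<Sum>i<n. (cmod (v $ i))\<^sup>2) > 0"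
    by (rule sum_pos2[of _ i]) (use i in auto)
  then have "complex_of_real (\<Sum>i<n. (cmod (v $ i))\<^sup>2) \<noteq> 0"
    unfolding of_real_eq_0_iff by linarith
  then have "z = q / of_real (\<Sum>i<n. (cmod (v $ i))\<^sup>2)"
    using qz by (metis nonzero_mult_div_cancel_right)
  with qr show ?thesis by (simp add: Reals_divide)
qed

section \<open>Positive semidefinite forms\<close>

text \<open>Vectors and matrices are functions on the naturals of which only the indices below
  \<open>d\<close> count; \<open>Matrix.mat\<close> appears only where determinants, inverses or
  eigenvalues are involved.\<close>

definition bform :: "nat \<Rightarrow> (nat \<Rightarrow> nat \<Rightarrow> real) \<Rightarrow> (nat \<Rightarrow> real) \<Rightarrow> (nat \<Rightarrow> real) \<Rightarrow> real" where
  "bform d V x y = (\<Sum>i<d. x i * (\<Sum>j<d. V i j * y j))"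

lemma bform_expand: "bform d V x y = (\<Sum>i<d. \<Sum>j<d. x i * V i j * y j)"
  by (simp add: bform_def sum_distrib_left mult.assoc)

lemma bform_commute:
  assumes "\<And>i j. i < d \<Longrightarrow> j < d \<Longrightarrow> V i j = V j i"
  shows "bform d V x y = bform d V y x"
  unfolding bform_expand by (subst sum.swap) (auto intro!: sum.cong simp: assms mult_ac)

lemma nonneg_quadratic_discriminant:
  fixes a b c :: real
  assumes "\<And>t. 0 \<le> a + 2 * t * b + t\<^sup>2 * c"
  shows "b\<^sup>2 \<le> a * c"
proof (cases "c = 0")
  case True
  have "b = 0"
  proof (rule ccontr)
    assume "b \<noteq> 0"
    \<comment> \<open>At this \<open>t\<close> the polynomial takes the value -1.\<close>
    then show False using assms[of "- (a + 1) / (2 * b)"] True by (simp add: field_simps)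
  qed
  then show ?thesis using True by simp
next
  case False
  have "c \<ge> 0"
  proof (rule ccontr)
    assume c: "\<not> c \<ge> 0"
    \<comment> \<open>So large that the quadratic term outweighs the other two and makes the
      polynomial negative.\<close>
    define t where "t = (1 + \<bar>a\<bar> + 2 * \<bar>b\<bar>) / - c + 1"
    have t: "t \<ge> 1" using c by (simp add: t_def divide_nonneg_neg)
    have "- (t * c) \<ge> 1 + \<bar>a\<bar> + 2 * \<bar>b\<bar>" using c by (simp add: t_def field_simps)
    then have "t * (- (t * c)) \<ge> t * (1 + \<bar>a\<bar> + 2 * \<bar>b\<bar>)" using t by (intro mult_left_mono) auto
    moreover have "t * (1 + \<bar>a\<bar>) \<ge> 1 + \<bar>a\<bar>" using t by (intro mult_le_cancel_right1[THEN iffD2]) auto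
    moreover have "t * b \<le> t * \<bar>b\<bar>" using t by (intro mult_left_mono) auto
    ultimately show False using assms[of t] by (simp add: power2_eq_square algebra_simps)
  qed
  with False have c: "c > 0" by simp
  have "0 \<le> c * (a + 2 * (- b / c) * b + (- b / c)\<^sup>2 * c)"
    using assms[of "- b / c"] c by simp
  also have "\<dots> = a * c - b\<^sup>2" using c by (simp add: power2_eq_square field_simps)
  finally show ?thesis by simp
qed

text \<open>The discriminant of the nonnegative polynomial that maps \<open>t\<close> to the form at
  \<open>x + t y\<close>. The form may be degenerate, as it will be before coercivity is
  known.\<close>

lemma psd_Cauchy_Schwarz:
  assumes sym: "\<And>i j. i < d \<Longrightarrow> j < d \<Longrightarrow> V i j = V j i"
    and psd: "\<And>x. 0 \<le> bform d V x x"
  shows "(bform d V x y)\<^sup>2 \<le> bform d V x x * bform d V y y"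
proof (rule nonneg_quadratic_discriminant)
  fix t :: real
  have "0 \<le> bform d V (\<lambda>i. x i + t * y i) (\<lambda>i. x i + t * y i)" by (rule psd)
  also have "\<dots> = bform d V x x + t * bform d V x y + t * bform d V y x + t\<^sup>2 * bform d V y y"
    unfolding bform_expand sum_distrib_left sum.distrib[symmetric]
    by (intro sum.cong refl) (simp add: algebra_simps power2_eq_square)
  also have "bform d V y x = bform d V x y" by (rule bform_commute[OF sym])
  finally show "0 \<le> bform d V x x + 2 * t * bform d V x y + t\<^sup>2 * bform d V y y" by simp
qed

lemma injective_imp_inverse:
  fixes V :: "nat \<Rightarrow> nat \<Rightarrow> real"
  assumes inj: "\<forall>v. (\<forall>i<d. (\<Sum>j<d. V i j * v j) = 0) \<longrightarrow> (\<forall>i<d. v i = 0)"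
  shows "det (Matrix.mat d d (\<lambda>(i, j). V i j)) \<noteq> 0"
    and "\<exists>W. (\<forall>i<d. \<forall>k<d. (\<Sum>j<d. V i j * W j k) = (if i = k then 1 else 0)) \<and>
             (\<forall>i<d. \<forall>k<d. (\<Sum>j<d. W i j * V j k) = (if i = k then 1 else 0))"
proof -
  let ?A = "Matrix.mat d d (\<lambda>(i, j). V i j)"
  have A: "?A \<in> carrier_mat d d" by simp
  show det: "det ?A \<noteq> 0"
  proof
    assume "det ?A = 0"
    then obtain v where v: "v \<in> carrier_vec d" "v \<noteq> 0\<^sub>v d" "?A *\<^sub>v v = 0\<^sub>v d"
      using det_0_iff_vec_prod_zero[OF A] by blast
    have "(\<Sum>j<d. V i j * v $ j) = 0" if "i < d" for i
    proof -
      have "(?A *\<^sub>v v) $ i = (\<Sum>j<d. V i j * v $ j)"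
        using that v(1) by (simp add: scalar_prod_def atLeast0LessThan)
      then show ?thesis using v(3) that by simp
    qed
    then have "v $ i = 0" if "i < d" for i using inj[rule_format, of "\<lambda>i. v $ i"] that by blast
    then show False using v(1,2) by (auto intro: eq_vecI)
  qed
  from det_non_zero_imp_unit[OF A det, of "()"]
  obtain B where B: "B \<in> carrier_mat d d" "B * ?A = 1\<^sub>m d" "?A * B = 1\<^sub>m d"
    unfolding Units_def ring_mat_def by auto
  have "(\<Sum>j<d. V i j * B $$ (j, k)) = (if i = k then 1 else 0)" if "i < d" "k < d" for i k
  proof -
    have "(?A * B) $$ (i, k) = (\<Sum>j<d. V i j * B $$ (j, k))"
      using that B(1) by (simp add: scalar_prod_def atLeast0LessThan)
    then show ?thesis using B(3) that by simp
  qed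
  moreover have "(\<Sum>j<d. B $$ (i, j) * V j k) = (if i = k then 1 else 0)" if "i < d" "k < d" for i k
  proof -
    have "(B * ?A) $$ (i, k) = (\<Sum>j<d. B $$ (i, j) * V j k)"
      using that B(1) by (simp add: scalar_prod_def atLeast0LessThan)
    then show ?thesis using B(2) that by simp
  qed
  ultimately show "\<exists>W. (\<forall>i<d. \<forall>k<d. (\<Sum>j<d. V i j * W j k) = (if i = k then 1 else 0)) \<and>
             (\<forall>i<d. \<forall>k<d. (\<Sum>j<d. W i j * V j k) = (if i = k then 1 else 0))"
    by (intro exI[of _ "\<lambda>i j. B $$ (i, j)"]) blast
qed

lemma bform_le_norm:
  "\<exists>K>0. \<forall>x. \<bar>bform d V x x\<bar> \<le> K * (\<Sum>i<d. (x i)\<^sup>2)"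
proof (intro exI conjI allI)
  \<comment> \<open>The summand 1 keeps the constant positive when \<open>V\<close> vanishes below
    \<open>d\<close>.\<close>
  let ?K = "1 + (\<Sum>i<d. \<Sum>j<d. \<bar>V i j\<bar>)"
  show "?K > 0" by (intro add_pos_nonneg sum_nonneg) auto
  fix x :: "nat \<Rightarrow> real"
  let ?N = "\<Sum>i<d. (x i)\<^sup>2"
  have N: "?N \<ge> 0" by (intro sum_nonneg) auto
  have le: "(x i)\<^sup>2 \<le> ?N" if "i < d" for i by (rule member_le_sum) (use that in auto)
  have "\<bar>bform d V x x\<bar> \<le> (\<Sum>i<d. \<Sum>j<d. \<bar>x i * V i j * x j\<bar>)"
    unfolding bform_expand by (intro order_trans[OF sum_abs] sum_mono sum_abs)
  also have "\<dots> \<le> (\<Sum>i<d. \<Sum>j<d. \<bar>V i j\<bar> * ?N)"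
  proof (intro sum_mono)
    fix i j assume ij: "i \<in> {..<d}" "j \<in> {..<d}"
    have "2 * \<bar>x i * x j\<bar> \<le> (x i)\<^sup>2 + (x j)\<^sup>2"
      using sum_squares_bound[of "\<bar>x i\<bar>" "\<bar>x j\<bar>"] by (simp add: abs_mult)
    then have "\<bar>x i * x j\<bar> \<le> ?N" using le[of i] le[of j] ij by auto
    then have "\<bar>V i j\<bar> * \<bar>x i * x j\<bar> \<le> \<bar>V i j\<bar> * ?N" by (intro mult_left_mono) auto
    then show "\<bar>x i * V i j * x j\<bar> \<le> \<bar>V i j\<bar> * ?N" by (simp add: abs_mult mult_ac)
  qed
  also have "\<dots> = (\<Sum>i<d. \<Sum>j<d. \<bar>V i j\<bar>) * ?N" by (simp add: sum_distrib_right)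
  also have "\<dots> \<le> ?K * ?N" using N by (intro mult_right_mono) auto
  finally show "\<bar>bform d V x x\<bar> \<le> ?K * ?N" .
qed

lemma matvec_le_norm:
  fixes W :: "nat \<Rightarrow> nat \<Rightarrow> real" and d e :: nat
  shows
  "\<exists>K>0. \<forall>x. (\<Sum>i<e. (\<Sum>j<d. W i j * x j)\<^sup>2) \<le> K * (\<Sum>j<d. (x j)\<^sup>2)"
proof -
  obtain K where K: "K > 0" "\<And>x. \<bar>bform d (\<lambda>j k. \<Sum>i<e. W i j * W i k) x x\<bar> \<le> K * (\<Sum>j<d. (x j)\<^sup>2)"
    using bform_le_norm[of d "\<lambda>j k. \<Sum>i<e. W i j * W i k"] by blast
  have "(\<Sum>i<e. (\<Sum>j<d. W i j * x j)\<^sup>2) = bform d (\<lambda>j k. \<Sum>i<e. W i j * W i k) x x" for x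
  proof -
    have "(\<Sum>i<e. (\<Sum>j<d. W i j * x j)\<^sup>2) = (\<Sum>i<e. \<Sum>j<d. \<Sum>k<d. x j * (W i j * W i k) * x k)"
      by (intro sum.cong refl) (simp add: power2_eq_square sum_product mult_ac)
    also have "\<dots> = (\<Sum>j<d. \<Sum>i<e. \<Sum>k<d. x j * (W i j * W i k) * x k)"
      by (rule sum.swap)
    also have "\<dots> = (\<Sum>j<d. \<Sum>k<d. \<Sum>i<e. x j * (W i j * W i k) * x k)"
      by (intro sum.cong refl sum.swap)
    finally show ?thesis by (simp add: bform_expand sum_distrib_left sum_distrib_right)
  qed
  then show ?thesis using K by (intro exI[of _ K]) (auto intro: order_trans[OF abs_ge_self])
qed

text \<open>No spectral theorem is involved. With \<open>y = V x\<close>, invertibility gives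
  \<open>|x|^2 <= K |y|^2\<close>. Cauchy-Schwarz for the form, applied to \<open>y\<close> and
  \<open>x\<close>, gives \<open>|y|^4 <= K' |y|^2\<close> times the form at \<open>x\<close>, and
  one factor \<open>|y|^2\<close> cancels.\<close>

lemma psd_injective_imp_coercive:
  assumes sym: "\<And>i j. i < d \<Longrightarrow> j < d \<Longrightarrow> V i j = V j i"
    and psd: "\<And>x. 0 \<le> bform d V x x"
    and inj: "\<forall>v. (\<forall>i<d. (\<Sum>j<d. V i j * v j) = 0) \<longrightarrow> (\<forall>i<d. v i = 0)"
  shows "\<exists>\<epsilon>>0. \<forall>x. \<epsilon> * (\<Sum>i<d. (x i)\<^sup>2) \<le> bform d V x x"
proof -
  obtain W where W: "\<And>i k. i < d \<Longrightarrow> k < d \<Longrightarrow> (\<Sum>j<d. W i j * V j k) = (if i = k then 1 else 0)"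
    using injective_imp_inverse(2)[OF inj] by blast
  obtain K where K: "K > 0" "\<And>x. (\<Sum>i<d. (\<Sum>j<d. W i j * x j)\<^sup>2) \<le> K * (\<Sum>j<d. (x j)\<^sup>2)"
    using matvec_le_norm[where W=W and d=d and e=d] by blast
  obtain K' where K': "K' > 0" "\<And>x. \<bar>bform d V x x\<bar> \<le> K' * (\<Sum>j<d. (x j)\<^sup>2)"
    using bform_le_norm[of d V] by blast
  have "(\<Sum>i<d. (x i)\<^sup>2) \<le> K * K' * bform d V x x" for x
  proof -
    define y where "y i = (\<Sum>j<d. V i j * x j)" for i
    have "(\<Sum>j<d. W i j * y j) = x i" if "i < d" for i
    proof -
      have "(\<Sum>j<d. W i j * y j) = (\<Sum>k<d. (\<Sum>j<d. W i j * V j k) * x k)"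
        unfolding y_def sum_distrib_left sum_distrib_right by (subst sum.swap) (simp add: mult_ac)
      also have "\<dots> = (\<Sum>k<d. if k = i then x k else 0)" using that by (intro sum.cong refl) (simp add: W)
      finally show ?thesis using that by simp
    qed
    then have 1: "(\<Sum>i<d. (x i)\<^sup>2) \<le> K * (\<Sum>j<d. (y j)\<^sup>2)" using K(2)[of y] by simp
    let ?Y = "\<Sum>j<d. (y j)\<^sup>2"
    have "bform d V y x = ?Y" by (simp add: bform_def y_def power2_eq_square)
    then have "?Y\<^sup>2 \<le> bform d V y y * bform d V x x"
      using psd_Cauchy_Schwarz[OF sym psd, of y x] by simp
    also have "\<dots> \<le> K' * ?Y * bform d V x x"
      using K'(2)[of y] psd[of x] by (intro mult_right_mono) auto
    finally have "?Y * ?Y \<le> ?Y * (K' * bform d V x x)" by (simp add: power2_eq_square mult_ac)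
    moreover have "?Y \<ge> 0" by (intro sum_nonneg) auto
    ultimately have "?Y \<le> K' * bform d V x x"
      using psd[of x] K' by (cases "?Y = 0") (auto simp: mult_le_cancel_left)
    then have "K * ?Y \<le> K * (K' * bform d V x x)" using K(1) by (intro mult_left_mono) auto
    with 1 show ?thesis by (simp add: mult_ac)
  qed
  then show ?thesis using K(1) K'(1)
    by (intro exI[of _ "1 / (K * K')"]) (auto simp: field_simps)
qed

section \<open>The smallest singular value and left inverses\<close>

text \<open>As all roots of the characteristic polynomial are real, the sorted list of singular
  values has exactly \<open>n\<close> entries. Entry \<open>n - 1\<close> of the decreasing list is
  then its minimum, and \<open>sqrt t\<close> is one of the entries.\<close>

lemma singular_value_gram_root:
  assumes M: "M \<in> carrier_mat m n" and n: "n \<ge> 1" and \<alpha>: "\<alpha> > 0" and sv: "singular_value n M \<ge> \<alpha>"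
    and root: "poly (char_poly (transpose_mat M * M)) t = 0" and t: "t \<ge> 0"
  shows "\<alpha>\<^sup>2 \<le> t"
proof -
  let ?B = "transpose_mat M * M"
  let ?P = "proots (char_poly ?B)"
  have B: "?B \<in> carrier_mat n n" using M by simp
  have sym: "?B $$ (i, j) = ?B $$ (j, i)" if "i < n" "j < n" for i j
    using that M by (auto simp: scalar_prod_def intro!: sum.cong)
  have p0: "char_poly ?B \<noteq> 0" using degree_monic_char_poly[OF B] by auto
  have "size ?P = degree (char_poly ?B)"
    by (rule size_proots_real_roots[OF p0]) (rule symmetric_char_poly_root_real[OF B sym])
  then have "size ?P = n" using degree_monic_char_poly[OF B] by simp
  moreover define l where "l = sorted_list_of_multiset (image_mset sqrt ?P)"
  ultimately have len: "length l = n" by (simp add: size_mset[symmetric] del: size_mset)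
  have "t \<in># ?P" using root p0 by simp
  then have "sqrt t \<in> set l" unfolding l_def by (simp add: set_sorted_list_of_multiset)
  then obtain i where i: "i < n" "l ! i = sqrt t" using len by (auto simp: in_set_conv_nth)
  have "\<alpha> \<le> singular_value n M" by fact
  \<comment> \<open>A value of at least \<open>\<alpha> > 0\<close> rules out the default 0 of
    \<open>singular_value\<close>.\<close>
  also have "singular_value n M = rev l ! (n - 1)"
    using sv \<alpha> M unfolding singular_value_def singular_values_def l_def by (auto split: if_splits)
  also have "\<dots> = l ! 0" using len n by (simp add: rev_nth)
  also have "\<dots> \<le> l ! i" using i len unfolding l_def by (intro sorted_nth_mono) auto
  finally have "\<alpha> \<le> sqrt t" using i by simp
  then show ?thesis using \<alpha> t by (metis less_eq_real_def power_mono real_sqrt_pow2)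
qed

text \<open>Let \<open>t\<close> be the largest constant for which the inequality holds, and suppose
  it is below \<open>\<alpha>\<close> squared. The matrix \<open>V\<close>, which is the Gram matrix
  minus \<open>t\<close> times the identity, is positive semidefinite. If it is injective, it is
  coercive and \<open>t\<close> could be increased; if not, \<open>t\<close> is an eigenvalue of the
  Gram matrix, and \<open>singular_value_gram_root\<close> puts it above \<open>\<alpha>\<close>
  squared.\<close>

lemma singular_value_lower_bound:
  assumes M: "M \<in> carrier_mat m n" and n: "n \<ge> 1" and \<alpha>: "\<alpha> > 0" and sv: "singular_value n M \<ge> \<alpha>"
  shows "\<alpha>\<^sup>2 * (\<Sum>i<n. (x i)\<^sup>2) \<le> (\<Sum>k<m. (\<Sum>i<n. M $$ (k, i) * x i)\<^sup>2)"
proof -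
  let ?B = "transpose_mat M * M"
  have B: "?B \<in> carrier_mat n n" using M by simp
  define Q where "Q x = (\<Sum>k<m. (\<Sum>i<n. M $$ (k, i) * x i)\<^sup>2)" for x
  define N where "N x = (\<Sum>i<n. (x i)\<^sup>2)" for x :: "nat \<Rightarrow> real"
  define b where "b i j = (\<Sum>k<m. M $$ (k, i) * M $$ (k, j))" for i j
  define T where "T = {t. 0 \<le> t \<and> (\<forall>x. t * N x \<le> Q x)}"
  have Q0: "0 \<le> Q x" for x unfolding Q_def by (intro sum_nonneg) auto
  have N0: "0 \<le> N x" for x unfolding N_def by (intro sum_nonneg) auto
  have T0: "0 \<in> T" using Q0 by (simp add: T_def)
  have down: "t \<in> T" if "s \<in> T" "0 \<le> t" "t \<le> s" for s t
    using that N0 unfolding T_def by (auto intro: order_trans[OF mult_right_mono])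
  have "\<alpha>\<^sup>2 \<in> T"
  proof (rule ccontr)
    assume na: "\<alpha>\<^sup>2 \<notin> T"
    then have ub: "t \<le> \<alpha>\<^sup>2" if "t \<in> T" for t using down[OF that, of "\<alpha>\<^sup>2"] by force
    then have bdd: "bdd_above T" by (rule bdd_aboveI)
    define t where "t = Sup T"
    have t0: "0 \<le> t" unfolding t_def using T0 bdd by (rule cSup_upper)
    have "t * N x \<le> Q x" for x
    proof (cases "N x = 0")
      case False
      then have Nx: "N x > 0" using N0[of x] by simp
      have "t \<le> Q x / N x" unfolding t_def
        using Nx T0 by (intro cSup_least) (auto simp: T_def field_simps)
      then show ?thesis using Nx by (simp add: field_simps)
    qed (use Q0 in simp)
    then have tT: "t \<in> T" using t0 by (simp add: T_def)
    then have "t \<noteq> \<alpha>\<^sup>2" using na by auto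
    then have t\<alpha>: "t < \<alpha>\<^sup>2" using ub[OF tT] by simp
    define V where "V i j = b i j - (if i = j then t else 0)" for i j
    have mv: "(\<Sum>j<n. V i j * x j) = (\<Sum>j<n. b i j * x j) - t * x i" if "i < n" for x i
      using that by (simp add: V_def left_diff_distrib sum_subtractf if_distribR if_distrib[of "\<lambda>c. c * _"] cong: if_cong)
    have Vf: "bform n V x x = Q x - t * N x" for x
    proof -
      have "bform n V x x = (\<Sum>i<n. x i * ((\<Sum>j<n. b i j * x j) - t * x i))"
        unfolding bform_def by (intro sum.cong refl) (simp add: mv)
      also have "\<dots> = (\<Sum>i<n. x i * (\<Sum>j<n. b i j * x j)) - t * N x"
        by (simp add: N_def sum_subtractf algebra_simps sum_distrib_left power2_eq_square)
      also have "(\<Sum>i<n. x i * (\<Sum>j<n. b i j * x j)) =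
          (\<Sum>i<n. \<Sum>j<n. \<Sum>k<m. (M $$ (k, i) * x i) * (M $$ (k, j) * x j))"
        by (simp add: b_def sum_distrib_left sum_distrib_right mult_ac)
      also have "\<dots> = (\<Sum>k<m. \<Sum>i<n. \<Sum>j<n. (M $$ (k, i) * x i) * (M $$ (k, j) * x j))"
        by (subst sum.swap[of _ "{..<n}" "{..<m}"], subst sum.swap[of _ "{..<n}" "{..<m}"]) (rule refl)
      also have "\<dots> = Q x" by (simp add: Q_def power2_eq_square sum_product)
      finally show ?thesis .
    qed
    have "\<exists>\<epsilon>>0. \<forall>x. \<epsilon> * (\<Sum>i<n. (x i)\<^sup>2) \<le> bform n V x x"
    proof (rule psd_injective_imp_coercive)
      show "V i j = V j i" for i j by (simp add: V_def b_def mult.commute)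
      show "0 \<le> bform n V x x" for x using tT by (simp add: Vf T_def)
      show "\<forall>v. (\<forall>i<n. (\<Sum>j<n. V i j * v j) = 0) \<longrightarrow> (\<forall>i<n. v i = 0)"
      proof (intro allI impI, rule ccontr)
        fix v i assume v: "\<forall>i<n. (\<Sum>j<n. V i j * v j) = 0" and i: "i < n"
        assume vi: "v i \<noteq> 0"
        let ?w = "Matrix.vec n v"
        have "?w \<noteq> 0\<^sub>v n" using vi i by (metis index_vec index_zero_vec(1))
        moreover have "?B *\<^sub>v ?w = t \<cdot>\<^sub>v ?w"
        proof (rule eq_vecI)
          fix k assume "k < dim_vec (t \<cdot>\<^sub>v ?w)"
          then have k: "k < n" by simp
          have "(?B *\<^sub>v ?w) $ k = (\<Sum>j<n. b k j * v j)"
          proof -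
            have "(?B *\<^sub>v ?w) $ k = (\<Sum>j<n. (\<Sum>l<m. M $$ (l, k) * M $$ (l, j)) * v j)"
              using k M by (subst index_mult_mat_vec) (auto simp: scalar_prod_def atLeast0LessThan intro!: sum.cong)
            then show ?thesis by (simp add: b_def)
          qed
          also have "\<dots> = t * v k" using v[rule_format, OF k] mv[OF k] by simp
          finally show "(?B *\<^sub>v ?w) $ k = (t \<cdot>\<^sub>v ?w) $ k" using k by simp
        qed (use M in simp)
        ultimately have "eigenvalue ?B t"
          unfolding eigenvalue_def eigenvector_def using M by (intro exI[of _ ?w]) auto
        then have "poly (char_poly ?B) t = 0" using eigenvalue_root_char_poly[OF B] by simp
        from singular_value_gram_root[OF M n \<alpha> sv this t0] t\<alpha> show False by simp
      qed
    qed
    then obtain \<epsilon> where \<epsilon>: "\<epsilon> > 0" "\<And>x. \<epsilon> * N x \<le> Q x - t * N x" by (auto simp: Vf N_def)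
    then have "t + \<epsilon> \<in> T" using t0 by (auto simp: T_def algebra_simps)
    then have "t + \<epsilon> \<le> t" unfolding t_def using bdd by (intro cSup_upper)
    with \<epsilon>(1) show False by simp
  qed
  then show ?thesis by (simp add: T_def Q_def N_def)
qed

text \<open>\<open>L\<close> is the Moore-Penrose inverse: the inverse of the Gram matrix times the
  transpose of \<open>M\<close>. The entry bound has no dimension factor, because it comes from the
  norm of a whole column of \<open>L\<close>.\<close>

lemma left_inverse_exists:
  fixes M :: "nat \<Rightarrow> nat \<Rightarrow> real"
  assumes \<alpha>: "\<alpha> > 0"
    and lb: "\<And>x. \<alpha>\<^sup>2 * (\<Sum>i<n. (x i)\<^sup>2) \<le> (\<Sum>k<m. (\<Sum>i<n. M k i * x i)\<^sup>2)"
  shows "\<exists>L. (\<forall>i<n. \<forall>j<n. (\<Sum>k<m. L i k * M k j) = (if i = j then 1 else 0)) \<and>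
             (\<forall>i<n. \<forall>k<m. \<bar>L i k\<bar> \<le> inverse \<alpha>)"
proof -
  define G where "G i j = (\<Sum>k<m. M k i * M k j)" for i j
  have Gf: "bform n G x x = (\<Sum>k<m. (\<Sum>i<n. M k i * x i)\<^sup>2)" for x
  proof -
    have "bform n G x x = (\<Sum>i<n. \<Sum>j<n. \<Sum>k<m. (M k i * x i) * (M k j * x j))"
      by (simp add: bform_expand G_def sum_distrib_left sum_distrib_right mult_ac)
    also have "\<dots> = (\<Sum>k<m. \<Sum>i<n. \<Sum>j<n. (M k i * x i) * (M k j * x j))"
      by (subst (2) sum.swap) (intro sum.cong refl sum.swap)
    finally show ?thesis by (simp add: power2_eq_square sum_product)
  qed
  have inj: "\<forall>v. (\<forall>i<n. (\<Sum>j<n. G i j * v j) = 0) \<longrightarrow> (\<forall>i<n. v i = 0)"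
  proof (intro allI impI)
    fix v i assume that: "\<forall>i<n. (\<Sum>j<n. G i j * v j) = 0" and i: "i < n"
    have "bform n G v v = 0" using that by (simp add: bform_def)
    then have "\<alpha>\<^sup>2 * (\<Sum>i<n. (v i)\<^sup>2) \<le> 0" using lb[of v] by (simp add: Gf)
    then have "(\<Sum>i<n. (v i)\<^sup>2) \<le> 0" using \<alpha> by (simp add: mult_le_0_iff)
    moreover have "(v i)\<^sup>2 \<le> (\<Sum>i<n. (v i)\<^sup>2)" by (rule member_le_sum) (use i in auto)
    ultimately have "(v i)\<^sup>2 \<le> 0" by linarith
    then show "v i = 0" by simp
  qed
  obtain W where WG: "\<And>i k. i < n \<Longrightarrow> k < n \<Longrightarrow> (\<Sum>j<n. W i j * G j k) = (if i = k then 1 else 0)"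
    and GW: "\<And>i k. i < n \<Longrightarrow> k < n \<Longrightarrow> (\<Sum>j<n. G i j * W j k) = (if i = k then 1 else 0)"
    using injective_imp_inverse(2)[of n G, OF inj] by blast
  define L where "L i k = (\<Sum>j<n. W i j * M k j)" for i k
  have "(\<Sum>k<m. L i k * M k j) = (if i = j then 1 else 0)" if "i < n" "j < n" for i j
  proof -
    have "(\<Sum>k<m. L i k * M k j) = (\<Sum>l<n. W i l * G l j)"
      unfolding L_def G_def sum_distrib_left sum_distrib_right by (subst sum.swap) (simp add: mult_ac)
    then show ?thesis using WG that by simp
  qed
  moreover have "\<bar>L i k\<bar> \<le> inverse \<alpha>" if i: "i < n" and k: "k < m" for i k
  proof -
    \<comment> \<open>Column \<open>k\<close> of \<open>L\<close>. Its image \<open>y\<close> under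
      \<open>M\<close> is the orthogonal projection of the \<open>k\<close>-th unit vector onto the
      range of \<open>M\<close>, whence \<open>|y|^2 = y k <= 1\<close>; the lower bound for
      \<open>M\<close> carries this over to \<open>v\<close>.\<close>
    define v where "v i = L i k" for i
    define y where "y l = (\<Sum>i<n. M l i * v i)" for l
    have Gv: "(\<Sum>j<n. G i j * v j) = M k i" if "i < n" for i
    proof -
      have "(\<Sum>j<n. G i j * v j) = (\<Sum>l<n. (\<Sum>j<n. G i j * W j l) * M k l)"
        unfolding v_def L_def sum_distrib_left sum_distrib_right by (subst sum.swap) (simp add: mult_ac)
      also have "\<dots> = (\<Sum>l<n. if l = i then M k l else 0)" using that by (intro sum.cong refl) (simp add: GW)
      finally show ?thesis using that by simp
    qed
    have "bform n G v v = y k" by (simp add: bform_def Gv y_def mult.commute[of "v _"])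
    then have yy: "(\<Sum>l<m. (y l)\<^sup>2) = y k" by (simp add: Gf y_def)
    have "(y k)\<^sup>2 \<le> (\<Sum>l<m. (y l)\<^sup>2)" by (rule member_le_sum) (use k in auto)
    then have "y k * y k \<le> y k" unfolding yy by (simp add: power2_eq_square)
    then have "y k \<le> 1" by (auto simp: mult_le_cancel_left2)
    then have "\<alpha>\<^sup>2 * (\<Sum>i<n. (v i)\<^sup>2) \<le> 1" using lb[of v] yy by (simp add: y_def)
    moreover have "\<alpha>\<^sup>2 * (v i)\<^sup>2 \<le> \<alpha>\<^sup>2 * (\<Sum>i<n. (v i)\<^sup>2)"
      by (intro mult_left_mono member_le_sum) (use i in auto)
    ultimately have "(\<alpha> * \<bar>v i\<bar>)\<^sup>2 \<le> 1\<^sup>2" by (simp add: power_mult_distrib)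
    then have "\<alpha> * \<bar>v i\<bar> \<le> 1" by (rule power2_le_imp_le) simp
    then show ?thesis using \<alpha> by (simp add: v_def field_simps)
  qed
  ultimately show ?thesis by (intro exI[of _ L]) blast
qed

section \<open>Determinants and the elliptical potential\<close>

text \<open>The matrix determinant lemma, from two factorisations of the block matrix
  \<open>?M\<close> with rows \<open>(V, -x)\<close> and \<open>(x^T, 1)\<close>: clearing its upper
  right block by a row operation produces the updated matrix, while the other factorisation splits
  off \<open>V\<close> and leaves the scalar \<open>1 + x^T y\<close>.\<close>

lemma det_rank_one_update:
  fixes V :: "nat \<Rightarrow> nat \<Rightarrow> real"
  assumes y: "\<And>i. i < d \<Longrightarrow> (\<Sum>j<d. V i j * y j) = x i"
  shows "det (Matrix.mat d d (\<lambda>(i, j). V i j + x i * x j)) =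
         det (Matrix.mat d d (\<lambda>(i, j). V i j)) * (1 + (\<Sum>i<d. x i * y i))"
proof -
  let ?V = "Matrix.mat d d (\<lambda>(i, j). V i j)"
  let ?U = "Matrix.mat d d (\<lambda>(i, j). V i j + x i * x j)"
  let ?x = "Matrix.mat d 1 (\<lambda>(i, j). x i)" and ?xn = "Matrix.mat d 1 (\<lambda>(i, j). - x i)"
  let ?yn = "Matrix.mat d 1 (\<lambda>(i, j). - y i)" and ?xt = "Matrix.mat 1 d (\<lambda>(i, j). x j)"
  let ?s = "Matrix.mat 1 1 (\<lambda>(i, j). 1 + (\<Sum>i<d. x i * y i))"
  let ?M = "four_block_mat ?V ?xn ?xt (1\<^sub>m 1)"
  have M: "?M \<in> carrier_mat (d + 1) (d + 1)" by (intro four_block_carrier_mat) auto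
  have 1: "four_block_mat (1\<^sub>m d) ?x (0\<^sub>m 1 d) (1\<^sub>m 1) * ?M = four_block_mat ?U (0\<^sub>m d 1) ?xt (1\<^sub>m 1)"
    by (subst mult_four_block_mat[of _ d d _ 1 _ 1 _ _ d _ 1])
       (auto intro!: arg_cong4[where f=four_block_mat] eq_matI simp: scalar_prod_def)
  have 2: "four_block_mat ?V (0\<^sub>m d 1) ?xt (1\<^sub>m 1) * four_block_mat (1\<^sub>m d) ?yn (0\<^sub>m 1 d) ?s = ?M"
    by (subst mult_four_block_mat[of _ d d _ 1 _ 1 _ _ d _ 1])
       (auto intro!: arg_cong4[where f=four_block_mat] eq_matI
             simp: scalar_prod_def atLeast0LessThan sum_negf y)
  have "det ?M = det ?V * (1 + (\<Sum>i<d. x i * y i))"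
    unfolding 2[symmetric]
    by (subst det_mult[of _ "d + 1"], (intro four_block_carrier_mat; simp)+)
       (simp add: det_four_block_mat_upper_right_zero[of _ d _ 1]
          det_four_block_mat_lower_left_zero[of _ d _ 1] det_single)
  moreover have "det ?U = det ?M"
    using arg_cong[OF 1, of det]
    by (subst (asm) det_mult[OF _ M], (intro four_block_carrier_mat; simp)+)
       (simp add: det_four_block_mat_upper_right_zero[of _ d _ 1]
          det_four_block_mat_lower_left_zero[of _ d _ 1])
  ultimately show ?thesis by simp
qed

text \<open>The Leibniz formula is enough in place of Hadamard's inequality, because only the
  logarithm of the bound will matter.\<close>

lemma abs_det_le:
  fixes V :: "nat \<Rightarrow> nat \<Rightarrow> real"
  assumes "\<And>i j. i < d \<Longrightarrow> j < d \<Longrightarrow> \<bar>V i j\<bar> \<le> c"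
  shows "\<bar>det (Matrix.mat d d (\<lambda>(i, j). V i j))\<bar> \<le> fact d * c ^ d"
proof -
  let ?V = "Matrix.mat d d (\<lambda>(i, j). V i j)"
  have "\<bar>det ?V\<bar> = \<bar>\<Sum>p | p permutes {0..<d}. signof p * (\<Prod>i = 0..<d. ?V $$ (i, p i))\<bar>"
    by (subst det_def'[of _ d]) auto
  also have "\<dots> \<le> (\<Sum>p | p permutes {0..<d}. \<bar>signof p * (\<Prod>i = 0..<d. ?V $$ (i, p i))\<bar>)"
    by (rule sum_abs)
  also have "\<dots> \<le> (\<Sum>p | p permutes {0..<d}. c ^ d)"
  proof (rule sum_mono)
    fix p assume "p \<in> {p. p permutes {0..<d}}"
    then have p: "p i < d" if "i < d" for i using that permutes_in_image[of p "{0..<d}" i] by auto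
    have "(\<Prod>i = 0..<d. \<bar>?V $$ (i, p i)\<bar>) \<le> (\<Prod>i = 0..<d. c)"
      by (intro prod_mono) (auto simp: p assms)
    then show "\<bar>signof p * (\<Prod>i = 0..<d. ?V $$ (i, p i))\<bar> \<le> c ^ d"
      by (cases "evenperm p") (simp_all add: abs_mult abs_prod sign_def)
  qed
  also have "\<dots> = fact d * c ^ d" by (simp add: card_permutations)
  finally show ?thesis .
qed

text \<open>The regularised design matrix before round \<open>n\<close>: the identity plus the outer
  products of the vectors of all earlier rounds.\<close>

definition gram :: "(nat \<Rightarrow> nat \<Rightarrow> real) \<Rightarrow> nat \<Rightarrow> nat \<Rightarrow> nat \<Rightarrow> real" where
  "gram x n i j = (if i = j then 1 else 0) + (\<Sum>t<n. x t i * x t j)"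

lemma bform_gram:
  "bform d (gram x n) u z = (\<Sum>i<d. u i * z i) + (\<Sum>t<n. (\<Sum>i<d. u i * x t i) * (\<Sum>i<d. z i * x t i))"
proof -
  have "bform d (gram x n) u z =
      (\<Sum>i<d. \<Sum>j<d. if i = j then u i * z j else 0) + (\<Sum>i<d. \<Sum>j<d. \<Sum>t<n. (u i * x t i) * (z j * x t j))"
    unfolding bform_expand gram_def sum.distrib[symmetric]
    by (intro sum.cong refl) (auto simp: algebra_simps sum_distrib_left)
  also have "(\<Sum>i<d. \<Sum>j<d. \<Sum>t<n. (u i * x t i) * (z j * x t j)) =
      (\<Sum>t<n. \<Sum>i<d. \<Sum>j<d. (u i * x t i) * (z j * x t j))"
    by (subst sum.swap[of _ "{..<d}" "{..<n}"], subst sum.swap[of _ "{..<d}" "{..<n}"]) (rule refl)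
  finally show ?thesis by (simp add: sum_product)
qed

text \<open>\<open>q\<close> is the squared length of \<open>x n\<close> in the norm dual to the
  Gram form, that is, the form at the solution \<open>y\<close> of \<open>gram x n\<close> applied
  to \<open>y = x n\<close>. It is at most 1, as the form dominates the Euclidean norm and
  \<open>x n\<close> lies in the unit ball.\<close>

lemma gram_step:
  assumes x: "(\<Sum>i<d. (x n i)\<^sup>2) \<le> 1"
  shows "\<exists>q. 0 \<le> q \<and> q \<le> 1 \<and>
    det (Matrix.mat d d (\<lambda>(i, j). gram x (Suc n) i j)) =
      det (Matrix.mat d d (\<lambda>(i, j). gram x n i j)) * (1 + q) \<and>
    (\<forall>w. (\<Sum>i<d. w i * x n i)\<^sup>2 \<le> bform d (gram x n) w w * q)"
proof -
  let ?V = "gram x n"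
  have sym: "?V i j = ?V j i" for i j by (simp add: gram_def mult.commute)
  have lb: "(\<Sum>i<d. (u i)\<^sup>2) \<le> bform d ?V u u" for u
    by (simp add: bform_gram power2_eq_square sum_nonneg)
  have psd: "0 \<le> bform d ?V u u" for u
    using lb[of u] sum_nonneg[of "{..<d}" "\<lambda>i. (u i)\<^sup>2"] by simp
  have inj: "\<forall>v. (\<forall>i<d. (\<Sum>j<d. ?V i j * v j) = 0) \<longrightarrow> (\<forall>i<d. v i = 0)"
  proof (intro allI impI)
    fix v i assume "\<forall>i<d. (\<Sum>j<d. ?V i j * v j) = 0" and i: "i < d"
    then have "bform d ?V v v = 0" by (simp add: bform_def)
    then have "(\<Sum>i<d. (v i)\<^sup>2) \<le> 0" using lb[of v] by simp
    moreover have "(v i)\<^sup>2 \<le> (\<Sum>i<d. (v i)\<^sup>2)" by (rule member_le_sum) (use i in auto)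
    ultimately have "(v i)\<^sup>2 \<le> 0" by linarith
    then show "v i = 0" by simp
  qed
  obtain W where W: "\<And>i k. i < d \<Longrightarrow> k < d \<Longrightarrow> (\<Sum>j<d. ?V i j * W j k) = (if i = k then 1 else 0)"
    using injective_imp_inverse(2)[OF inj] by blast
  define y where "y j = (\<Sum>k<d. W j k * x n k)" for j
  have y: "(\<Sum>j<d. ?V i j * y j) = x n i" if "i < d" for i
  proof -
    have "(\<Sum>j<d. ?V i j * y j) = (\<Sum>k<d. (\<Sum>j<d. ?V i j * W j k) * x n k)"
      unfolding y_def sum_distrib_left sum_distrib_right by (subst sum.swap) (simp add: mult_ac)
    also have "\<dots> = (\<Sum>k<d. if k = i then x n k else 0)" using that by (intro sum.cong refl) (simp add: W)
    finally show ?thesis using that by simp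
  qed
  define q where "q = (\<Sum>i<d. x n i * y i)"
  have B: "bform d ?V w y = (\<Sum>i<d. w i * x n i)" for w by (simp add: bform_def y)
  have qB: "q = bform d ?V y y" by (simp add: B q_def mult.commute)
  have CS: "(\<Sum>i<d. w i * x n i)\<^sup>2 \<le> bform d ?V w w * q" for w
    using psd_Cauchy_Schwarz[of d ?V w y, OF sym psd] by (simp add: B qB)
  have q0: "0 \<le> q" using qB psd by simp
  have "q\<^sup>2 \<le> (\<Sum>i<d. (x n i)\<^sup>2) * (\<Sum>i<d. (y i)\<^sup>2)"
    unfolding q_def by (rule Cauchy_Schwarz_ineq_sum)
  also have "\<dots> \<le> 1 * q" using x lb[of y] q0 qB by (intro mult_mono) (auto intro: sum_nonneg)
  finally have "q * q \<le> q" by (simp add: power2_eq_square)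
  then have "q \<le> 1" using q0 by (auto simp: mult_le_cancel_left2)
  moreover have "det (Matrix.mat d d (\<lambda>(i, j). gram x (Suc n) i j)) =
      det (Matrix.mat d d (\<lambda>(i, j). gram x n i j)) * (1 + q)"
  proof -
    have "Matrix.mat d d (\<lambda>(i, j). gram x (Suc n) i j) =
        Matrix.mat d d (\<lambda>(i, j). ?V i j + x n i * x n j)"
      by (auto intro!: eq_matI simp: gram_def)
    then show ?thesis using det_rank_one_update[of d ?V y "x n", OF y] by (simp add: q_def)
  qed
  ultimately show ?thesis using q0 CS by blast
qed

text \<open>The Gram form of round \<open>k\<close> at \<open>w k\<close> is at most
  \<open>\<rho> + \<zeta>\<close>, so each summand is at most
  \<open>(\<rho> + \<zeta>) * q k\<close>. The determinant grows by the factor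
  \<open>1 + q k\<close> in round \<open>k\<close> but stays polynomial in the number of rounds,
  which bounds the sum of the \<open>q k\<close> logarithmically.\<close>

lemma elliptical_potential:
  assumes d: "d \<ge> 1"
    and x: "\<And>t. t < n \<Longrightarrow> (\<Sum>i<d. (x t i)\<^sup>2) \<le> 1"
    and w: "\<And>k. k < n \<Longrightarrow> (\<Sum>i<d. (w k i)\<^sup>2) \<le> \<rho>"
    and \<zeta>: "\<And>k. k < n \<Longrightarrow> (\<Sum>t<k. (\<Sum>i<d. w k i * x t i)\<^sup>2) \<le> \<zeta>" and nonneg: "0 \<le> \<rho>" "0 \<le> \<zeta>"
  shows "(\<Sum>k<n. (\<Sum>i<d. w k i * x k i)\<^sup>2) \<le> (\<rho> + \<zeta>) * (2 * real d * (ln d + ln (1 + real n)))"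
proof -
  define D where "D k = det (Matrix.mat d d (\<lambda>(i, j). gram x k i j))" for k
  have "\<forall>k<n. \<exists>q. 0 \<le> q \<and> q \<le> 1 \<and> D (Suc k) = D k * (1 + q) \<and>
      (\<forall>w. (\<Sum>i<d. w i * x k i)\<^sup>2 \<le> bform d (gram x k) w w * q)"
    unfolding D_def by (intro allI impI gram_step x)
  then obtain q where q: "\<And>k. k < n \<Longrightarrow> 0 \<le> q k" "\<And>k. k < n \<Longrightarrow> q k \<le> 1"
    "\<And>k. k < n \<Longrightarrow> D (Suc k) = D k * (1 + q k)"
    "\<And>k w. k < n \<Longrightarrow> (\<Sum>i<d. w i * x k i)\<^sup>2 \<le> bform d (gram x k) w w * q k"
    by metis
  have "D 0 = det (1\<^sub>m d :: real mat)"
    unfolding D_def by (rule arg_cong[where f=det]) (auto intro!: eq_matI simp: gram_def)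
  then have D: "D k = (\<Prod>t<k. 1 + q t)" if "k \<le> n" for k
    using that by (induction k) (auto simp: q)
  have Dn: "D n \<le> (real d * (1 + real n)) ^ d"
  proof -
    have "\<bar>gram x n i j\<bar> \<le> 1 + real n" if ij: "i < d" "j < d" for i j
    proof -
      have "\<bar>x t i * x t j\<bar> \<le> 1" if t: "t < n" for t
      proof -
        have "(x t i)\<^sup>2 \<le> (\<Sum>i<d. (x t i)\<^sup>2)" "(x t j)\<^sup>2 \<le> (\<Sum>i<d. (x t i)\<^sup>2)"
          by (rule member_le_sum; use ij in auto)+
        then have "(x t i)\<^sup>2 \<le> 1" "(x t j)\<^sup>2 \<le> 1" using x[OF t] by auto
        then have "\<bar>x t i\<bar> \<le> 1" "\<bar>x t j\<bar> \<le> 1" by (auto simp: abs_square_le_1)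
        then show ?thesis by (simp add: abs_mult mult_le_one)
      qed
      then have "\<bar>\<Sum>t<n. x t i * x t j\<bar> \<le> (\<Sum>t<n. 1)"
        by (intro order_trans[OF sum_abs] sum_mono) auto
      then show ?thesis by (auto simp: gram_def)
    qed
    then have "\<bar>D n\<bar> \<le> fact d * (1 + real n) ^ d" unfolding D_def by (rule abs_det_le)
    also have "\<dots> \<le> real (d ^ d) * (1 + real n) ^ d"
      by (intro mult_right_mono) (use fact_le_power[of d] in simp_all)
    finally show ?thesis by (simp add: power_mult_distrib)
  qed
  \<comment> \<open>This is where \<open>q k <= 1\<close> is used:
    \<open>ln (1 + q) >= q / (1 + q) >= q / 2\<close>.\<close>
  have "(\<Sum>k<n. q k) \<le> (\<Sum>k<n. 2 * ln (1 + q k))"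
  proof (rule sum_mono)
    fix k assume "k \<in> {..<n}"
    then have k: "0 \<le> q k" "q k \<le> 1" using q by auto
    have "ln (1 / (1 + q k)) \<le> 1 / (1 + q k) - 1" by (rule ln_le_minus_one) (use k in auto)
    then have "q k / (1 + q k) \<le> ln (1 + q k)" using k by (simp add: ln_div field_simps)
    moreover have "q k / 2 \<le> q k / (1 + q k)" using k by (intro divide_left_mono) auto
    ultimately have "q k / 2 \<le> ln (1 + q k)" by (rule order_trans[rotated])
    then show "q k \<le> 2 * ln (1 + q k)" by simp
  qed
  also have "\<dots> = 2 * ln (D n)"
  proof -
    have "ln (\<Prod>k<n. 1 + q k) = (\<Sum>k<n. ln (1 + q k))"
      by (rule ln_prod) (use q(1) in \<open>force simp: add_nonneg_eq_0_iff\<close>)+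
    then show ?thesis by (simp add: D sum_distrib_left)
  qed
  also have "\<dots> \<le> 2 * ln ((real d * (1 + real n)) ^ d)"
  proof -
    have "D n > 0" unfolding D[OF order_refl] by (intro prod_pos) (use q in \<open>auto intro: add_pos_nonneg\<close>)
    with Dn show ?thesis by simp
  qed
  also have "\<dots> = 2 * real d * (ln d + ln (1 + real n))"
    using d by (simp add: ln_realpow ln_mult)
  finally have sq: "(\<Sum>k<n. q k) \<le> 2 * real d * (ln d + ln (1 + real n))" .
  have "(\<Sum>k<n. (\<Sum>i<d. w k i * x k i)\<^sup>2) \<le> (\<Sum>k<n. (\<rho> + \<zeta>) * q k)"
  proof (rule sum_mono)
    fix k assume k: "k \<in> {..<n}"
    have "(\<Sum>i<d. w k i * x k i)\<^sup>2 \<le> bform d (gram x k) (w k) (w k) * q k" using q k by auto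
    also have "bform d (gram x k) (w k) (w k) \<le> \<rho> + \<zeta>"
      using w[of k] \<zeta>[of k] k by (simp add: bform_gram power2_eq_square)
    finally show "(\<Sum>i<d. w k i * x k i)\<^sup>2 \<le> (\<rho> + \<zeta>) * q k"
      using q k by (simp add: mult_right_mono)
  qed
  also have "\<dots> = (\<rho> + \<zeta>) * (\<Sum>k<n. q k)" by (simp add: sum_distrib_left)
  also have "\<dots> \<le> (\<rho> + \<zeta>) * (2 * real d * (ln d + ln (1 + real n)))"
    using sq nonneg by (intro mult_left_mono) auto
  finally show ?thesis .
qed

lemma sum_le_sqrt_card:
  fixes a :: "nat \<Rightarrow> real"
  assumes "(\<Sum>k<n. (a k)\<^sup>2) \<le> b"
  shows "(\<Sum>k<n. a k) \<le> sqrt (real n * b)"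
proof -
  have "(\<Sum>k<n. a k * 1)\<^sup>2 \<le> (\<Sum>k<n. (a k)\<^sup>2) * (\<Sum>k<n. 1\<^sup>2)"
    by (rule Cauchy_Schwarz_ineq_sum)
  also have "\<dots> \<le> b * real n" using assms by (simp add: mult_right_mono)
  finally show ?thesis by (intro real_le_rsqrt) (simp add: mult.commute)
qed

text \<open>
  Choosing the signs by which \<open>w t\<close> turns \<open>\<Sum>\<tau>. \<bar>w t \<bullet> x t \<tau>\<bar>\<close> into \<open>w t \<bullet> z t\<close> leaves a single vector
  \<open>z t\<close> per round, for which the signs can only decrease \<open>\<Sum>\<tau>. \<bar>w k \<bullet> x t \<tau>\<bar>\<close> for \<open>k \<noteq> t\<close>.
\<close>

lemma eluder_sum:
  fixes w :: "nat \<Rightarrow> nat \<Rightarrow> real" and x :: "nat \<Rightarrow> 'a \<Rightarrow> nat \<Rightarrow> real"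
  assumes d: "d \<ge> 1" and nonneg: "0 \<le> R" "0 \<le> \<zeta>"
    and x: "\<And>t. t < n \<Longrightarrow> (\<Sum>\<tau>\<in>X. \<Sum>i<d. \<bar>x t \<tau> i\<bar>) \<le> 1"
    and w: "\<And>k i. k < n \<Longrightarrow> i < d \<Longrightarrow> \<bar>w k i\<bar> \<le> R"
    and \<zeta>: "\<And>k. k < n \<Longrightarrow> (\<Sum>t<k. (\<Sum>\<tau>\<in>X. \<bar>\<Sum>i<d. w k i * x t \<tau> i\<bar>)\<^sup>2) \<le> \<zeta>"
  shows "(\<Sum>k<n. \<Sum>\<tau>\<in>X. \<bar>\<Sum>i<d. w k i * x k \<tau> i\<bar>) \<le>
    sqrt (real n * ((real d * R\<^sup>2 + \<zeta>) * (2 * real d * (ln d + ln (1 + real n)))))"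
proof -
  define z where "z t i = (\<Sum>\<tau>\<in>X. sgn (\<Sum>i<d. w t i * x t \<tau> i) * x t \<tau> i)" for t i
  have wz: "(\<Sum>i<d. w k i * z t i) = (\<Sum>\<tau>\<in>X. sgn (\<Sum>i<d. w t i * x t \<tau> i) * (\<Sum>i<d. w k i * x t \<tau> i))" for k t
    unfolding z_def sum_distrib_left by (subst sum.swap) (simp add: mult_ac)
  have diag: "(\<Sum>i<d. w k i * z k i) = (\<Sum>\<tau>\<in>X. \<bar>\<Sum>i<d. w k i * x k \<tau> i\<bar>)" for k
    unfolding wz by (intro sum.cong refl) (simp add: abs_sgn mult.commute)
  have "(\<Sum>k<n. (\<Sum>i<d. w k i * z k i)\<^sup>2) \<le>
      (real d * R\<^sup>2 + \<zeta>) * (2 * real d * (ln d + ln (1 + real n)))"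
  proof (rule elliptical_potential[OF d])
    fix t assume t: "t < n"
    have z: "(\<Sum>i<d. \<bar>z t i\<bar>) \<le> 1"
    proof -
      have "(\<Sum>i<d. \<bar>z t i\<bar>) \<le> (\<Sum>i<d. \<Sum>\<tau>\<in>X. \<bar>x t \<tau> i\<bar>)"
        unfolding z_def
        by (intro sum_mono order_trans[OF sum_abs]) (auto simp: abs_mult abs_sgn_eq mult_left_le_one_le)
      also have "\<dots> \<le> 1" by (subst sum.swap) (rule x[OF t])
      finally show ?thesis .
    qed
    have "(\<Sum>i<d. (z t i)\<^sup>2) \<le> (\<Sum>i<d. \<bar>z t i\<bar>)"
    proof (rule sum_mono)
      fix i assume i: "i \<in> {..<d}"
      have "\<bar>z t i\<bar> \<le> (\<Sum>i<d. \<bar>z t i\<bar>)" by (rule member_le_sum) (use i in auto)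
      then have "\<bar>z t i\<bar> * \<bar>z t i\<bar> \<le> \<bar>z t i\<bar>" using z by (intro mult_left_le) auto
      then show "(z t i)\<^sup>2 \<le> \<bar>z t i\<bar>" by (simp add: power2_eq_square abs_mult[symmetric])
    qed
    with z show "(\<Sum>i<d. (z t i)\<^sup>2) \<le> 1" by simp
  next
    fix k assume k: "k < n"
    have "(\<Sum>i<d. (w k i)\<^sup>2) \<le> (\<Sum>i<d. R\<^sup>2)"
      using w[OF k] by (intro sum_mono) (auto simp: abs_le_square_iff[symmetric] nonneg)
    then show "(\<Sum>i<d. (w k i)\<^sup>2) \<le> real d * R\<^sup>2" by simp
    have "(\<Sum>t<k. (\<Sum>i<d. w k i * z t i)\<^sup>2) \<le> (\<Sum>t<k. (\<Sum>\<tau>\<in>X. \<bar>\<Sum>i<d. w k i * x t \<tau> i\<bar>)\<^sup>2)"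
    proof (rule sum_mono)
      fix t
      have "\<bar>\<Sum>i<d. w k i * z t i\<bar> \<le> (\<Sum>\<tau>\<in>X. \<bar>\<Sum>i<d. w k i * x t \<tau> i\<bar>)"
        unfolding wz
        by (intro order_trans[OF sum_abs] sum_mono) (auto simp: abs_mult abs_sgn_eq mult_left_le_one_le)
      then show "(\<Sum>i<d. w k i * z t i)\<^sup>2 \<le> (\<Sum>\<tau>\<in>X. \<bar>\<Sum>i<d. w k i * x t \<tau> i\<bar>)\<^sup>2"
        by (metis abs_ge_zero power2_abs power_mono)
    qed
    with \<zeta>[OF k] show "(\<Sum>t<k. (\<Sum>i<d. w k i * z t i)\<^sup>2) \<le> \<zeta>" by linarith
  qed (use nonneg in auto)
  then show ?thesis unfolding diag by (rule sum_le_sqrt_card)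
qed

section \<open>Trajectory probabilities\<close>

lemma trajectories_0 [simp]: "trajectories A Ob 0 = {[]}"
  by (auto simp: trajectories_def)

lemma finite_trajectories [simp, intro]: "finite (trajectories A Ob n)"
proof -
  have "trajectories A Ob n = {\<tau>. set \<tau> \<subseteq> {..<Ob} \<times> {..<A} \<and> length \<tau> = n}"
    by (auto simp: trajectories_def)
  then show ?thesis using finite_lists_length_eq[of "{..<Ob} \<times> {..<A}" n] by simp
qed

lemma snoc_in_trajectories [simp]:
  "\<tau> @ [(ob, a)] \<in> trajectories A Ob (Suc n) \<longleftrightarrow> \<tau> \<in> trajectories A Ob n \<and> ob < Ob \<and> a < A"
  by (auto simp: trajectories_def)

lemma sum_trajectories_Suc:
  "(\<Sum>\<tau>\<in>trajectories A Ob (Suc n). f \<tau>) =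
   (\<Sum>\<tau>\<in>trajectories A Ob n. \<Sum>ob<Ob. \<Sum>a<A. f (\<tau> @ [(ob, a)]))"
proof -
  have "(\<Sum>\<tau>\<in>trajectories A Ob n. \<Sum>ob<Ob. \<Sum>a<A. f (\<tau> @ [(ob, a)])) =
      (\<Sum>(\<tau>, ob, a)\<in>trajectories A Ob n \<times> {..<Ob} \<times> {..<A}. f (\<tau> @ [(ob, a)]))"
    by (simp add: sum.cartesian_product case_prod_unfold)
  also have "\<dots> = (\<Sum>\<tau>\<in>trajectories A Ob (Suc n). f \<tau>)"
  proof (rule sum.reindex_bij_witness[where i = "\<lambda>\<tau>. (butlast \<tau>, last \<tau>)" and j = "\<lambda>(\<tau>, ob, a). \<tau> @ [(ob, a)]"])
    fix \<tau> assume "\<tau> \<in> trajectories A Ob (Suc n)"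
    then show "(butlast \<tau>, last \<tau>) \<in> trajectories A Ob n \<times> {..<Ob} \<times> {..<A}"
      by (cases \<tau> rule: rev_cases) (auto simp: trajectories_def)
    show "(case (butlast \<tau>, last \<tau>) of (\<tau>, ob, a) \<Rightarrow> \<tau> @ [(ob, a)]) = \<tau>"
      using \<open>\<tau> \<in> _\<close> by (cases \<tau> rule: rev_cases) (auto simp: trajectories_def)
  qed auto
  finally show ?thesis ..
qed

lemma pmf_bind_single:
  assumes "\<And>y. y \<noteq> z \<Longrightarrow> pmf (f y) x = 0"
  shows "pmf (bind_pmf p f) x = pmf p z * pmf (f z) x"
  unfolding pmf_bind using assms
  by (subst integral_measure_pmf[of "{z}"]) auto

lemma pmf_bind_finite:
  assumes "finite B" "set_pmf p \<subseteq> B"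
  shows "pmf (bind_pmf p f) x = (\<Sum>y\<in>B. pmf p y * pmf (f y) x)"
  unfolding pmf_bind using assms
  by (subst integral_measure_pmf[of B]) (auto simp: mult.commute)

lemma pmf_mult_le: "0 \<le> x \<Longrightarrow> x \<le> b \<Longrightarrow> pmf p i * x \<le> b"
  by (rule order_trans[OF mult_left_le_one_le]) (auto simp: pmf_le_1)

lemma sum_pmf_lessThan: "set_pmf p \<subseteq> {..<n::nat} \<Longrightarrow> (\<Sum>i<n. pmf p i) = 1"
  by (rule sum_pmf_eq_1) auto

section \<open>Splitting trajectory probabilities into a policy factor and a model factor\<close>

text \<open>The policy's factor in a trajectory probability: the probability of choosing the actions
  of the trajectory when its observations are fed in after the history \<open>\<sigma>\<close>. It
  is the same under every model.\<close>

primrec action_weight :: "policy \<Rightarrow> trajectory \<Rightarrow> trajectory \<Rightarrow> real" where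
  "action_weight \<pi> \<sigma> [] = 1"
| "action_weight \<pi> \<sigma> (x # \<tau>) = pmf (\<pi> \<sigma> (fst x)) (snd x) * action_weight \<pi> (\<sigma> @ [x]) \<tau>"

lemma action_weight_snoc:
  "action_weight \<pi> \<sigma> (\<tau> @ [x]) = action_weight \<pi> \<sigma> \<tau> * pmf (\<pi> (\<sigma> @ \<tau>) (fst x)) (snd x)"
  by (induction \<tau> arbitrary: \<sigma>) auto

lemma action_weight_nonneg [simp]: "0 \<le> action_weight \<pi> \<sigma> \<tau>"
  by (induction \<tau> arbitrary: \<sigma>) auto

abbreviation weight :: "policy \<Rightarrow> trajectory \<Rightarrow> real" where
  "weight \<pi> \<equiv> action_weight \<pi> []"

lemma weight_snoc: "weight \<pi> (\<tau> @ [(ob, a)]) = weight \<pi> \<tau> * pmf (\<pi> \<tau> ob) a"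
  by (simp add: action_weight_snoc)

text \<open>The probability of the observations of the list from state \<open>s\<close> in step
  \<open>h\<close>, with the actions forced. The case distinction mirrors the missing transition
  after the last action, for which \<open>models\<close> imposes no support condition.\<close>

primrec backward :: "nat \<Rightarrow> model \<Rightarrow> nat \<Rightarrow> nat \<Rightarrow> trajectory \<Rightarrow> real" where
  "backward S \<theta> h s [] = 1"
| "backward S \<theta> h s (x # \<tau>) = pmf (emit \<theta> h s) (fst x) *
     (if \<tau> = [] then 1 else \<Sum>s'<S. pmf (trans \<theta> h (snd x) s) s' * backward S \<theta> (Suc h) s' \<tau>)"

text \<open>The observable operator of \<open>ob\<close> and \<open>a\<close>: condition on the
  observation, then move. The argument \<open>z\<close> may have negative entries, since it will
  also be applied to pseudo-states and to differences.\<close>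

definition forward_step ::
  "nat \<Rightarrow> model \<Rightarrow> nat \<Rightarrow> nat \<Rightarrow> nat \<Rightarrow> (nat \<Rightarrow> real) \<Rightarrow> nat \<Rightarrow> real" where
  "forward_step S \<theta> h ob a z s' = (\<Sum>s<S. pmf (trans \<theta> h a s) s' * pmf (emit \<theta> h s) ob * z s)"

text \<open>The history comes in reverse order, so that the recursion peels off its last step.\<close>

primrec forward_rev :: "nat \<Rightarrow> model \<Rightarrow> trajectory \<Rightarrow> nat \<Rightarrow> real" where
  "forward_rev S \<theta> [] = pmf (init \<theta>)"
| "forward_rev S \<theta> (x # \<sigma>) = forward_step S \<theta> (Suc (length \<sigma>)) (fst x) (snd x) (forward_rev S \<theta> \<sigma>)"

text \<open>The unnormalised belief: the joint probability of the observations of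
  \<open>\<tau>\<close>, with its actions forced, and of the hidden state in the step after
  \<open>\<tau>\<close>.\<close>

definition forward :: "nat \<Rightarrow> model \<Rightarrow> trajectory \<Rightarrow> nat \<Rightarrow> real" where
  "forward S \<theta> \<tau> = forward_rev S \<theta> (rev \<tau>)"

lemma forward_Nil [simp]: "forward S \<theta> [] = pmf (init \<theta>)"
  by (simp add: forward_def)

lemma forward_snoc:
  "forward S \<theta> (\<tau> @ [(ob, a)]) = forward_step S \<theta> (Suc (length \<tau>)) ob a (forward S \<theta> \<tau>)"
  by (simp add: forward_def)

lemma forward_nonneg [simp]: "0 \<le> forward S \<theta> \<tau> s"
  by (induction \<tau> arbitrary: s rule: rev_induct)
     (auto simp: forward_snoc forward_step_def intro!: sum_nonneg)

text \<open>Both sides sum over the same hidden paths, cut at different times, and the induction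
  moves the cut by one step. A nonempty rest is required because \<open>forward\<close> includes the
  transition after \<open>\<tau>\<close>, while \<open>backward\<close> has none after its last
  step.\<close>

lemma forward_backward:
  assumes "\<rho> \<noteq> []"
  shows "(\<Sum>s<S. forward S \<theta> \<tau> s * backward S \<theta> (Suc (length \<tau>)) s \<rho>) =
         (\<Sum>s<S. pmf (init \<theta>) s * backward S \<theta> 1 s (\<tau> @ \<rho>))"
  using assms
proof (induction \<tau> arbitrary: \<rho> rule: rev_induct)
  case (snoc x \<tau>)
  obtain ob a where x: "x = (ob, a)" by fastforce
  have "(\<Sum>s<S. forward S \<theta> (\<tau> @ [x]) s * backward S \<theta> (Suc (length (\<tau> @ [x]))) s \<rho>) =
      (\<Sum>s<S. forward S \<theta> \<tau> s * backward S \<theta> (Suc (length \<tau>)) s (x # \<rho>))"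
    unfolding x forward_snoc forward_step_def sum_distrib_right using snoc.prems
    by (subst sum.swap) (auto simp: sum_distrib_left mult_ac)
  also have "\<dots> = (\<Sum>s<S. pmf (init \<theta>) s * backward S \<theta> 1 s (\<tau> @ x # \<rho>))"
    by (rule snoc.IH) simp
  finally show ?case by simp
qed simp

lemma rollout_extends: "\<tau> \<in> set_pmf (rollout \<theta> \<pi> n h s \<sigma>) \<Longrightarrow> \<exists>\<rho>. length \<rho> = n \<and> \<tau> = \<sigma> @ \<rho>"
proof (induction n arbitrary: h s \<sigma>)
  case (Suc n)
  then obtain ob a where "\<tau> = \<sigma> @ [(ob, a)] \<and> n = 0 \<or> (\<exists>s'. \<tau> \<in> set_pmf (rollout \<theta> \<pi> n (Suc h) s' (\<sigma> @ [(ob, a)])))"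
    by (auto split: if_splits)
  then show ?case
  proof (elim disjE exE conjE)
    fix s' assume "\<tau> \<in> set_pmf (rollout \<theta> \<pi> n (Suc h) s' (\<sigma> @ [(ob, a)]))"
    from Suc.IH[OF this] obtain \<rho> where "length \<rho> = n" "\<tau> = \<sigma> @ (ob, a) # \<rho>" by auto
    then show ?case by (intro exI[of _ "(ob, a) # \<rho>"]) simp
  qed simp
qed simp

lemma models_init: "\<theta> \<in> models S A Ob H \<Longrightarrow> set_pmf (init \<theta>) \<subseteq> {..<S}"
  and models_trans: "\<theta> \<in> models S A Ob H \<Longrightarrow> 1 \<le> h \<Longrightarrow> h < H \<Longrightarrow> a < A \<Longrightarrow> s < S \<Longrightarrow>
    set_pmf (trans \<theta> h a s) \<subseteq> {..<S}"
  and models_emit: "\<theta> \<in> models S A Ob H \<Longrightarrow> 1 \<le> h \<Longrightarrow> h \<le> H \<Longrightarrow> s < S \<Longrightarrow>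
    set_pmf (emit \<theta> h s) \<subseteq> {..<Ob}"
  by (auto simp: models_def)

lemma pmf_rollout:
  assumes "\<theta> \<in> models S A Ob H" "h \<ge> 1" "n \<ge> 1" "h + n = Suc H" "s < S" "length \<rho> = n"
    "set \<rho> \<subseteq> {..<Ob} \<times> {..<A}"
  shows "pmf (rollout \<theta> \<pi> n h s \<sigma>) (\<sigma> @ \<rho>) = action_weight \<pi> \<sigma> \<rho> * backward S \<theta> h s \<rho>"
  using assms(2-)
proof (induction n arbitrary: h s \<sigma> \<rho>)
  case (Suc n)
  obtain ob a \<rho>' where \<rho>: "\<rho> = (ob, a) # \<rho>'" using Suc.prems by (cases \<rho>) auto
  define f where "f ob' a' = (if n = 0 then return_pmf (\<sigma> @ [(ob', a')])
       else bind_pmf (trans \<theta> h a' s) (\<lambda>s'. rollout \<theta> \<pi> n (Suc h) s' (\<sigma> @ [(ob', a')])))" for ob' a'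
  \<comment> \<open>Later steps only extend the history, so the head of \<open>\<rho>\<close> forces
    the current pair and both binds collapse to a single term.\<close>
  have f0: "pmf (f ob' a') (\<sigma> @ \<rho>) = 0" if "(ob', a') \<noteq> (ob, a)" for ob' a'
  proof -
    have "\<sigma> @ \<rho> \<notin> set_pmf (f ob' a')"
      using that by (auto simp: f_def \<rho> dest!: rollout_extends)
    then show ?thesis by (simp add: set_pmf_iff)
  qed
  have "pmf (rollout \<theta> \<pi> (Suc n) h s \<sigma>) (\<sigma> @ \<rho>) =
      pmf (bind_pmf (emit \<theta> h s) (\<lambda>ob. bind_pmf (\<pi> \<sigma> ob) (f ob))) (\<sigma> @ \<rho>)"
    by (simp add: f_def[abs_def])
  also have "\<dots> = pmf (emit \<theta> h s) ob * pmf (bind_pmf (\<pi> \<sigma> ob) (f ob)) (\<sigma> @ \<rho>)"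
    by (rule pmf_bind_single) (simp add: pmf_bind f0)
  also have "pmf (bind_pmf (\<pi> \<sigma> ob) (f ob)) (\<sigma> @ \<rho>) = pmf (\<pi> \<sigma> ob) a * pmf (f ob a) (\<sigma> @ \<rho>)"
    by (rule pmf_bind_single) (simp add: f0)
  also have "pmf (f ob a) (\<sigma> @ \<rho>) = action_weight \<pi> (\<sigma> @ [(ob, a)]) \<rho>' *
      (if \<rho>' = [] then 1 else \<Sum>s'<S. pmf (trans \<theta> h a s) s' * backward S \<theta> (Suc h) s' \<rho>')"
  proof (cases "n = 0")
    case True
    then show ?thesis using Suc.prems by (simp add: f_def \<rho>)
  next
    case False
    then have ne: "\<rho>' \<noteq> []" using Suc.prems by (auto simp: \<rho>)
    have "pmf (f ob a) (\<sigma> @ \<rho>) =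
        (\<Sum>s'<S. pmf (trans \<theta> h a s) s' * pmf (rollout \<theta> \<pi> n (Suc h) s' (\<sigma> @ [(ob, a)])) (\<sigma> @ \<rho>))"
      unfolding f_def using False Suc.prems models_trans[OF assms(1), of h a s]
      by (simp add: \<rho> pmf_bind_finite)
    also have "\<dots> = (\<Sum>s'<S. pmf (trans \<theta> h a s) s' *
        (action_weight \<pi> (\<sigma> @ [(ob, a)]) \<rho>' * backward S \<theta> (Suc h) s' \<rho>'))"
      using Suc.IH[of "Suc h" _ \<rho>' "\<sigma> @ [(ob, a)]"] False Suc.prems by (intro sum.cong refl) (auto simp: \<rho>)
    finally show ?thesis using ne by (simp add: sum_distrib_left mult_ac)
  qed
  finally show ?case by (simp add: \<rho>)
qed simp

text \<open>
  For a history of length \<open>h - 1\<close>, \<open>next_obs S \<theta> \<tau> ob\<close> is the probability of observing \<open>\<tau>\<close> and then \<open>ob\<close>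
  when the actions of \<open>\<tau>\<close> are taken.
\<close>

definition next_obs :: "nat \<Rightarrow> model \<Rightarrow> trajectory \<Rightarrow> nat \<Rightarrow> real" where
  "next_obs S \<theta> \<tau> ob = (\<Sum>s<S. pmf (emit \<theta> (Suc (length \<tau>)) s) ob * forward S \<theta> \<tau> s)"

text \<open>No transition follows the last action, which therefore enters through
  \<open>weight\<close> alone; the model contributes only the prediction for the history without the
  last pair.\<close>

lemma pmf_episode_snoc:
  assumes "\<theta> \<in> models S A Ob H" "\<tau> @ [(ob, a)] \<in> trajectories A Ob H"
  shows "pmf (episode H \<theta> \<pi>) (\<tau> @ [(ob, a)]) = weight \<pi> (\<tau> @ [(ob, a)]) * next_obs S \<theta> \<tau> ob"
proof -
  let ?\<rho> = "\<tau> @ [(ob, a)]"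
  have H: "length ?\<rho> = H" "set ?\<rho> \<subseteq> {..<Ob} \<times> {..<A}" "H \<ge> 1"
    using assms(2) by (auto simp: trajectories_def)
  have "pmf (episode H \<theta> \<pi>) ?\<rho> = (\<Sum>s<S. pmf (init \<theta>) s * pmf (rollout \<theta> \<pi> H 1 s []) ?\<rho>)"
    unfolding episode_def by (rule pmf_bind_finite) (use models_init[OF assms(1)] in auto)
  also have "\<dots> = (\<Sum>s<S. pmf (init \<theta>) s * (weight \<pi> ?\<rho> * backward S \<theta> 1 s ?\<rho>))"
    using pmf_rollout[OF assms(1), of 1 H _ ?\<rho> \<pi> "[]"] H by (intro sum.cong refl) auto
  also have "\<dots> = weight \<pi> ?\<rho> * (\<Sum>s<S. pmf (init \<theta>) s * backward S \<theta> 1 s ?\<rho>)"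
    by (simp add: sum_distrib_left mult_ac)
  also have "(\<Sum>s<S. pmf (init \<theta>) s * backward S \<theta> 1 s ?\<rho>) = next_obs S \<theta> \<tau> ob"
    using forward_backward[of "[(ob, a)]" S \<theta> \<tau>] by (simp add: next_obs_def mult.commute)
  finally show ?thesis .
qed

section \<open>Conservation of probability along histories\<close>

lemma policies_sum_1:
  assumes "\<pi> \<in> policies A Ob H" "\<tau> \<in> trajectories A Ob n" "n < H" "ob < Ob"
  shows "(\<Sum>a<A. pmf (\<pi> \<tau> ob) a) = 1"
proof (rule sum_pmf_lessThan)
  have "Suc n \<in> {1..H}" using assms by auto
  then show "set_pmf (\<pi> \<tau> ob) \<subseteq> {..<A}"
    using assms unfolding policies_def by (metis (mono_tags, lifting) diff_Suc_1 mem_Collect_eq)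
qed

lemma sum_weight_snoc:
  assumes "\<pi> \<in> policies A Ob H" "\<tau> \<in> trajectories A Ob n" "n < H" "ob < Ob"
  shows "(\<Sum>a<A. weight \<pi> (\<tau> @ [(ob, a)])) = weight \<pi> \<tau>"
  using policies_sum_1[OF assms] by (simp add: weight_snoc sum_distrib_left[symmetric])

lemma sum_forward_step:
  assumes "\<theta> \<in> models S A Ob H" "1 \<le> h" "h < H" "a < A"
  shows "(\<Sum>s'<S. forward_step S \<theta> h ob a z s') = (\<Sum>s<S. pmf (emit \<theta> h s) ob * z s)"
proof -
  have "(\<Sum>s'<S. forward_step S \<theta> h ob a z s') =
      (\<Sum>s<S. (\<Sum>s'<S. pmf (trans \<theta> h a s) s') * (pmf (emit \<theta> h s) ob * z s))"
    unfolding forward_step_def sum_distrib_right by (subst sum.swap) (simp add: mult_ac)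
  then show ?thesis using assms by (simp add: sum_pmf_lessThan models_trans)
qed

text \<open>A stochastic matrix does not increase the L1 norm; summation over observations is left
  to the caller, where the emission probabilities then add up to 1.\<close>

lemma abs_forward_step_le:
  assumes "\<theta> \<in> models S A Ob H" "1 \<le> h" "h < H" "a < A"
  shows "(\<Sum>s'<S. \<bar>forward_step S \<theta> h ob a z s'\<bar>) \<le> (\<Sum>s<S. pmf (emit \<theta> h s) ob * \<bar>z s\<bar>)"
proof -
  have "(\<Sum>s'<S. \<bar>forward_step S \<theta> h ob a z s'\<bar>) \<le> (\<Sum>s'<S. forward_step S \<theta> h ob a (\<lambda>s. \<bar>z s\<bar>) s')"
    unfolding forward_step_def by (intro sum_mono order_trans[OF sum_abs]) (simp add: abs_mult)
  also have "\<dots> = (\<Sum>s<S. pmf (emit \<theta> h s) ob * \<bar>z s\<bar>)" by (rule sum_forward_step[OF assms])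
  finally show ?thesis .
qed

lemma sum_emit:
  assumes "\<theta> \<in> models S A Ob H" "1 \<le> h" "h \<le> H"
  shows "(\<Sum>ob<Ob. \<Sum>s<S. pmf (emit \<theta> h s) ob * z s) = (\<Sum>s<S. z s)"
proof -
  have "(\<Sum>ob<Ob. \<Sum>s<S. pmf (emit \<theta> h s) ob * z s) = (\<Sum>s<S. (\<Sum>ob<Ob. pmf (emit \<theta> h s) ob) * z s)"
    unfolding sum_distrib_right by (rule sum.swap)
  then show ?thesis using assms by (simp add: sum_pmf_lessThan models_emit)
qed

lemma sum_next_obs_snoc:
  assumes "\<theta> \<in> models S A Ob H" "\<tau> \<in> trajectories A Ob n" "Suc n < H" "a < A"
  shows "(\<Sum>ob'<Ob. next_obs S \<theta> (\<tau> @ [(ob, a)]) ob') = next_obs S \<theta> \<tau> ob"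
proof -
  have n: "length \<tau> = n" using assms by (simp add: trajectories_def)
  have "(\<Sum>ob'<Ob. next_obs S \<theta> (\<tau> @ [(ob, a)]) ob') = (\<Sum>s<S. forward S \<theta> (\<tau> @ [(ob, a)]) s)"
    unfolding next_obs_def by (rule sum_emit[OF assms(1)]) (use assms n in auto)
  also have "\<dots> = next_obs S \<theta> \<tau> ob"
    unfolding forward_snoc next_obs_def
    by (rule sum_forward_step[OF assms(1)]) (use assms n in auto)
  finally show ?thesis .
qed

text \<open>\<open>weight\<close> times \<open>forward\<close> is the joint law of the history and
  of the hidden state that follows it. The unit mass becomes the norm bound that
  \<open>eluder_sum\<close> asks for.\<close>

lemma weighted_forward_mass:
  assumes "\<theta> \<in> models S A Ob H" "\<pi> \<in> policies A Ob H" "n < H"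
  shows "(\<Sum>\<tau>\<in>trajectories A Ob n. weight \<pi> \<tau> * (\<Sum>s<S. forward S \<theta> \<tau> s)) = 1"
  using assms(3)
proof (induction n)
  case 0
  then show ?case by (simp add: sum_pmf_lessThan models_init[OF assms(1)])
next
  case (Suc n)
  have "(\<Sum>\<tau>\<in>trajectories A Ob (Suc n). weight \<pi> \<tau> * (\<Sum>s<S. forward S \<theta> \<tau> s)) =
      (\<Sum>\<tau>\<in>trajectories A Ob n. \<Sum>ob<Ob. \<Sum>a<A. weight \<pi> (\<tau> @ [(ob, a)]) * next_obs S \<theta> \<tau> ob)"
    unfolding sum_trajectories_Suc
  proof (intro sum.cong refl)
    fix \<tau> ob a assume "\<tau> \<in> trajectories A Ob n" "a \<in> {..<A}"
    then have "(\<Sum>s<S. forward S \<theta> (\<tau> @ [(ob, a)]) s) = next_obs S \<theta> \<tau> ob"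
      unfolding forward_snoc next_obs_def using Suc.prems
      by (intro sum_forward_step[OF assms(1)]) (auto simp: trajectories_def)
    then show "weight \<pi> (\<tau> @ [(ob, a)]) * (\<Sum>s<S. forward S \<theta> (\<tau> @ [(ob, a)]) s) =
        weight \<pi> (\<tau> @ [(ob, a)]) * next_obs S \<theta> \<tau> ob" by simp
  qed
  also have "\<dots> = (\<Sum>\<tau>\<in>trajectories A Ob n. \<Sum>ob<Ob. weight \<pi> \<tau> * next_obs S \<theta> \<tau> ob)"
    using Suc.prems
    by (intro sum.cong refl) (simp add: sum_weight_snoc[OF assms(2)] sum_distrib_right[symmetric])
  also have "\<dots> = (\<Sum>\<tau>\<in>trajectories A Ob n. weight \<pi> \<tau> * (\<Sum>s<S. forward S \<theta> \<tau> s))"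
    unfolding next_obs_def sum_distrib_left[symmetric] using Suc.prems
    by (intro sum.cong refl arg_cong2[where f=times] sum_emit[OF assms(1)]) (auto simp: trajectories_def)
  finally show ?case using Suc by simp
qed

section \<open>Total variation and one-step residuals\<close>

text \<open>The L1 distance of the two trajectory laws, without the customary factor 1/2.\<close>

definition tv_dist :: "nat \<Rightarrow> nat \<Rightarrow> nat \<Rightarrow> policy \<Rightarrow> model \<Rightarrow> model \<Rightarrow> real" where
  "tv_dist A Ob H \<pi> \<theta> \<theta>' =
     (\<Sum>\<tau>\<in>trajectories A Ob H. \<bar>pmf (episode H \<theta> \<pi>) \<tau> - pmf (episode H \<theta>' \<pi>) \<tau>\<bar>)"

text \<open>The L1 distance of the two laws of the first \<open>n\<close> observation-action pairs
  together with the next observation; the policy factor is common to both.\<close>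

definition obs_dist :: "nat \<Rightarrow> nat \<Rightarrow> nat \<Rightarrow> policy \<Rightarrow> model \<Rightarrow> model \<Rightarrow> nat \<Rightarrow> real" where
  "obs_dist S A Ob \<pi> \<theta> \<theta>' n =
     (\<Sum>\<tau>\<in>trajectories A Ob n. weight \<pi> \<tau> * (\<Sum>ob<Ob. \<bar>next_obs S \<theta> \<tau> ob - next_obs S \<theta>' \<tau> ob\<bar>))"

lemma tv_dist_nonneg: "0 \<le> tv_dist A Ob H \<pi> \<theta> \<theta>'"
  unfolding tv_dist_def by (intro sum_nonneg) auto

lemma tv_dist_eq_obs_dist:
  assumes "\<theta> \<in> models S A Ob H" "\<theta>' \<in> models S A Ob H" "\<pi> \<in> policies A Ob H" "H = Suc n"
  shows "tv_dist A Ob H \<pi> \<theta> \<theta>' = obs_dist S A Ob \<pi> \<theta> \<theta>' n"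
proof -
  let ?D = "\<lambda>\<tau> ob. \<bar>next_obs S \<theta> \<tau> ob - next_obs S \<theta>' \<tau> ob\<bar>"
  have "tv_dist A Ob H \<pi> \<theta> \<theta>' =
      (\<Sum>\<tau>\<in>trajectories A Ob n. \<Sum>ob<Ob. \<Sum>a<A. weight \<pi> (\<tau> @ [(ob, a)]) * ?D \<tau> ob)"
    unfolding tv_dist_def assms(4) sum_trajectories_Suc
    using assms by (intro sum.cong refl)
      (simp add: pmf_episode_snoc[of _ S A Ob] right_diff_distrib[symmetric] abs_mult)
  also have "\<dots> = (\<Sum>\<tau>\<in>trajectories A Ob n. \<Sum>ob<Ob. weight \<pi> \<tau> * ?D \<tau> ob)"
    using assms by (intro sum.cong refl)
      (simp add: sum_weight_snoc[of _ A Ob H] sum_distrib_right[symmetric])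
  finally show ?thesis by (simp add: obs_dist_def sum_distrib_left)
qed

text \<open>The data processing inequality: the prediction after a shorter history is a marginal of
  the prediction after a longer one, whichever action comes between.\<close>

lemma obs_dist_Suc:
  assumes \<theta>: "\<theta> \<in> models S A Ob H" "\<theta>' \<in> models S A Ob H" and \<pi>: "\<pi> \<in> policies A Ob H" and n: "Suc n < H"
  shows "obs_dist S A Ob \<pi> \<theta> \<theta>' n \<le> obs_dist S A Ob \<pi> \<theta> \<theta>' (Suc n)"
proof -
  let ?D = "\<lambda>\<tau> ob. \<bar>next_obs S \<theta> \<tau> ob - next_obs S \<theta>' \<tau> ob\<bar>"
  have "obs_dist S A Ob \<pi> \<theta> \<theta>' n =
      (\<Sum>\<tau>\<in>trajectories A Ob n. \<Sum>ob<Ob. \<Sum>a<A. weight \<pi> (\<tau> @ [(ob, a)]) * ?D \<tau> ob)"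
    unfolding obs_dist_def sum_distrib_left using n
    by (intro sum.cong refl) (simp add: sum_weight_snoc[OF \<pi>] sum_distrib_right[symmetric])
  also have "\<dots> \<le> obs_dist S A Ob \<pi> \<theta> \<theta>' (Suc n)"
    unfolding obs_dist_def sum_trajectories_Suc
  proof (intro sum_mono mult_left_mono)
    fix \<tau> ob a assume \<tau>: "\<tau> \<in> trajectories A Ob n" "a \<in> {..<A}"
    have "?D \<tau> ob = \<bar>\<Sum>ob'<Ob. next_obs S \<theta> (\<tau> @ [(ob, a)]) ob' - next_obs S \<theta>' (\<tau> @ [(ob, a)]) ob'\<bar>"
      using \<tau> n by (simp add: sum_subtractf sum_next_obs_snoc[OF \<theta>(1)] sum_next_obs_snoc[OF \<theta>(2)])
    also have "\<dots> \<le> (\<Sum>ob'<Ob. ?D (\<tau> @ [(ob, a)]) ob')" by (rule sum_abs)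
    finally show "?D \<tau> ob \<le> (\<Sum>ob'<Ob. ?D (\<tau> @ [(ob, a)]) ob')" .
  qed simp
  finally show ?thesis .
qed

lemma obs_dist_le_tv_dist:
  assumes \<theta>: "\<theta> \<in> models S A Ob H" "\<theta>' \<in> models S A Ob H" and \<pi>: "\<pi> \<in> policies A Ob H" and n: "n < H"
  shows "obs_dist S A Ob \<pi> \<theta> \<theta>' n \<le> tv_dist A Ob H \<pi> \<theta> \<theta>'"
proof -
  have "n \<le> H - 1" using n by simp
  then show ?thesis
  proof (induction rule: inc_induct)
    case base
    then show ?case using tv_dist_eq_obs_dist[OF \<theta> \<pi>, of "H - 1"] n by simp
  next
    case (step m)
    then show ?case using obs_dist_Suc[OF \<theta> \<pi>, of m] by linarith
  qed
qed

text \<open>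
  In \<open>estimation\<close>, \<open>L h\<close> is a left inverse of the emission matrix of the estimate \<open>\<theta>\<close>, so
  \<open>L h\<close> turns the predictions of \<open>\<theta>\<close> for the next observation back into its forward vector.
  Applied to the predictions of the true model \<open>\<theta>'\<close> it gives the pseudo-state \<open>pstate\<close>; the residuals
  measure by how much the pseudo-states fail to obey the dynamics of \<open>\<theta>\<close>.
\<close>

locale estimation =
  fixes S A Ob H :: nat and \<theta> \<theta>' :: model and L :: "nat \<Rightarrow> nat \<Rightarrow> nat \<Rightarrow> real" and b :: real
  assumes H: "H \<ge> 1" and b: "b \<ge> 0"
    and \<theta>: "\<theta> \<in> models S A Ob H" and \<theta>': "\<theta>' \<in> models S A Ob H"
    and left_inverse: "\<And>h i j. 1 \<le> h \<Longrightarrow> h \<le> H \<Longrightarrow> i < S \<Longrightarrow> j < S \<Longrightarrow>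
      (\<Sum>ob<Ob. L h i ob * pmf (emit \<theta> h j) ob) = (if i = j then 1 else 0)"
    and L_le: "\<And>h i ob. 1 \<le> h \<Longrightarrow> h \<le> H \<Longrightarrow> i < S \<Longrightarrow> ob < Ob \<Longrightarrow> \<bar>L h i ob\<bar> \<le> b"
begin

definition pstate :: "trajectory \<Rightarrow> nat \<Rightarrow> real" where
  "pstate \<tau> i = (\<Sum>ob<Ob. L (Suc (length \<tau>)) i ob * next_obs S \<theta>' \<tau> ob)"

definition res_init :: "nat \<Rightarrow> real" where
  "res_init i = pmf (init \<theta>) i - pstate [] i"

definition res_step :: "trajectory \<Rightarrow> nat \<Rightarrow> nat \<Rightarrow> nat \<Rightarrow> real" where
  "res_step \<tau> ob a i = forward_step S \<theta> (Suc (length \<tau>)) ob a (pstate \<tau>) i - pstate (\<tau> @ [(ob, a)]) i"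

definition res_obs :: "trajectory \<Rightarrow> nat \<Rightarrow> real" where
  "res_obs \<tau> ob = (\<Sum>i<S. pmf (emit \<theta> (Suc (length \<tau>)) i) ob * pstate \<tau> i) - next_obs S \<theta>' \<tau> ob"

lemma L_contract:
  assumes "1 \<le> h" "h \<le> H"
  shows "(\<Sum>i<S. \<bar>\<Sum>ob<Ob. L h i ob * v ob\<bar>) \<le> real S * b * (\<Sum>ob<Ob. \<bar>v ob\<bar>)"
proof -
  have "(\<Sum>i<S. \<bar>\<Sum>ob<Ob. L h i ob * v ob\<bar>) \<le> (\<Sum>i<S. \<Sum>ob<Ob. b * \<bar>v ob\<bar>)"
    using L_le[OF assms]
    by (intro sum_mono order_trans[OF sum_abs]) (auto simp: abs_mult intro!: mult_right_mono)
  then show ?thesis by (simp add: sum_distrib_left mult_ac)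
qed

lemma L_next_obs:
  assumes "length \<tau> < H" "i < S"
  shows "(\<Sum>ob<Ob. L (Suc (length \<tau>)) i ob * next_obs S \<theta> \<tau> ob) = forward S \<theta> \<tau> i"
proof -
  have "(\<Sum>ob<Ob. L (Suc (length \<tau>)) i ob * next_obs S \<theta> \<tau> ob) =
      (\<Sum>j<S. (\<Sum>ob<Ob. L (Suc (length \<tau>)) i ob * pmf (emit \<theta> (Suc (length \<tau>)) j) ob) * forward S \<theta> \<tau> j)"
    unfolding next_obs_def sum_distrib_left sum_distrib_right by (subst sum.swap) (simp add: mult_ac)
  also have "\<dots> = (\<Sum>j<S. if j = i then forward S \<theta> \<tau> j else 0)"
    using assms by (intro sum.cong refl) (simp add: left_inverse)
  finally show ?thesis using assms by simp
qed

text \<open>Both vectors arise by applying the same matrix \<open>L\<close> to predictions, of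
  \<open>\<theta>\<close> and of \<open>\<theta>'\<close>. Hence their difference is
  \<open>L\<close> applied to the prediction error.\<close>

lemma forward_pstate_le:
  assumes "length \<tau> < H"
  shows "(\<Sum>i<S. \<bar>forward S \<theta> \<tau> i - pstate \<tau> i\<bar>) \<le>
         real S * b * (\<Sum>ob<Ob. \<bar>next_obs S \<theta> \<tau> ob - next_obs S \<theta>' \<tau> ob\<bar>)"
proof -
  have "(\<Sum>i<S. \<bar>forward S \<theta> \<tau> i - pstate \<tau> i\<bar>) =
      (\<Sum>i<S. \<bar>\<Sum>ob<Ob. L (Suc (length \<tau>)) i ob * (next_obs S \<theta> \<tau> ob - next_obs S \<theta>' \<tau> ob)\<bar>)"
    using assms
    by (intro sum.cong refl) (simp add: pstate_def L_next_obs[symmetric] right_diff_distrib sum_subtractf)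
  also have "\<dots> \<le> real S * b * (\<Sum>ob<Ob. \<bar>next_obs S \<theta> \<tau> ob - next_obs S \<theta>' \<tau> ob\<bar>)"
    by (rule L_contract) (use assms in auto)
  finally show ?thesis .
qed

definition state_err :: "policy \<Rightarrow> nat \<Rightarrow> real" where
  "state_err \<pi> n = (\<Sum>\<tau>\<in>trajectories A Ob n. weight \<pi> \<tau> * (\<Sum>i<S. \<bar>forward S \<theta> \<tau> i - pstate \<tau> i\<bar>))"

definition step_err :: "policy \<Rightarrow> nat \<Rightarrow> real" where
  "step_err \<pi> n = (\<Sum>\<tau>\<in>trajectories A Ob n. \<Sum>ob<Ob. \<Sum>a<A.
     weight \<pi> (\<tau> @ [(ob, a)]) * (\<Sum>i<S. \<bar>res_step \<tau> ob a i\<bar>))"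

definition obs_err :: "policy \<Rightarrow> real" where
  "obs_err \<pi> = (\<Sum>\<tau>\<in>trajectories A Ob (H - 1). weight \<pi> \<tau> * (\<Sum>ob<Ob. \<bar>res_obs \<tau> ob\<bar>))"

lemma state_err_le:
  assumes "n < H"
  shows "state_err \<pi> n \<le> real S * b * obs_dist S A Ob \<pi> \<theta> \<theta>' n"
proof -
  have "state_err \<pi> n \<le> (\<Sum>\<tau>\<in>trajectories A Ob n. weight \<pi> \<tau> *
      (real S * b * (\<Sum>ob<Ob. \<bar>next_obs S \<theta> \<tau> ob - next_obs S \<theta>' \<tau> ob\<bar>)))"
    unfolding state_err_def using assms
    by (intro sum_mono mult_left_mono forward_pstate_le) (auto simp: trajectories_def)
  then show ?thesis by (simp add: obs_dist_def sum_distrib_left mult_ac)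
qed

text \<open>Averaged over observations and policy actions, one step of the dynamics of
  \<open>\<theta>\<close> does not increase the L1 norm. This keeps errors from growing
  exponentially in \<open>H\<close>.\<close>

lemma propagate_le:
  assumes \<pi>: "\<pi> \<in> policies A Ob H" and n: "Suc n < H"
  shows "(\<Sum>\<tau>\<in>trajectories A Ob n. \<Sum>ob<Ob. \<Sum>a<A. weight \<pi> (\<tau> @ [(ob, a)]) *
      (\<Sum>i<S. \<bar>forward_step S \<theta> (Suc (length \<tau>)) ob a (z \<tau>) i\<bar>)) \<le>
    (\<Sum>\<tau>\<in>trajectories A Ob n. weight \<pi> \<tau> * (\<Sum>i<S. \<bar>z \<tau> i\<bar>))"
proof (rule sum_mono)
  fix \<tau> assume \<tau>: "\<tau> \<in> trajectories A Ob n"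
  then have len: "length \<tau> = n" by (simp add: trajectories_def)
  have "(\<Sum>ob<Ob. \<Sum>a<A. weight \<pi> (\<tau> @ [(ob, a)]) *
      (\<Sum>i<S. \<bar>forward_step S \<theta> (Suc (length \<tau>)) ob a (z \<tau>) i\<bar>)) \<le>
    (\<Sum>ob<Ob. \<Sum>a<A. weight \<pi> (\<tau> @ [(ob, a)]) * (\<Sum>s<S. pmf (emit \<theta> (Suc n) s) ob * \<bar>z \<tau> s\<bar>))"
    using n unfolding len by (intro sum_mono mult_left_mono abs_forward_step_le[OF \<theta>]) auto
  also have "\<dots> = (\<Sum>ob<Ob. weight \<pi> \<tau> * (\<Sum>s<S. pmf (emit \<theta> (Suc n) s) ob * \<bar>z \<tau> s\<bar>))"
    using n \<tau> by (intro sum.cong refl) (simp add: sum_weight_snoc[OF \<pi>] sum_distrib_right[symmetric])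
  also have "\<dots> = weight \<pi> \<tau> * (\<Sum>i<S. \<bar>z \<tau> i\<bar>)"
    unfolding sum_distrib_left[symmetric]
    by (intro arg_cong2[where f=times] refl sum_emit[OF \<theta>]) (use n in auto)
  finally show "(\<Sum>ob<Ob. \<Sum>a<A. weight \<pi> (\<tau> @ [(ob, a)]) *
      (\<Sum>i<S. \<bar>forward_step S \<theta> (Suc (length \<tau>)) ob a (z \<tau>) i\<bar>)) \<le>
    weight \<pi> \<tau> * (\<Sum>i<S. \<bar>z \<tau> i\<bar>)" .
qed

lemma forward_step_diff:
  "forward_step S \<theta> h ob a z i - forward_step S \<theta> h ob a z' i = forward_step S \<theta> h ob a (\<lambda>s. z s - z' s) i"
  by (simp add: forward_step_def sum_subtractf right_diff_distrib)

text \<open>The forward vectors follow the dynamics of \<open>\<theta>\<close> exactly and the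
  pseudo-states follow them up to the residual. The new error is thus the propagated old error plus
  the residual.\<close>

lemma state_err_Suc:
  assumes \<pi>: "\<pi> \<in> policies A Ob H" and n: "Suc n < H"
  shows "state_err \<pi> (Suc n) \<le> state_err \<pi> n + step_err \<pi> n"
proof -
  let ?z = "\<lambda>\<tau> s. forward S \<theta> \<tau> s - pstate \<tau> s"
  have "state_err \<pi> (Suc n) \<le> (\<Sum>\<tau>\<in>trajectories A Ob n. \<Sum>ob<Ob. \<Sum>a<A. weight \<pi> (\<tau> @ [(ob, a)]) *
      ((\<Sum>i<S. \<bar>forward_step S \<theta> (Suc (length \<tau>)) ob a (?z \<tau>) i\<bar>) + (\<Sum>i<S. \<bar>res_step \<tau> ob a i\<bar>)))"
    unfolding state_err_def sum_trajectories_Suc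
  proof (intro sum_mono mult_left_mono)
    fix \<tau> ob a
    have "forward S \<theta> (\<tau> @ [(ob, a)]) i - pstate (\<tau> @ [(ob, a)]) i =
        forward_step S \<theta> (Suc (length \<tau>)) ob a (?z \<tau>) i + res_step \<tau> ob a i" for i
      by (simp add: forward_snoc res_step_def forward_step_diff[symmetric])
    then show "(\<Sum>i<S. \<bar>forward S \<theta> (\<tau> @ [(ob, a)]) i - pstate (\<tau> @ [(ob, a)]) i\<bar>) \<le>
        (\<Sum>i<S. \<bar>forward_step S \<theta> (Suc (length \<tau>)) ob a (?z \<tau>) i\<bar>) + (\<Sum>i<S. \<bar>res_step \<tau> ob a i\<bar>)"
      unfolding sum.distrib[symmetric] by (intro sum_mono) simp
  qed simp
  also have "\<dots> \<le> state_err \<pi> n + step_err \<pi> n"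
    unfolding distrib_left sum.distrib step_err_def state_err_def
    by (intro add_mono order_refl propagate_le[OF \<pi> n])
  finally show ?thesis .
qed

text \<open>The state error is compared with the residuals by unrolling its recursion, and a last
  emission turns it into a distance of predictions. Only contractions are applied, so no factor
  \<open>b\<close> is lost in this direction.\<close>

lemma tv_dist_le_residuals:
  assumes \<pi>: "\<pi> \<in> policies A Ob H"
  shows "tv_dist A Ob H \<pi> \<theta> \<theta>' \<le> (\<Sum>i<S. \<bar>res_init i\<bar>) + (\<Sum>n<H-1. step_err \<pi> n) + obs_err \<pi>"
proof -
  have st: "state_err \<pi> n \<le> (\<Sum>i<S. \<bar>res_init i\<bar>) + (\<Sum>m<n. step_err \<pi> m)" if "n < H" for n
    using that
  proof (induction n)
    case 0
    then show ?case by (simp add: state_err_def res_init_def)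
  next
    case (Suc n)
    then have "state_err \<pi> n \<le> (\<Sum>i<S. \<bar>res_init i\<bar>) + (\<Sum>m<n. step_err \<pi> m)" by simp
    then show ?case using state_err_Suc[OF \<pi> Suc.prems] unfolding sum.lessThan_Suc by linarith
  qed
  have "tv_dist A Ob H \<pi> \<theta> \<theta>' = obs_dist S A Ob \<pi> \<theta> \<theta>' (H - 1)"
    by (rule tv_dist_eq_obs_dist[OF \<theta> \<theta>' \<pi>]) (use H in simp)
  also have "\<dots> \<le> state_err \<pi> (H - 1) + obs_err \<pi>"
    unfolding obs_dist_def state_err_def obs_err_def sum.distrib[symmetric] distrib_left[symmetric]
  proof (intro sum_mono mult_left_mono)
    fix \<tau> assume "\<tau> \<in> trajectories A Ob (H - 1)"
    then have SH: "Suc (length \<tau>) = H" using H by (simp add: trajectories_def)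
    let ?z = "\<lambda>i. forward S \<theta> \<tau> i - pstate \<tau> i"
    have "(\<Sum>ob<Ob. \<bar>next_obs S \<theta> \<tau> ob - next_obs S \<theta>' \<tau> ob\<bar>) \<le>
        (\<Sum>ob<Ob. (\<Sum>i<S. pmf (emit \<theta> H i) ob * \<bar>?z i\<bar>) + \<bar>res_obs \<tau> ob\<bar>)"
    proof (rule sum_mono)
      fix ob
      have "next_obs S \<theta> \<tau> ob - next_obs S \<theta>' \<tau> ob = (\<Sum>i<S. pmf (emit \<theta> H i) ob * ?z i) + res_obs \<tau> ob"
        by (simp add: next_obs_def[of S \<theta>] res_obs_def SH right_diff_distrib sum_subtractf)
      moreover have "\<bar>\<Sum>i<S. pmf (emit \<theta> H i) ob * ?z i\<bar> \<le> (\<Sum>i<S. pmf (emit \<theta> H i) ob * \<bar>?z i\<bar>)"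
        by (rule order_trans[OF sum_abs]) (simp add: abs_mult)
      ultimately show "\<bar>next_obs S \<theta> \<tau> ob - next_obs S \<theta>' \<tau> ob\<bar> \<le>
          (\<Sum>i<S. pmf (emit \<theta> H i) ob * \<bar>?z i\<bar>) + \<bar>res_obs \<tau> ob\<bar>" by linarith
    qed
    also have "\<dots> = (\<Sum>i<S. \<bar>?z i\<bar>) + (\<Sum>ob<Ob. \<bar>res_obs \<tau> ob\<bar>)"
      unfolding sum.distrib by (simp only: sum_emit[OF \<theta> H order_refl])
    finally show "(\<Sum>ob<Ob. \<bar>next_obs S \<theta> \<tau> ob - next_obs S \<theta>' \<tau> ob\<bar>) \<le>
        (\<Sum>i<S. \<bar>?z i\<bar>) + (\<Sum>ob<Ob. \<bar>res_obs \<tau> ob\<bar>)" .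
  qed simp
  also have "\<dots> \<le> (\<Sum>i<S. \<bar>res_init i\<bar>) + (\<Sum>n<H-1. step_err \<pi> n) + obs_err \<pi>"
    using st[of "H - 1"] H by simp
  finally show ?thesis .
qed

text \<open>A residual is the propagated error of one pseudo-state plus the error of the next
  pseudo-state, with opposite orientations; each of the two costs \<open>S * b\<close> times the
  distance.\<close>

lemma step_err_le:
  assumes \<pi>: "\<pi> \<in> policies A Ob H" and n: "Suc n < H"
  shows "step_err \<pi> n \<le> 2 * (real S * b) * tv_dist A Ob H \<pi> \<theta> \<theta>'"
proof -
  let ?z = "\<lambda>\<tau> s. pstate \<tau> s - forward S \<theta> \<tau> s"
  have "step_err \<pi> n \<le> (\<Sum>\<tau>\<in>trajectories A Ob n. \<Sum>ob<Ob. \<Sum>a<A. weight \<pi> (\<tau> @ [(ob, a)]) *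
      ((\<Sum>i<S. \<bar>forward_step S \<theta> (Suc (length \<tau>)) ob a (?z \<tau>) i\<bar>) +
       (\<Sum>i<S. \<bar>forward S \<theta> (\<tau> @ [(ob, a)]) i - pstate (\<tau> @ [(ob, a)]) i\<bar>)))"
    unfolding step_err_def
  proof (intro sum_mono mult_left_mono)
    fix \<tau> ob a
    have "res_step \<tau> ob a i = forward_step S \<theta> (Suc (length \<tau>)) ob a (?z \<tau>) i +
        (forward S \<theta> (\<tau> @ [(ob, a)]) i - pstate (\<tau> @ [(ob, a)]) i)" for i
      by (simp add: forward_snoc res_step_def forward_step_diff[symmetric])
    then show "(\<Sum>i<S. \<bar>res_step \<tau> ob a i\<bar>) \<le>
        (\<Sum>i<S. \<bar>forward_step S \<theta> (Suc (length \<tau>)) ob a (?z \<tau>) i\<bar>) +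
        (\<Sum>i<S. \<bar>forward S \<theta> (\<tau> @ [(ob, a)]) i - pstate (\<tau> @ [(ob, a)]) i\<bar>)"
      unfolding sum.distrib[symmetric] by (intro sum_mono) simp
  qed simp
  also have "\<dots> \<le> state_err \<pi> n + state_err \<pi> (Suc n)"
  proof -
    have "state_err \<pi> n = (\<Sum>\<tau>\<in>trajectories A Ob n. weight \<pi> \<tau> * (\<Sum>i<S. \<bar>?z \<tau> i\<bar>))"
      by (simp add: state_err_def abs_minus_commute)
    then show ?thesis
      unfolding distrib_left sum.distrib state_err_def[of _ "Suc n"] sum_trajectories_Suc
      by (intro add_mono order_refl) (simp only: propagate_le[OF \<pi> n])
  qed
  also have "\<dots> \<le> real S * b * obs_dist S A Ob \<pi> \<theta> \<theta>' n + real S * b * obs_dist S A Ob \<pi> \<theta> \<theta>' (Suc n)"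
    by (intro add_mono state_err_le) (use n in auto)
  also have "\<dots> \<le> real S * b * tv_dist A Ob H \<pi> \<theta> \<theta>' + real S * b * tv_dist A Ob H \<pi> \<theta> \<theta>'"
    by (intro add_mono mult_left_mono obs_dist_le_tv_dist[OF \<theta> \<theta>' \<pi>]) (use n b in auto)
  finally show ?thesis by (simp only: mult_2 distrib_right)
qed

lemma obs_err_le:
  assumes \<pi>: "\<pi> \<in> policies A Ob H"
  shows "obs_err \<pi> \<le> (real S * b + 1) * tv_dist A Ob H \<pi> \<theta> \<theta>'"
proof -
  have "obs_err \<pi> \<le> state_err \<pi> (H - 1) + obs_dist S A Ob \<pi> \<theta> \<theta>' (H - 1)"
    unfolding obs_dist_def state_err_def obs_err_def sum.distrib[symmetric] distrib_left[symmetric]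
  proof (intro sum_mono mult_left_mono)
    fix \<tau> assume "\<tau> \<in> trajectories A Ob (H - 1)"
    then have SH: "Suc (length \<tau>) = H" using H by (simp add: trajectories_def)
    let ?z = "\<lambda>i. forward S \<theta> \<tau> i - pstate \<tau> i" and ?D = "\<lambda>ob. next_obs S \<theta> \<tau> ob - next_obs S \<theta>' \<tau> ob"
    have "(\<Sum>ob<Ob. \<bar>res_obs \<tau> ob\<bar>) \<le> (\<Sum>ob<Ob. (\<Sum>i<S. pmf (emit \<theta> H i) ob * \<bar>?z i\<bar>) + \<bar>?D ob\<bar>)"
    proof (rule sum_mono)
      fix ob
      have "res_obs \<tau> ob = ?D ob - (\<Sum>i<S. pmf (emit \<theta> H i) ob * ?z i)"
        by (simp add: next_obs_def[of S \<theta>] res_obs_def SH right_diff_distrib sum_subtractf)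
      moreover have "\<bar>\<Sum>i<S. pmf (emit \<theta> H i) ob * ?z i\<bar> \<le> (\<Sum>i<S. pmf (emit \<theta> H i) ob * \<bar>?z i\<bar>)"
        by (rule order_trans[OF sum_abs]) (simp add: abs_mult)
      ultimately show "\<bar>res_obs \<tau> ob\<bar> \<le> (\<Sum>i<S. pmf (emit \<theta> H i) ob * \<bar>?z i\<bar>) + \<bar>?D ob\<bar>"
        by linarith
    qed
    also have "\<dots> = (\<Sum>i<S. \<bar>?z i\<bar>) + (\<Sum>ob<Ob. \<bar>?D ob\<bar>)"
      unfolding sum.distrib by (simp only: sum_emit[OF \<theta> H order_refl])
    finally show "(\<Sum>ob<Ob. \<bar>res_obs \<tau> ob\<bar>) \<le> (\<Sum>i<S. \<bar>?z i\<bar>) + (\<Sum>ob<Ob. \<bar>?D ob\<bar>)" .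
  qed simp
  also have "\<dots> \<le> real S * b * obs_dist S A Ob \<pi> \<theta> \<theta>' (H - 1) + obs_dist S A Ob \<pi> \<theta> \<theta>' (H - 1)"
    by (intro add_mono state_err_le order_refl) (use H in simp)
  also have "\<dots> = (real S * b + 1) * tv_dist A Ob H \<pi> \<theta> \<theta>'"
    using H by (simp add: tv_dist_eq_obs_dist[OF \<theta> \<theta>' \<pi>, of "H - 1"] algebra_simps)
  finally show ?thesis .
qed

text \<open>The left-hand side is independent of the policy, so the initial residual can be charged
  to every past episode.\<close>

lemma res_init_le:
  assumes \<pi>: "\<pi> \<in> policies A Ob H"
  shows "(\<Sum>i<S. \<bar>res_init i\<bar>) \<le> real S * b * tv_dist A Ob H \<pi> \<theta> \<theta>'"
proof -
  have "(\<Sum>i<S. \<bar>res_init i\<bar>) = state_err \<pi> 0" by (simp add: state_err_def res_init_def)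
  also have "\<dots> \<le> real S * b * obs_dist S A Ob \<pi> \<theta> \<theta>' 0" by (rule state_err_le) (use H in simp)
  also have "\<dots> \<le> real S * b * tv_dist A Ob H \<pi> \<theta> \<theta>'"
    by (intro mult_left_mono obs_dist_le_tv_dist[OF \<theta> \<theta>' \<pi>]) (use H b in auto)
  finally show ?thesis .
qed

section \<open>Residuals as linear functionals of the true beliefs\<close>

text \<open>The product of \<open>L h\<close> with the emission matrix of the true model; it would
  be the identity if \<open>\<theta>' = \<theta>\<close>. Row \<open>i\<close> expresses a
  pseudo-state coordinate through the true belief.\<close>

definition LE :: "nat \<Rightarrow> nat \<Rightarrow> nat \<Rightarrow> real" where
  "LE h i s = (\<Sum>ob<Ob. L h i ob * pmf (emit \<theta>' h s) ob)"

text \<open>Of the history only the length \<open>n\<close> enters, and the rest is carried by the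
  belief vector. For fixed \<open>n\<close>, \<open>ob\<close>, \<open>a\<close> and
  \<open>i\<close> the residuals of all histories are therefore values of a single
  functional.\<close>

definition step_coeff :: "nat \<Rightarrow> nat \<Rightarrow> nat \<Rightarrow> nat \<Rightarrow> nat \<Rightarrow> real" where
  "step_coeff n ob a i s = forward_step S \<theta> (Suc n) ob a (\<lambda>j. LE (Suc n) j s) i -
     (\<Sum>j<S. LE (Suc (Suc n)) i j * pmf (trans \<theta>' (Suc n) a s) j * pmf (emit \<theta>' (Suc n) s) ob)"

definition obs_coeff :: "nat \<Rightarrow> nat \<Rightarrow> real" where
  "obs_coeff ob s = (\<Sum>i<S. pmf (emit \<theta> H i) ob * LE H i s) - pmf (emit \<theta>' H s) ob"

lemma pstate_eq: "pstate \<tau> i = (\<Sum>s<S. LE (Suc (length \<tau>)) i s * forward S \<theta>' \<tau> s)"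
  unfolding pstate_def next_obs_def LE_def sum_distrib_left sum_distrib_right
  by (subst sum.swap) (simp add: mult_ac)

lemma res_step_eq:
  assumes "length \<tau> = n"
  shows "res_step \<tau> ob a i = (\<Sum>s<S. step_coeff n ob a i s * forward S \<theta>' \<tau> s)"
proof -
  have 1: "forward_step S \<theta> (Suc n) ob a (pstate \<tau>) i =
      (\<Sum>s<S. forward_step S \<theta> (Suc n) ob a (\<lambda>j. LE (Suc n) j s) i * forward S \<theta>' \<tau> s)"
    unfolding forward_step_def pstate_eq assms sum_distrib_left sum_distrib_right
    by (subst sum.swap) (simp add: mult_ac)
  have 2: "pstate (\<tau> @ [(ob, a)]) i = (\<Sum>s<S. (\<Sum>j<S. LE (Suc (Suc n)) i j *
      pmf (trans \<theta>' (Suc n) a s) j * pmf (emit \<theta>' (Suc n) s) ob) * forward S \<theta>' \<tau> s)"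
    unfolding pstate_eq forward_snoc forward_step_def sum_distrib_left sum_distrib_right
    using assms by (subst sum.swap) (simp add: mult_ac)
  show ?thesis
    unfolding res_step_def assms 1 2 step_coeff_def by (simp add: left_diff_distrib sum_subtractf)
qed

lemma res_obs_eq:
  assumes "length \<tau> = H - 1"
  shows "res_obs \<tau> ob = (\<Sum>s<S. obs_coeff ob s * forward S \<theta>' \<tau> s)"
proof -
  have "(\<Sum>i<S. pmf (emit \<theta> H i) ob * pstate \<tau> i) =
      (\<Sum>s<S. (\<Sum>i<S. pmf (emit \<theta> H i) ob * LE H i s) * forward S \<theta>' \<tau> s)"
    unfolding pstate_eq sum_distrib_left sum_distrib_right
    using assms H by (subst sum.swap) (simp add: mult_ac)
  then show ?thesis
    using assms H by (simp add: res_obs_def next_obs_def obs_coeff_def left_diff_distrib sum_subtractf)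
qed

lemma abs_LE_le:
  assumes "1 \<le> h" "h \<le> H" "i < S" "s < S"
  shows "\<bar>LE h i s\<bar> \<le> b"
proof -
  have "\<bar>LE h i s\<bar> \<le> (\<Sum>ob<Ob. b * pmf (emit \<theta>' h s) ob)"
    unfolding LE_def using L_le assms
    by (intro order_trans[OF sum_abs] sum_mono) (auto simp: abs_mult intro!: mult_right_mono)
  also have "\<dots> = b"
    using assms by (simp add: sum_distrib_left[symmetric] sum_pmf_lessThan models_emit[OF \<theta>'])
  finally show ?thesis .
qed

text \<open>Each of the two terms is a subconvex combination of at most \<open>S\<close> entries of
  size \<open>b\<close>. The bound is shared with the initial and observation residuals, where the
  summand 1 accounts for a single probability.\<close>

lemma abs_step_coeff_le:
  assumes "Suc n < H" "a < A" "i < S" "s < S"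
  shows "\<bar>step_coeff n ob a i s\<bar> \<le> 2 * (real S * b) + 1"
proof -
  have "\<bar>forward_step S \<theta> (Suc n) ob a (\<lambda>j. LE (Suc n) j s) i\<bar> \<le> (\<Sum>j<S. b)"
    unfolding forward_step_def mult.assoc using assms
    by (intro order_trans[OF sum_abs] sum_mono)
       (auto simp: abs_mult intro!: pmf_mult_le abs_LE_le)
  moreover have "\<bar>\<Sum>j<S. LE (Suc (Suc n)) i j * pmf (trans \<theta>' (Suc n) a s) j * pmf (emit \<theta>' (Suc n) s) ob\<bar>
      \<le> (\<Sum>j<S. b)"
    unfolding mult.assoc mult.commute[of "LE _ _ _"] using assms
    by (intro order_trans[OF sum_abs] sum_mono)
       (auto simp: abs_mult intro!: pmf_mult_le abs_LE_le)
  ultimately show ?thesis unfolding step_coeff_def by simp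
qed

lemma abs_obs_coeff_le:
  assumes "s < S"
  shows "\<bar>obs_coeff ob s\<bar> \<le> 2 * (real S * b) + 1"
proof -
  have "\<bar>\<Sum>i<S. pmf (emit \<theta> H i) ob * LE H i s\<bar> \<le> (\<Sum>j<S. b)"
    using assms H
    by (intro order_trans[OF sum_abs] sum_mono)
       (auto simp: abs_mult intro!: pmf_mult_le abs_LE_le)
  moreover have "0 \<le> pmf (emit \<theta>' H s) ob" "pmf (emit \<theta>' H s) ob \<le> 1" by (simp_all add: pmf_le_1)
  moreover have "real S * b \<ge> 0" using b by simp
  ultimately show ?thesis unfolding obs_coeff_def sum_constant card_lessThan by linarith
qed

lemma abs_res_init_le:
  assumes "i < S"
  shows "\<bar>res_init i\<bar> \<le> 2 * (real S * b) + 1"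
proof -
  have "\<bar>pstate [] i\<bar> \<le> (\<Sum>s<S. b)"
    unfolding pstate_eq mult.commute[of "LE _ _ _"] using assms H
    by (intro order_trans[OF sum_abs] sum_mono)
       (auto simp: abs_mult intro!: pmf_mult_le abs_LE_le)
  moreover have "0 \<le> pmf (init \<theta>) i" "pmf (init \<theta>) i \<le> 1" by (simp_all add: pmf_le_1)
  moreover have "real S * b \<ge> 0" using b by simp
  ultimately show ?thesis unfolding res_init_def sum_constant card_lessThan by linarith
qed

end

section \<open>Summing the residuals over the episodes\<close>

text \<open>The residuals fall into scalar families indexed by coordinate, by step, observation,
  action and coordinate, or by last observation; the prefactor bounds their number.
  \<open>eluder_sum\<close> bounds each family by the same root: it turns control of the current
  model on past policies, \<open>t < k\<close>, into control on the diagonal.\<close>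

lemma sum_tv_dist_le:
  fixes \<theta> :: "nat \<Rightarrow> model" and \<pi> :: "nat \<Rightarrow> policy"
  assumes S: "S \<ge> 1" and est: "\<And>k. estimation S A Ob H (\<theta> k) \<theta>' (L k) b"
    and \<pi>: "\<And>k. \<pi> k \<in> policies A Ob H" and Z: "0 \<le> Z"
    and tv: "\<And>k. k < n \<Longrightarrow> (\<Sum>t<k. (tv_dist A Ob H (\<pi> t) (\<theta> k) \<theta>')\<^sup>2) \<le> Z"
  defines "R \<equiv> 2 * (real S * b) + 1"
  shows "(\<Sum>k<n. tv_dist A Ob H (\<pi> k) (\<theta> k) \<theta>') \<le>
    (real S + real H * real Ob * real A * real S + real Ob) *
    sqrt (real n * ((real S * R\<^sup>2 + R\<^sup>2 * Z) * (2 * real S * (ln (real S) + ln (1 + real n)))))"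
    (is "_ \<le> _ * ?B")
proof -
  interpret E: estimation S A Ob H "\<theta> k" \<theta>' "L k" b for k by (rule est)
  let ?tv = "\<lambda>t k. tv_dist A Ob H (\<pi> t) (\<theta> k) \<theta>'"
  have b: "b \<ge> 0" and H: "H \<ge> 1" by (rule E.b, rule E.H)
  have Sb: "0 \<le> real S * b" using b by simp
  then have R: "0 \<le> R" "R \<ge> 1" by (auto simp: R_def)
  have B0: "?B \<ge> 0" using S Z R by (intro real_sqrt_ge_zero mult_nonneg_nonneg add_nonneg_nonneg) auto
  \<comment> \<open>\<open>R\<close> has two roles: it bounds the coefficients, and it bounds the
    factor by which a residual may exceed the distance. The budget \<open>Z\<close> for squared
    distances becomes \<open>R\<^sup>2 * Z\<close> for squared residuals.\<close>
  have budget: "(\<Sum>t<k. (f t)\<^sup>2) \<le> R\<^sup>2 * Z" if "k < n" "\<And>t. 0 \<le> f t" "\<And>t. f t \<le> R * ?tv t k" for f k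
  proof -
    have "(\<Sum>t<k. (f t)\<^sup>2) \<le> (\<Sum>t<k. (R * ?tv t k)\<^sup>2)"
      using that by (intro sum_mono power_mono) auto
    also have "\<dots> = R\<^sup>2 * (\<Sum>t<k. (?tv t k)\<^sup>2)" by (simp add: power_mult_distrib sum_distrib_left)
    also have "\<dots> \<le> R\<^sup>2 * Z" using tv[OF that(1)] by (intro mult_left_mono) auto
    finally show ?thesis .
  qed
  have mass: "(\<Sum>\<tau>\<in>trajectories A Ob m. weight (\<pi> t) \<tau> * (\<Sum>s<S. forward S \<theta>' \<tau> s)) = 1" if "m < H" for m t
    using weighted_forward_mass[OF E.\<theta>' \<pi> that] .
  have init: "(\<Sum>k<n. \<bar>E.res_init k i\<bar>) \<le> ?B" if i: "i < S" for i
  proof -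
    have eq: "(\<Sum>s<S. E.res_init k i * pmf (init \<theta>') s) = E.res_init k i" for k
      by (simp add: sum_distrib_left[symmetric] sum_pmf_lessThan models_init[OF E.\<theta>'])
    \<comment> \<open>The initial residual involves no history. It is written as a functional
      constant in \<open>s\<close>, evaluated at the true initial distribution, over a one-point
      index set.\<close>
    have "(\<Sum>k<n. \<Sum>\<tau>\<in>{()}. \<bar>\<Sum>s<S. E.res_init k i * pmf (init \<theta>') s\<bar>) \<le> ?B"
    proof (rule eluder_sum[OF S R(1)])
      show "(\<Sum>t<k. (\<Sum>\<tau>\<in>{()}. \<bar>\<Sum>s<S. E.res_init k i * pmf (init \<theta>') s\<bar>)\<^sup>2) \<le> R\<^sup>2 * Z" if "k < n" for k
      proof (rule budget[OF that])
        fix t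
        have "\<bar>E.res_init k i\<bar> \<le> (\<Sum>i<S. \<bar>E.res_init k i\<bar>)" by (rule member_le_sum) (use i in auto)
        also have "\<dots> \<le> real S * b * ?tv t k" by (rule E.res_init_le[OF \<pi>])
        also have "\<dots> \<le> R * ?tv t k" using Sb by (intro mult_right_mono tv_dist_nonneg, unfold R_def, linarith)
        finally show "(\<Sum>\<tau>\<in>{()}. \<bar>\<Sum>s<S. E.res_init k i * pmf (init \<theta>') s\<bar>) \<le> R * ?tv t k"
          by (simp add: eq)
      qed simp
    qed (use Z R E.abs_res_init_le i in
      \<open>auto simp: R_def sum_pmf_lessThan models_init[OF E.\<theta>'] mult_nonneg_nonneg\<close>)
    then show ?thesis by (simp add: eq)
  qed
  have step: "(\<Sum>k<n. \<Sum>\<tau>\<in>trajectories A Ob m. weight (\<pi> k) (\<tau> @ [(ob, a)]) * \<bar>E.res_step k \<tau> ob a i\<bar>) \<le> ?B"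
    if i: "i < S" and m: "Suc m < H" and oa: "ob < Ob" "a < A" for i m ob a
  proof -
    \<comment> \<open>The weight includes the action \<open>a\<close>. Its probability is at most 1,
      so for fixed \<open>ob\<close> and \<open>a\<close> the total mass of these vectors is still
      at most 1.\<close>
    let ?x = "\<lambda>t \<tau> s. weight (\<pi> t) (\<tau> @ [(ob, a)]) * forward S \<theta>' \<tau> s"
    have eq: "\<bar>\<Sum>s<S. E.step_coeff k m ob a i s * ?x t \<tau> s\<bar> =
        weight (\<pi> t) (\<tau> @ [(ob, a)]) * \<bar>E.res_step k \<tau> ob a i\<bar>" if "\<tau> \<in> trajectories A Ob m" for k t \<tau>
    proof -
      have "(\<Sum>s<S. E.step_coeff k m ob a i s * ?x t \<tau> s) = weight (\<pi> t) (\<tau> @ [(ob, a)]) * E.res_step k \<tau> ob a i"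
        using that by (subst E.res_step_eq[of _ m]) (auto simp: trajectories_def sum_distrib_left mult_ac)
      then show ?thesis by (simp add: abs_mult)
    qed
    have "(\<Sum>k<n. \<Sum>\<tau>\<in>trajectories A Ob m. \<bar>\<Sum>s<S. E.step_coeff k m ob a i s * ?x k \<tau> s\<bar>) \<le> ?B"
    proof (rule eluder_sum[OF S R(1)])
      fix t
      have "(\<Sum>\<tau>\<in>trajectories A Ob m. \<Sum>s<S. \<bar>?x t \<tau> s\<bar>) \<le>
          (\<Sum>\<tau>\<in>trajectories A Ob m. weight (\<pi> t) \<tau> * (\<Sum>s<S. forward S \<theta>' \<tau> s))"
        unfolding sum_distrib_left weight_snoc
        by (intro sum_mono) (auto simp: abs_mult intro!: mult_right_mono mult_left_le pmf_le_1)
      then show "(\<Sum>\<tau>\<in>trajectories A Ob m. \<Sum>s<S. \<bar>?x t \<tau> s\<bar>) \<le> 1" using mass m by simp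
    next
      fix k assume k: "k < n"
      show "(\<Sum>t<k. (\<Sum>\<tau>\<in>trajectories A Ob m. \<bar>\<Sum>s<S. E.step_coeff k m ob a i s * ?x t \<tau> s\<bar>)\<^sup>2) \<le> R\<^sup>2 * Z"
      proof (rule budget[OF k])
        fix t
        have "(\<Sum>\<tau>\<in>trajectories A Ob m. \<bar>\<Sum>s<S. E.step_coeff k m ob a i s * ?x t \<tau> s\<bar>) =
            (\<Sum>\<tau>\<in>trajectories A Ob m. weight (\<pi> t) (\<tau> @ [(ob, a)]) * \<bar>E.res_step k \<tau> ob a i\<bar>)"
          by (intro sum.cong refl eq)
        also have "\<dots> \<le> E.step_err k (\<pi> t) m"
          unfolding E.step_err_def
        proof (rule sum_mono)
          fix \<tau>
          let ?g = "\<lambda>ob a. weight (\<pi> t) (\<tau> @ [(ob, a)]) * (\<Sum>i<S. \<bar>E.res_step k \<tau> ob a i\<bar>)"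
          have "weight (\<pi> t) (\<tau> @ [(ob, a)]) * \<bar>E.res_step k \<tau> ob a i\<bar> \<le> ?g ob a"
            by (intro mult_left_mono member_le_sum) (use i in auto)
          also have "\<dots> \<le> (\<Sum>a<A. ?g ob a)"
            by (rule member_le_sum[of a]) (use oa in \<open>auto intro!: mult_nonneg_nonneg sum_nonneg\<close>)
          also have "\<dots> \<le> (\<Sum>ob<Ob. \<Sum>a<A. ?g ob a)"
            by (rule member_le_sum[of ob "{..<Ob}" "\<lambda>ob. \<Sum>a<A. ?g ob a"])
               (use oa in \<open>auto intro!: mult_nonneg_nonneg sum_nonneg\<close>)
          finally show "weight (\<pi> t) (\<tau> @ [(ob, a)]) * \<bar>E.res_step k \<tau> ob a i\<bar> \<le> (\<Sum>ob<Ob. \<Sum>a<A. ?g ob a)" .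
        qed
        also have "\<dots> \<le> 2 * (real S * b) * ?tv t k" by (rule E.step_err_le[OF \<pi> m])
        also have "\<dots> \<le> R * ?tv t k" by (intro mult_right_mono tv_dist_nonneg, unfold R_def, linarith)
        finally show "(\<Sum>\<tau>\<in>trajectories A Ob m. \<bar>\<Sum>s<S. E.step_coeff k m ob a i s * ?x t \<tau> s\<bar>) \<le> R * ?tv t k" .
      qed (auto intro!: sum_nonneg)
    next
      show "\<bar>E.step_coeff k m ob a i s\<bar> \<le> R" if "s < S" for k s
        unfolding R_def by (rule E.abs_step_coeff_le[OF m oa(2) i that])
    qed (use Z in simp)
    then show ?thesis by (simp add: eq cong: sum.cong)
  qed
  have obs: "(\<Sum>k<n. \<Sum>\<tau>\<in>trajectories A Ob (H - 1). weight (\<pi> k) \<tau> * \<bar>E.res_obs k \<tau> ob\<bar>) \<le> ?B"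
    if ob: "ob < Ob" for ob
  proof -
    let ?X = "trajectories A Ob (H - 1)" and ?x = "\<lambda>t \<tau> s. weight (\<pi> t) \<tau> * forward S \<theta>' \<tau> s"
    have eq: "\<bar>\<Sum>s<S. E.obs_coeff k ob s * ?x t \<tau> s\<bar> = weight (\<pi> t) \<tau> * \<bar>E.res_obs k \<tau> ob\<bar>"
      if "\<tau> \<in> ?X" for k t \<tau>
    proof -
      have "(\<Sum>s<S. E.obs_coeff k ob s * ?x t \<tau> s) = weight (\<pi> t) \<tau> * E.res_obs k \<tau> ob"
        using that by (subst E.res_obs_eq) (auto simp: trajectories_def sum_distrib_left mult_ac)
      then show ?thesis by (simp add: abs_mult)
    qed
    have "(\<Sum>k<n. \<Sum>\<tau>\<in>?X. \<bar>\<Sum>s<S. E.obs_coeff k ob s * ?x k \<tau> s\<bar>) \<le> ?B"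
    proof (rule eluder_sum[OF S R(1)])
      fix t
      have "(\<Sum>\<tau>\<in>?X. \<Sum>s<S. \<bar>?x t \<tau> s\<bar>) = (\<Sum>\<tau>\<in>?X. weight (\<pi> t) \<tau> * (\<Sum>s<S. forward S \<theta>' \<tau> s))"
        unfolding sum_distrib_left by (simp add: abs_mult)
      then show "(\<Sum>\<tau>\<in>?X. \<Sum>s<S. \<bar>?x t \<tau> s\<bar>) \<le> 1" using mass[of "H - 1"] H by simp
    next
      fix k assume k: "k < n"
      show "(\<Sum>t<k. (\<Sum>\<tau>\<in>?X. \<bar>\<Sum>s<S. E.obs_coeff k ob s * ?x t \<tau> s\<bar>)\<^sup>2) \<le> R\<^sup>2 * Z"
      proof (rule budget[OF k])
        fix t
        have "(\<Sum>\<tau>\<in>?X. \<bar>\<Sum>s<S. E.obs_coeff k ob s * ?x t \<tau> s\<bar>) = (\<Sum>\<tau>\<in>?X. weight (\<pi> t) \<tau> * \<bar>E.res_obs k \<tau> ob\<bar>)"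
          by (intro sum.cong refl eq)
        also have "\<dots> \<le> E.obs_err k (\<pi> t)"
          unfolding E.obs_err_def
          by (intro sum_mono mult_left_mono member_le_sum) (use ob in auto)
        also have "\<dots> \<le> (real S * b + 1) * ?tv t k" by (rule E.obs_err_le[OF \<pi>])
        also have "\<dots> \<le> R * ?tv t k" using Sb by (intro mult_right_mono tv_dist_nonneg, unfold R_def, linarith)
        finally show "(\<Sum>\<tau>\<in>?X. \<bar>\<Sum>s<S. E.obs_coeff k ob s * ?x t \<tau> s\<bar>) \<le> R * ?tv t k" .
      qed (auto intro!: sum_nonneg)
    next
      show "\<bar>E.obs_coeff k ob s\<bar> \<le> R" if "s < S" for k s
        unfolding R_def by (rule E.abs_obs_coeff_le[OF that])
    qed (use Z in simp)
    then show ?thesis by (simp add: eq cong: sum.cong)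
  qed
  have "(\<Sum>k<n. ?tv k k) \<le>
      (\<Sum>k<n. (\<Sum>i<S. \<bar>E.res_init k i\<bar>) + (\<Sum>m<H-1. E.step_err k (\<pi> k) m) + E.obs_err k (\<pi> k))"
    by (intro sum_mono E.tv_dist_le_residuals \<pi>)
  also have "\<dots> = (\<Sum>i<S. \<Sum>k<n. \<bar>E.res_init k i\<bar>) +
      (\<Sum>m<H-1. \<Sum>k<n. E.step_err k (\<pi> k) m) + (\<Sum>k<n. E.obs_err k (\<pi> k))"
    unfolding sum.distrib by (simp only: sum.swap[of _ "{..<S}" "{..<n}"] sum.swap[of _ "{..<H-1}" "{..<n}"])
  also have "\<dots> \<le> real S * ?B + real H * real Ob * real A * real S * ?B + real Ob * ?B"
  proof (intro add_mono)
    have "(\<Sum>i<S. \<Sum>k<n. \<bar>E.res_init k i\<bar>) \<le> (\<Sum>i<S. ?B)" by (intro sum_mono init) simp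
    then show "(\<Sum>i<S. \<Sum>k<n. \<bar>E.res_init k i\<bar>) \<le> real S * ?B" by (simp del: real_sqrt_mult)
    have "(\<Sum>k<n. E.step_err k (\<pi> k) m) \<le> real Ob * (real A * (real S * ?B))" if m: "Suc m < H" for m
    proof -
      have "(\<Sum>k<n. E.step_err k (\<pi> k) m) = (\<Sum>ob<Ob. \<Sum>a<A. \<Sum>i<S. \<Sum>k<n. \<Sum>\<tau>\<in>trajectories A Ob m.
          weight (\<pi> k) (\<tau> @ [(ob, a)]) * \<bar>E.res_step k \<tau> ob a i\<bar>)"
        unfolding E.step_err_def sum_distrib_left
        by (simp only: sum.swap[of _ "{..<Ob}" "trajectories A Ob m"] sum.swap[of _ "{..<A}" "trajectories A Ob m"]
            sum.swap[of _ "{..<S}" "trajectories A Ob m"]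
            sum.swap[of _ "{..<Ob}" "{..<n}"] sum.swap[of _ "{..<A}" "{..<n}"] sum.swap[of _ "{..<S}" "{..<n}"])
      also have "\<dots> \<le> (\<Sum>ob<Ob. \<Sum>a<A. \<Sum>i<S. ?B)" by (intro sum_mono step m) auto
      finally show ?thesis by (simp del: real_sqrt_mult)
    qed
    then have "(\<Sum>m<H-1. \<Sum>k<n. E.step_err k (\<pi> k) m) \<le> (\<Sum>m<H-1. real Ob * (real A * (real S * ?B)))"
      by (intro sum_mono) auto
    also have "\<dots> = real (H - 1) * (real Ob * (real A * (real S * ?B)))" by simp
    also have "\<dots> \<le> real H * (real Ob * (real A * (real S * ?B)))"
      using B0 by (intro mult_right_mono mult_nonneg_nonneg) auto
    finally show "(\<Sum>m<H-1. \<Sum>k<n. E.step_err k (\<pi> k) m) \<le> real H * real Ob * real A * real S * ?B"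
      by (simp only: mult.assoc)
    have "(\<Sum>k<n. E.obs_err k (\<pi> k)) =
        (\<Sum>ob<Ob. \<Sum>k<n. \<Sum>\<tau>\<in>trajectories A Ob (H - 1). weight (\<pi> k) \<tau> * \<bar>E.res_obs k \<tau> ob\<bar>)"
      unfolding E.obs_err_def sum_distrib_left
      by (simp only: sum.swap[of _ "{..<Ob}" "trajectories A Ob (H - 1)"] sum.swap[of _ "{..<Ob}" "{..<n}"])
    also have "\<dots> \<le> (\<Sum>ob<Ob. ?B)" by (intro sum_mono obs) auto
    finally show "(\<Sum>k<n. E.obs_err k (\<pi> k)) \<le> real Ob * ?B" by (simp del: real_sqrt_mult)
  qed
  also have "\<dots> = (real S + real H * real Ob * real A * real S + real Ob) * ?B"
    by (simp only: distrib_right)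
  finally show ?thesis .
qed

section \<open>A finite net of models\<close>

text \<open>Normalised integer weights between 0 and \<open>m\<close>. A positive total excludes the
  empty multiset, on which \<open>pmf_of_multiset\<close> is unspecified.\<close>

definition grid_pmfs :: "nat \<Rightarrow> nat \<Rightarrow> nat pmf set" where
  "grid_pmfs n m = (\<lambda>c. pmf_of_multiset (\<Sum>i<n. replicate_mset (c i) i)) `
     {c \<in> PiE {..<n} (\<lambda>_. {..m}). 0 < (\<Sum>i<n. c i)}"

lemma finite_grid_pmfs [simp, intro]: "finite (grid_pmfs n m)"
  unfolding grid_pmfs_def by (intro finite_imageI finite_subset[OF Collect_restrict] finite_PiE) auto

lemma card_grid_pmfs: "card (grid_pmfs n m) \<le> (m + 1) ^ n"
proof -
  have fin: "finite (PiE {..<n} (\<lambda>_. {..m}))" by (intro finite_PiE) auto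
  have "card (grid_pmfs n m) \<le> card {c \<in> PiE {..<n} (\<lambda>_. {..m}). 0 < (\<Sum>i<n. c i)}"
    unfolding grid_pmfs_def by (intro card_image_le finite_subset[OF Collect_restrict fin])
  also have "\<dots> \<le> card (PiE {..<n} (\<lambda>_. {..m}))" by (intro card_mono fin) auto
  also have "\<dots> = (m + 1) ^ n" by (simp add: card_PiE)
  finally show ?thesis .
qed

lemma grid_multiset:
  fixes c :: "nat \<Rightarrow> nat"
  shows "count (\<Sum>i<n. replicate_mset (c i) i) j = (if j < n then c j else 0)"
    and "size (\<Sum>i<n. replicate_mset (c i) i) = (\<Sum>i<n. c i)"
  by (simp_all add: count_sum size_multiset_sum)

lemma grid_multiset_nonempty:
  fixes c :: "nat \<Rightarrow> nat"
  assumes "0 < (\<Sum>i<n. c i)"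
  shows "(\<Sum>i<n. replicate_mset (c i) i) \<noteq> {#}"
proof
  assume "(\<Sum>i<n. replicate_mset (c i) i) = {#}"
  from arg_cong[OF this, of size] show False using assms unfolding grid_multiset(2) by simp
qed

lemma set_grid_pmfs:
  assumes "q \<in> grid_pmfs n m"
  shows "set_pmf q \<subseteq> {..<n}"
proof -
  from assms obtain c where c: "q = pmf_of_multiset (\<Sum>i<n. replicate_mset (c i) i)" "0 < (\<Sum>i<n. c i)"
    by (auto simp: grid_pmfs_def)
  have "j < n" if "j \<in># (\<Sum>i<n. replicate_mset (c i) i)" for j
    using that unfolding count_greater_zero_iff[symmetric] grid_multiset(1) by (simp split: if_splits)
  then show ?thesis unfolding c(1) using grid_multiset_nonempty[OF c(2)] by auto
qed

text \<open>Rounding each \<open>m * pmf p i\<close> up preserves domination and raises the total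
  from \<open>m\<close> to at most \<open>m + n\<close>; normalising then costs the factor
  \<open>1 + n / m\<close>. The slack \<open>k\<close> allows one factor for states and observations
  alike.\<close>

lemma grid_pmfs_dominate:
  assumes p: "set_pmf p \<subseteq> {..<n}" and m: "m \<ge> 1" and nk: "n \<le> k"
  shows "\<exists>q\<in>grid_pmfs n m. \<forall>i. pmf p i \<le> (1 + real k / real m) * pmf q i"
proof -
  define c where "c = restrict (\<lambda>i. nat \<lceil>real m * pmf p i\<rceil>) {..<n}"
  have c: "real m * pmf p i \<le> c i" "c i \<le> real m * pmf p i + 1" "c i \<le> m" if "i < n" for i
  proof -
    have "real m * pmf p i \<le> real m * 1" by (intro mult_left_mono) (auto simp: pmf_le_1)
    then show "c i \<le> m" using that by (simp add: c_def nat_le_iff ceiling_le_iff)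
    have "0 \<le> real m * pmf p i" by simp
    then show "real m * pmf p i \<le> c i" "c i \<le> real m * pmf p i + 1"
      using that of_int_ceiling_le_add_one[of "real m * pmf p i"] le_of_int_ceiling[of "real m * pmf p i"]
      by (simp_all add: c_def)
  qed
  have s1: "(\<Sum>i<n. pmf p i) = 1" by (rule sum_pmf_lessThan[OF p])
  have "real m = (\<Sum>i<n. real m * pmf p i)" by (simp add: sum_distrib_left[symmetric] s1)
  also have "\<dots> \<le> (\<Sum>i<n. real (c i))" by (intro sum_mono c) auto
  finally have lo: "real m \<le> (\<Sum>i<n. real (c i))" .
  have "(\<Sum>i<n. real (c i)) \<le> (\<Sum>i<n. real m * pmf p i + 1)" by (intro sum_mono c) auto
  also have "\<dots> = real m + real n" by (simp add: sum.distrib sum_distrib_left[symmetric] s1)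
  finally have hi: "(\<Sum>i<n. real (c i)) \<le> real m + real k" using nk by simp
  define M where "M = (\<Sum>i<n. replicate_mset (c i) i)"
  have pos: "0 < (\<Sum>i<n. c i)" using lo m by (simp flip: of_nat_sum)
  then have "M \<noteq> {#}" unfolding M_def by (rule grid_multiset_nonempty)
  then have pmfM: "pmf (pmf_of_multiset M) i = (if i < n then c i else 0) / (\<Sum>i<n. real (c i))" for i
    by (simp add: M_def grid_multiset)
  have "pmf_of_multiset M \<in> grid_pmfs n m"
  proof -
    have "c \<in> PiE {..<n} (\<lambda>_. {..m})" by (rule PiE_I) (use c(3) in blast, simp add: c_def)
    with pos show ?thesis unfolding grid_pmfs_def M_def by (intro imageI CollectI conjI)
  qed
  moreover have "pmf p i \<le> (1 + real k / real m) * pmf (pmf_of_multiset M) i" for i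
  proof (cases "i < n")
    case True
    have "pmf p i * (\<Sum>i<n. real (c i)) \<le> pmf p i * (real m + real k)"
      using hi by (intro mult_left_mono) auto
    also have "\<dots> = (1 + real k / real m) * (real m * pmf p i)" using m by (simp add: field_simps)
    also have "\<dots> \<le> (1 + real k / real m) * real (c i)" using c(1)[OF True] by (intro mult_left_mono) auto
    finally show ?thesis using True lo m by (simp add: pmfM pos_le_divide_eq)
  next
    case False
    then have "pmf p i = 0" using p by (auto simp: set_pmf_iff)
    then show ?thesis by simp
  qed
  ultimately show ?thesis by blast
qed

section \<open>The net and its one-sided approximation property\<close>

text \<open>Extensional functions keep the net finite; outside the index ranges the components are
  arbitrary, which \<open>models\<close> permits.\<close>

definition model_net :: "nat \<Rightarrow> nat \<Rightarrow> nat \<Rightarrow> nat \<Rightarrow> nat \<Rightarrow> model set" where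
  "model_net S A Ob H m =
     (\<lambda>(i, t, e). \<lparr>init = i, trans = \<lambda>h a s. t (h, a, s), emit = \<lambda>h s. e (h, s)\<rparr>) `
     (grid_pmfs S m \<times> PiE ({1..<H} \<times> {..<A} \<times> {..<S}) (\<lambda>_. grid_pmfs S m) \<times>
      PiE ({1..H} \<times> {..<S}) (\<lambda>_. grid_pmfs Ob m))"

lemma finite_model_net [simp, intro]: "finite (model_net S A Ob H m)"
  unfolding model_net_def by (intro finite_imageI finite_cartesian_product finite_PiE) auto

lemma model_net_subset: "model_net S A Ob H m \<subseteq> models S A Ob H"
proof
  fix \<theta> assume "\<theta> \<in> model_net S A Ob H m"
  then obtain i t e where \<theta>: "\<theta> = \<lparr>init = i, trans = \<lambda>h a s. t (h, a, s), emit = \<lambda>h s. e (h, s)\<rparr>"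
    and i: "i \<in> grid_pmfs S m" and t: "t \<in> PiE ({1..<H} \<times> {..<A} \<times> {..<S}) (\<lambda>_. grid_pmfs S m)"
    and e: "e \<in> PiE ({1..H} \<times> {..<S}) (\<lambda>_. grid_pmfs Ob m)"
    unfolding model_net_def by (elim imageE SigmaE) (rule that, simp_all)
  have "set_pmf (t (h, a, s)) \<subseteq> {..<S}" if "h \<in> {1..<H}" "a < A" "s < S" for h a s
    by (rule set_grid_pmfs[OF PiE_mem[OF t]]) (use that in simp)
  moreover have "set_pmf (e (h, s)) \<subseteq> {..<Ob}" if "h \<in> {1..H}" "s < S" for h s
    by (rule set_grid_pmfs[OF PiE_mem[OF e]]) (use that in simp)
  ultimately show "\<theta> \<in> models S A Ob H"
    using set_grid_pmfs[OF i] unfolding models_def \<theta> by simp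
qed

lemma card_model_net:
  "card (model_net S A Ob H m) \<le> (m + 1) ^ (S + (H - 1) * A * S * S + H * S * Ob)"
proof -
  let ?T = "PiE ({1..<H} \<times> {..<A} \<times> {..<S}) (\<lambda>_. grid_pmfs S m)"
  let ?E = "PiE ({1..H} \<times> {..<S}) (\<lambda>_. grid_pmfs Ob m)"
  have "card (model_net S A Ob H m) \<le> card (grid_pmfs S m \<times> ?T \<times> ?E)"
    unfolding model_net_def by (intro card_image_le finite_cartesian_product finite_PiE) auto
  also have "\<dots> = card (grid_pmfs S m) * (card (grid_pmfs S m) ^ ((H - 1) * (A * S)) *
      card (grid_pmfs Ob m) ^ (H * S))"
    by (simp add: card_cartesian_product card_PiE)
  also have "\<dots> \<le> (m + 1) ^ S * (((m + 1) ^ S) ^ ((H - 1) * (A * S)) * ((m + 1) ^ Ob) ^ (H * S))"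
    by (intro mult_mono power_mono card_grid_pmfs) auto
  also have "\<dots> = (m + 1) ^ (S + (H - 1) * A * S * S + H * S * Ob)"
    by (simp only: power_mult[symmetric] power_add[symmetric]) (simp add: mult_ac add_ac)
  finally show ?thesis .
qed

lemma model_net_nonempty:
  assumes "S \<ge> 1" "Ob \<ge> 1" "m \<ge> 1"
  shows "model_net S A Ob H m \<noteq> {}"
proof -
  have "grid_pmfs n m \<noteq> {}" if "n \<ge> 1" for n
    using grid_pmfs_dominate[of "return_pmf 0" n m n] that assms by auto
  then show ?thesis using assms by (auto simp: model_net_def PiE_eq_empty_iff)
qed

lemma model_net_dominates:
  assumes \<theta>: "\<theta> \<in> models S A Ob H" and m: "m \<ge> 1"
  defines "\<kappa> \<equiv> 1 + real (S + Ob) / real m"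
  shows "\<exists>\<theta>'\<in>model_net S A Ob H m.
    (\<forall>s. pmf (init \<theta>) s \<le> \<kappa> * pmf (init \<theta>') s) \<and>
    (\<forall>h\<in>{1..<H}. \<forall>a<A. \<forall>s<S. \<forall>s'. pmf (trans \<theta> h a s) s' \<le> \<kappa> * pmf (trans \<theta>' h a s) s') \<and>
    (\<forall>h\<in>{1..H}. \<forall>s<S. \<forall>ob. pmf (emit \<theta> h s) ob \<le> \<kappa> * pmf (emit \<theta>' h s) ob)"
proof -
  obtain i where i: "i \<in> grid_pmfs S m" "\<And>s. pmf (init \<theta>) s \<le> \<kappa> * pmf i s"
    using grid_pmfs_dominate[OF models_init[OF \<theta>] m, of "S + Ob"] unfolding \<kappa>_def by auto
  have "\<forall>x\<in>{1..<H} \<times> {..<A} \<times> {..<S}. \<exists>q\<in>grid_pmfs S m.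
      \<forall>s'. pmf (trans \<theta> (fst x) (fst (snd x)) (snd (snd x))) s' \<le> \<kappa> * pmf q s'"
    unfolding \<kappa>_def by (intro ballI grid_pmfs_dominate m) (simp_all add: mem_Times_iff models_trans[OF \<theta>])
  then obtain t where t: "\<And>x. x \<in> {1..<H} \<times> {..<A} \<times> {..<S} \<Longrightarrow> t x \<in> grid_pmfs S m \<and>
      (\<forall>s'. pmf (trans \<theta> (fst x) (fst (snd x)) (snd (snd x))) s' \<le> \<kappa> * pmf (t x) s')"
    unfolding bchoice_iff Bex_def by metis
  have "\<forall>x\<in>{1..H} \<times> {..<S}. \<exists>q\<in>grid_pmfs Ob m. \<forall>ob. pmf (emit \<theta> (fst x) (snd x)) ob \<le> \<kappa> * pmf q ob"
    unfolding \<kappa>_def by (intro ballI grid_pmfs_dominate m) (simp_all add: mem_Times_iff models_emit[OF \<theta>])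
  then obtain e where e: "\<And>x. x \<in> {1..H} \<times> {..<S} \<Longrightarrow> e x \<in> grid_pmfs Ob m \<and>
      (\<forall>ob. pmf (emit \<theta> (fst x) (snd x)) ob \<le> \<kappa> * pmf (e x) ob)"
    unfolding bchoice_iff Bex_def by metis
  define t' where "t' = restrict t ({1..<H} \<times> {..<A} \<times> {..<S})"
  define e' where "e' = restrict e ({1..H} \<times> {..<S})"
  let ?\<theta>' = "\<lparr>init = i, trans = \<lambda>h a s. t' (h, a, s), emit = \<lambda>h s. e' (h, s)\<rparr>"
  have "?\<theta>' \<in> model_net S A Ob H m"
    unfolding model_net_def
    by (rule image_eqI[of _ _ "(i, t', e')"]) (use i t e in \<open>auto simp: t'_def e'_def\<close>)
  moreover have "pmf (trans \<theta> h a s) s' \<le> \<kappa> * pmf (t' (h, a, s)) s'" if "h \<in> {1..<H}" "a < A" "s < S" for h a s s'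
    using t[of "(h, a, s)"] that by (auto simp: t'_def)
  moreover have "pmf (emit \<theta> h s) ob \<le> \<kappa> * pmf (e' (h, s)) ob" if "h \<in> {1..H}" "s < S" for h s ob
    using e[of "(h, s)"] that by (auto simp: e'_def)
  ultimately show ?thesis using i(2) by (intro bexI[of _ ?\<theta>']) auto
qed

text \<open>Each hidden path contributes one initial, \<open>H - 1\<close> transition and
  \<open>H\<close> emission probabilities, hence \<open>2 * H\<close> factors \<kappa>.\<close>

lemma pmf_episode_dominated:
  assumes \<theta>: "\<theta> \<in> models S A Ob H" and \<theta>': "\<theta>' \<in> models S A Ob H" and \<kappa>: "\<kappa> \<ge> 1"
    and i: "\<And>s. pmf (init \<theta>) s \<le> \<kappa> * pmf (init \<theta>') s"
    and t: "\<And>h a s s'. h \<in> {1..<H} \<Longrightarrow> a < A \<Longrightarrow> s < S \<Longrightarrow> pmf (trans \<theta> h a s) s' \<le> \<kappa> * pmf (trans \<theta>' h a s) s'"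
    and e: "\<And>h s ob. h \<in> {1..H} \<Longrightarrow> s < S \<Longrightarrow> pmf (emit \<theta> h s) ob \<le> \<kappa> * pmf (emit \<theta>' h s) ob"
    and \<tau>: "\<tau> \<in> trajectories A Ob H" and H: "H \<ge> 1"
  shows "pmf (episode H \<theta> \<pi>) \<tau> \<le> \<kappa> ^ (2 * H) * pmf (episode H \<theta>' \<pi>) \<tau>"
proof -
  \<comment> \<open>The initial probability and the two factors of each of the \<open>n\<close>
    completed steps.\<close>
  have fw: "forward S \<theta> \<sigma> s \<le> \<kappa> ^ (2 * n + 1) * forward S \<theta>' \<sigma> s" if "\<sigma> \<in> trajectories A Ob n" "n < H" for \<sigma> n s
    using that
  proof (induction n arbitrary: \<sigma> s)
    case 0
    then show ?case using i by simp
  next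
    case (Suc n)
    from Suc.prems(1) obtain \<sigma>' ob a where \<sigma>: "\<sigma> = \<sigma>' @ [(ob, a)]" "\<sigma>' \<in> trajectories A Ob n" "ob < Ob" "a < A"
      by (cases \<sigma> rule: rev_cases) (auto simp: trajectories_def)
    have "forward S \<theta> \<sigma> s \<le> (\<Sum>r<S. (\<kappa> * pmf (trans \<theta>' (Suc n) a r) s) * (\<kappa> * pmf (emit \<theta>' (Suc n) r) ob) *
        (\<kappa> ^ (2 * n + 1) * forward S \<theta>' \<sigma>' r))"
      unfolding \<sigma>(1) forward_snoc forward_step_def using \<sigma> Suc.prems \<kappa> Suc.IH[OF \<sigma>(2)]
      by (intro sum_mono mult_mono) (auto simp: trajectories_def intro!: t e)
    also have "\<dots> = \<kappa> ^ (2 * Suc n + 1) * forward S \<theta>' \<sigma> s"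
      unfolding \<sigma>(1) forward_snoc forward_step_def using \<sigma>(2)
      by (simp add: sum_distrib_left trajectories_def mult_ac)
    finally show ?case .
  qed
  obtain n where n: "H = Suc n" using H by (cases H) auto
  from \<tau> obtain \<sigma> ob a where \<sigma>: "\<tau> = \<sigma> @ [(ob, a)]" "\<sigma> \<in> trajectories A Ob n"
    by (cases \<tau> rule: rev_cases) (auto simp: trajectories_def n)
  have "next_obs S \<theta> \<sigma> ob \<le> (\<Sum>s<S. (\<kappa> * pmf (emit \<theta>' (Suc n) s) ob) * (\<kappa> ^ (2 * n + 1) * forward S \<theta>' \<sigma> s))"
    unfolding next_obs_def using fw[OF \<sigma>(2)] \<sigma> \<kappa> n
    by (intro sum_mono mult_mono) (auto simp: trajectories_def intro!: e)
  also have "\<dots> = \<kappa> ^ (2 * H) * next_obs S \<theta>' \<sigma> ob"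
    using \<sigma>(2) by (simp add: next_obs_def n trajectories_def sum_distrib_left mult_ac)
  finally have "weight \<pi> \<tau> * next_obs S \<theta> \<sigma> ob \<le> weight \<pi> \<tau> * (\<kappa> ^ (2 * H) * next_obs S \<theta>' \<sigma> ob)"
    by (intro mult_left_mono) auto
  then show ?thesis using \<tau> \<theta> \<theta>' unfolding \<sigma>(1)
    by (simp add: pmf_episode_snoc[of _ S A Ob] mult_ac)
qed

lemma net_approximation:
  assumes S: "S \<ge> 1" and Ob: "Ob \<ge> 1" and H: "H \<ge> 1" and K: "K \<ge> 1" and \<theta>: "\<theta> \<in> models S A Ob H"
  defines "m \<equiv> 2 * (S + Ob) * H * K"
  shows "\<exists>\<theta>'\<in>model_net S A Ob H m. \<forall>\<pi>. \<forall>\<tau>\<in>trajectories A Ob H.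
    pmf (episode H \<theta> \<pi>) \<tau> \<le> exp (1 / real K) * pmf (episode H \<theta>' \<pi>) \<tau>"
proof -
  define \<kappa> where "\<kappa> = 1 + real (S + Ob) / real m"
  have m: "m \<ge> 1" using S H K by (simp add: m_def)
  obtain \<theta>' where \<theta>': "\<theta>' \<in> model_net S A Ob H m" and
    d: "(\<forall>s. pmf (init \<theta>) s \<le> \<kappa> * pmf (init \<theta>') s) \<and>
    (\<forall>h\<in>{1..<H}. \<forall>a<A. \<forall>s<S. \<forall>s'. pmf (trans \<theta> h a s) s' \<le> \<kappa> * pmf (trans \<theta>' h a s) s') \<and>
    (\<forall>h\<in>{1..H}. \<forall>s<S. \<forall>ob. pmf (emit \<theta> h s) ob \<le> \<kappa> * pmf (emit \<theta>' h s) ob)"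
    using model_net_dominates[OF \<theta> m] unfolding \<kappa>_def by blast
  have \<kappa>1: "\<kappa> \<ge> 1" by (simp add: \<kappa>_def)
  \<comment> \<open>The mesh \<open>m\<close> is chosen for this: \<open>2 * H\<close> factors give
    \<open>exp (1 / K)\<close> per episode, hence at most \<open>exp 1\<close> over the whole
    run.\<close>
  have "\<kappa> = 1 + 1 / (2 * real H * real K)"
    using S H K by (simp add: \<kappa>_def m_def divide_simps) (simp add: algebra_simps)
  then have "\<kappa> \<le> exp (1 / (2 * real H * real K))" using exp_ge_add_one_self by simp
  then have "\<kappa> ^ (2 * H) \<le> exp (1 / (2 * real H * real K)) ^ (2 * H)" using \<kappa>1 by (intro power_mono) auto
  also have "\<dots> = exp (1 / real K)" using H by (simp add: exp_of_nat_mult[symmetric])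
  finally have \<kappa>: "\<kappa> ^ (2 * H) \<le> exp (1 / real K)" .
  have "pmf (episode H \<theta> \<pi>) \<tau> \<le> exp (1 / real K) * pmf (episode H \<theta>' \<pi>) \<tau>"
    if "\<tau> \<in> trajectories A Ob H" for \<pi> \<tau>
  proof -
    have "pmf (episode H \<theta> \<pi>) \<tau> \<le> \<kappa> ^ (2 * H) * pmf (episode H \<theta>' \<pi>) \<tau>"
      by (rule pmf_episode_dominated[OF \<theta> _ \<kappa>1 _ _ _ that H]) (use d \<theta>' model_net_subset in blast)+
    also have "\<dots> \<le> exp (1 / real K) * pmf (episode H \<theta>' \<pi>) \<tau>" using \<kappa> by (intro mult_right_mono) auto
    finally show ?thesis .
  qed
  then show ?thesis using \<theta>' by blast
qed

text \<open>The exponent in the size of the net is the number of model parameters, and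
  \<open>m + 1\<close> is at most \<open>8 * ?P\<close>. As \<open>K >= 2\<close> forces
  \<open>?P >= 2\<close>, the summand \<open>ln 8\<close> is at most \<open>3 * ln ?P\<close>, which
  makes the constant 4.\<close>

lemma ln_card_model_net_le:
  assumes "S \<ge> 1" "A \<ge> 1" "Ob \<ge> 1" "H \<ge> 1" "K \<ge> 2"
  shows "ln (real (card (model_net S A Ob H (2 * (S + Ob) * H * K)))) \<le>
    4 * (real H * (real S ^ 2 * real A + real S * real Ob) * ln (real S * real A * real Ob * real H * real K))"
proof -
  let ?m = "2 * (S + Ob) * H * K" and ?P = "real S * real A * real Ob * real H * real K"
  let ?N = "model_net S A Ob H ?m" and ?d = "S + (H - 1) * A * S * S + H * S * Ob"
  have m: "?m \<ge> 1" using assms by simp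
  have N: "card ?N > 0" using model_net_nonempty[OF assms(1,3) m] by (simp add: card_gt_0_iff)
  have P2: "?P \<ge> 2"
  proof -
    have "1 * 1 * 1 * 1 * 2 \<le> ?P" using assms by (intro mult_mono) auto
    then show ?thesis by simp
  qed
  have SO: "S + Ob \<le> 2 * (S * Ob)"
  proof -
    have "S * 1 \<le> S * Ob" "1 * Ob \<le> S * Ob" using assms by (intro mult_le_mono order_refl; simp)+
    then show ?thesis by linarith
  qed
  have "?m + 1 \<le> 2 * ?m" using m by simp
  also have "\<dots> \<le> 8 * (S * A * Ob * H * K)"
  proof -
    have "2 * ?m = 4 * ((S + Ob) * (H * K))" by simp
    also have "\<dots> \<le> 4 * (2 * (S * Ob) * (H * K))" using SO by (intro mult_le_mono order_refl)
    also have "\<dots> = 8 * (S * 1 * Ob * H * K)" by simp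
    also have "\<dots> \<le> 8 * (S * A * Ob * H * K)" using assms by (intro mult_le_mono order_refl) auto
    finally show ?thesis .
  qed
  finally have "real (?m + 1) \<le> real (8 * (S * A * Ob * H * K))" by (rule of_nat_mono)
  then have m8: "real (?m + 1) \<le> 8 * ?P" by simp
  have d: "real ?d \<le> real H * (real S ^ 2 * real A + real S * real Ob)"
  proof -
    have "S \<le> A * S * S" using assms by simp
    then have "?d \<le> A * S * S + (H - 1) * A * S * S + H * S * Ob" by simp
    also have "A * S * S + (H - 1) * A * S * S = H * (A * S * S)"
      using assms by (cases H) (simp_all add: algebra_simps)
    finally have "real ?d \<le> real (H * (A * S * S) + H * S * Ob)" by (rule of_nat_mono)
    then show ?thesis by (simp add: power2_eq_square algebra_simps)
  qed
  have "ln (real (card ?N)) \<le> ln (real ((?m + 1) ^ ?d))"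
    using N card_model_net[of S A Ob H ?m] by (subst ln_le_cancel_iff) (simp_all del: of_nat_power)
  also have "\<dots> = real ?d * ln (real (?m + 1))" by (simp add: ln_realpow)
  also have "\<dots> \<le> real ?d * (4 * ln ?P)"
  proof (intro mult_left_mono)
    have P: "0 < ?P" using P2 by linarith
    have "0 < real (?m + 1)" by (simp only: of_nat_0_less_iff)
    with m8 have "ln (real (?m + 1)) \<le> ln (8 * ?P)" by (rule ln_mono)
    also have "\<dots> = ln 8 + ln ?P" using ln_mult_pos[of 8 ?P] P by linarith
    also have "ln (8::real) = 3 * ln 2" using ln_realpow[of 2 3] by simp
    also have "3 * ln 2 + ln ?P \<le> 3 * ln ?P + ln ?P" using P2 by simp
    finally show "ln (real (?m + 1)) \<le> 4 * ln ?P" by simp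
  qed simp
  also have "\<dots> \<le> real H * (real S ^ 2 * real A + real S * real Ob) * (4 * ln ?P)"
    using d P2 by (intro mult_right_mono) auto
  finally show ?thesis by (simp add: mult_ac)
qed

section \<open>Likelihood ratios along the run of the algorithm\<close>

lemma rollout_trajectories:
  assumes \<theta>: "\<theta> \<in> models S A Ob H" and \<pi>: "\<pi> \<in> policies A Ob H"
  shows "h + n = Suc H \<Longrightarrow> h \<ge> 1 \<Longrightarrow> s < S \<Longrightarrow> \<sigma> \<in> trajectories A Ob (h - 1) \<Longrightarrow>
    set_pmf (rollout \<theta> \<pi> n h s \<sigma>) \<subseteq> trajectories A Ob H"
proof (induction n arbitrary: h s \<sigma>)
  case (Suc n)
  have h: "h \<in> {1..H}" using Suc.prems by auto
  show ?case
  proof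
    fix \<tau> assume "\<tau> \<in> set_pmf (rollout \<theta> \<pi> (Suc n) h s \<sigma>)"
    then obtain ob a where oa: "ob \<in> set_pmf (emit \<theta> h s)" "a \<in> set_pmf (\<pi> \<sigma> ob)" and
      *: "\<tau> \<in> set_pmf (if n = 0 then return_pmf (\<sigma> @ [(ob, a)])
        else bind_pmf (trans \<theta> h a s) (\<lambda>s'. rollout \<theta> \<pi> n (Suc h) s' (\<sigma> @ [(ob, a)])))"
      by (auto simp only: rollout.simps set_bind_pmf UN_iff)
    have ob: "ob < Ob" using oa(1) models_emit[OF \<theta>, of h s] h Suc.prems by auto
    have "\<forall>\<tau>\<in>trajectories A Ob (h - 1). \<forall>ob<Ob. set_pmf (\<pi> \<tau> ob) \<subseteq> {..<A}"
      using \<pi> h unfolding policies_def by blast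
    then have a: "a < A" using oa(2) ob Suc.prems(4) by blast
    have snoc: "\<sigma> @ [(ob, a)] \<in> trajectories A Ob h"
      using snoc_in_trajectories[of \<sigma> ob a A Ob "h - 1"] Suc.prems ob a by simp
    show "\<tau> \<in> trajectories A Ob H"
    proof (cases "n = 0")
      case True
      then show ?thesis using * snoc Suc.prems by simp
    next
      case False
      with * obtain s' where s': "s' \<in> set_pmf (trans \<theta> h a s)"
        "\<tau> \<in> set_pmf (rollout \<theta> \<pi> n (Suc h) s' (\<sigma> @ [(ob, a)]))" by auto
      have "s' < S" using s'(1) models_trans[OF \<theta>, of h a s] False Suc.prems a by auto
      then show ?thesis using Suc.IH[of "Suc h" s' "\<sigma> @ [(ob, a)]"] s'(2) snoc Suc.prems by auto
    qed
  qed
qed simp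

lemma set_pmf_episode:
  assumes "\<theta> \<in> models S A Ob H" "\<pi> \<in> policies A Ob H"
  shows "set_pmf (episode H \<theta> \<pi>) \<subseteq> trajectories A Ob H"
  unfolding episode_def using rollout_trajectories[OF assms, of 1 H _ "[]"] models_init[OF assms(1)]
  by (auto simp: subset_iff)

lemma sum_episode:
  assumes "\<theta> \<in> models S A Ob H" "\<pi> \<in> policies A Ob H"
  shows "(\<Sum>\<tau>\<in>trajectories A Ob H. pmf (episode H \<theta> \<pi>) \<tau>) = 1"
  by (rule sum_pmf_eq_1) (use set_pmf_episode[OF assms] in auto)

section \<open>Affinity and L1 distance\<close>

text \<open>The Hellinger affinity, or Bhattacharyya coefficient, of the two trajectory
  laws.\<close>

definition affinity :: "nat \<Rightarrow> nat \<Rightarrow> nat \<Rightarrow> model \<Rightarrow> model \<Rightarrow> policy \<Rightarrow> real" where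
  "affinity A Ob H \<theta> \<theta>' \<pi> =
     (\<Sum>\<tau>\<in>trajectories A Ob H. sqrt (pmf (episode H \<theta> \<pi>) \<tau> * pmf (episode H \<theta>' \<pi>) \<tau>))"

text \<open>With \<open>p\<close> and \<open>q\<close> the square roots of the two laws, the L1
  distance is the sum of \<open>|p - q| * (p + q)\<close>. Cauchy-Schwarz bounds its square by
  \<open>(2 - 2 c) * (2 + 2 c)\<close>, where \<open>c\<close> is the affinity.\<close>

lemma tv_dist_affinity:
  assumes \<theta>: "\<theta> \<in> models S A Ob H" "\<theta>' \<in> models S A Ob H" and \<pi>: "\<pi> \<in> policies A Ob H"
  shows "(tv_dist A Ob H \<pi> \<theta> \<theta>')\<^sup>2 \<le> 8 * (1 - affinity A Ob H \<theta> \<theta>' \<pi>)"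
    and "affinity A Ob H \<theta> \<theta>' \<pi> \<le> 1"
proof -
  let ?X = "trajectories A Ob H"
  define p where "p \<tau> = sqrt (pmf (episode H \<theta> \<pi>) \<tau>)" for \<tau>
  define q where "q \<tau> = sqrt (pmf (episode H \<theta>' \<pi>) \<tau>)" for \<tau>
  define c where "c = affinity A Ob H \<theta> \<theta>' \<pi>"
  have p0: "p \<tau> \<ge> 0" and q0: "q \<tau> \<ge> 0" for \<tau> by (simp_all add: p_def q_def)
  have p2: "(p \<tau>)\<^sup>2 = pmf (episode H \<theta> \<pi>) \<tau>" and q2: "(q \<tau>)\<^sup>2 = pmf (episode H \<theta>' \<pi>) \<tau>" for \<tau>
    by (simp_all add: p_def q_def)
  have sp: "(\<Sum>\<tau>\<in>?X. (p \<tau>)\<^sup>2) = 1" and sq: "(\<Sum>\<tau>\<in>?X. (q \<tau>)\<^sup>2) = 1"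
    unfolding p2 q2 by (rule sum_episode[OF _ \<pi>], fact \<theta>)+
  have c: "c = (\<Sum>\<tau>\<in>?X. p \<tau> * q \<tau>)" by (simp add: c_def affinity_def p_def q_def real_sqrt_mult)
  have m: "(\<Sum>\<tau>\<in>?X. (p \<tau> - q \<tau>)\<^sup>2) = 2 - 2 * c"
    by (simp add: power2_diff sum.distrib sum_subtractf sp sq c sum_distrib_left mult.assoc)
  have pl: "(\<Sum>\<tau>\<in>?X. (p \<tau> + q \<tau>)\<^sup>2) = 2 + 2 * c"
    by (simp add: power2_sum sum.distrib sp sq c sum_distrib_left mult.assoc)
  have "0 \<le> 2 - 2 * c" unfolding m[symmetric] by (intro sum_nonneg) auto
  then show c1: "affinity A Ob H \<theta> \<theta>' \<pi> \<le> 1" by (simp add: c_def)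
  have "tv_dist A Ob H \<pi> \<theta> \<theta>' = (\<Sum>\<tau>\<in>?X. \<bar>p \<tau> - q \<tau>\<bar> * (p \<tau> + q \<tau>))"
    unfolding tv_dist_def
  proof (intro sum.cong refl)
    fix \<tau>
    have "pmf (episode H \<theta> \<pi>) \<tau> - pmf (episode H \<theta>' \<pi>) \<tau> = (p \<tau> - q \<tau>) * (p \<tau> + q \<tau>)"
      unfolding p2[symmetric] q2[symmetric] by (simp add: power2_eq_square algebra_simps)
    then show "\<bar>pmf (episode H \<theta> \<pi>) \<tau> - pmf (episode H \<theta>' \<pi>) \<tau>\<bar> = \<bar>p \<tau> - q \<tau>\<bar> * (p \<tau> + q \<tau>)"
      using p0[of \<tau>] q0[of \<tau>] by (simp add: abs_mult)
  qed
  then have "(tv_dist A Ob H \<pi> \<theta> \<theta>')\<^sup>2 \<le> (\<Sum>\<tau>\<in>?X. \<bar>p \<tau> - q \<tau>\<bar>\<^sup>2) * (\<Sum>\<tau>\<in>?X. (p \<tau> + q \<tau>)\<^sup>2)"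
    using Cauchy_Schwarz_ineq_sum[of "\<lambda>\<tau>. \<bar>p \<tau> - q \<tau>\<bar>" "\<lambda>\<tau>. p \<tau> + q \<tau>" ?X] by simp
  also have "\<dots> = (2 - 2 * c) * (2 + 2 * c)" by (simp add: m pl)
  also have "\<dots> \<le> (2 - 2 * c) * 4" using c1 by (intro mult_left_mono) (auto simp: c_def)
  finally show "(tv_dist A Ob H \<pi> \<theta> \<theta>')\<^sup>2 \<le> 8 * (1 - affinity A Ob H \<theta> \<theta>' \<pi>)" by (simp add: c_def)
qed

lemma tv_dist_triangle:
  "tv_dist A Ob H \<pi> \<theta>\<^sub>1 \<theta>\<^sub>3 \<le> tv_dist A Ob H \<pi> \<theta>\<^sub>1 \<theta>\<^sub>2 + tv_dist A Ob H \<pi> \<theta>\<^sub>2 \<theta>\<^sub>3"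
  unfolding tv_dist_def sum.distrib[symmetric] by (intro sum_mono) linarith

text \<open>One-sided domination suffices: the differences of the two laws sum to 0, so their
  negative parts have the same total as their positive parts, at most
  \<open>\<epsilon>\<close>.\<close>

lemma tv_dist_dominated:
  assumes \<theta>: "\<theta> \<in> models S A Ob H" "\<theta>' \<in> models S A Ob H" and \<pi>: "\<pi> \<in> policies A Ob H" and \<epsilon>: "\<epsilon> \<ge> 0"
    and dom: "\<And>\<tau>. \<tau> \<in> trajectories A Ob H \<Longrightarrow> pmf (episode H \<theta> \<pi>) \<tau> \<le> (1 + \<epsilon>) * pmf (episode H \<theta>' \<pi>) \<tau>"
  shows "tv_dist A Ob H \<pi> \<theta> \<theta>' \<le> 2 * \<epsilon>"
proof -
  let ?p = "pmf (episode H \<theta> \<pi>)" and ?q = "pmf (episode H \<theta>' \<pi>)"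
  have "tv_dist A Ob H \<pi> \<theta> \<theta>' \<le> (\<Sum>\<tau>\<in>trajectories A Ob H. 2 * \<epsilon> * ?q \<tau> - (?p \<tau> - ?q \<tau>))"
    unfolding tv_dist_def
  proof (rule sum_mono)
    fix \<tau> assume "\<tau> \<in> trajectories A Ob H"
    then have "?p \<tau> - ?q \<tau> \<le> \<epsilon> * ?q \<tau>" using dom[of \<tau>] by (simp add: algebra_simps)
    moreover have "0 \<le> \<epsilon> * ?q \<tau>" using \<epsilon> by simp
    ultimately show "\<bar>?p \<tau> - ?q \<tau>\<bar> \<le> 2 * \<epsilon> * ?q \<tau> - (?p \<tau> - ?q \<tau>)" unfolding mult.assoc by linarith
  qed
  also have "\<dots> = 2 * \<epsilon>"
    by (simp add: sum_subtractf sum_distrib_left[symmetric] sum_episode[OF \<theta>(1) \<pi>] sum_episode[OF \<theta>(2) \<pi>])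
  finally show ?thesis .
qed

section \<open>Likelihoods and likelihood ratios\<close>

lemma elog_mult: "0 \<le> x \<Longrightarrow> 0 \<le> y \<Longrightarrow> elog (x * y) = elog x + elog y"
  by (auto simp: elog_def ln_mult mult_le_0_iff)

lemma elog_le_add_iff: "0 < y \<Longrightarrow> elog x \<le> elog y + ereal b \<longleftrightarrow> x \<le> exp b * y"
proof (cases "x \<le> 0")
  case False
  assume y: "0 < y"
  have "ln x \<le> ln y + b \<longleftrightarrow> ln x \<le> ln (exp b * y)" using y by (simp add: ln_mult add.commute)
  also have "\<dots> \<longleftrightarrow> x \<le> exp b * y" using False y by (subst ln_le_cancel_iff) auto
  finally show ?thesis using False y by (simp add: elog_def)
qed (auto simp: elog_def intro: order_trans[of _ 0])

definition likelihood :: "nat \<Rightarrow> dataset \<Rightarrow> model \<Rightarrow> real" where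
  "likelihood H D \<theta> = prod_list (map (\<lambda>(\<pi>, \<tau>). pmf (episode H \<theta> \<pi>) \<tau>) D)"

lemma likelihood_nonneg: "0 \<le> likelihood H D \<theta>"
  unfolding likelihood_def by (induction D) auto

text \<open>As \<open>elog 0\<close> is minus infinity, \<open>elog\<close> is additive on products
  of nonnegative reals. From here on, comparisons of extended-real sums become comparisons of real
  products.\<close>

lemma log_likelihood_eq: "log_likelihood H D \<theta> = elog (likelihood H D \<theta>)"
proof (induction D)
  case (Cons x D)
  obtain \<pi> \<tau> where x: "x = (\<pi>, \<tau>)" by fastforce
  have "elog (likelihood H (x # D) \<theta>) = elog (pmf (episode H \<theta> \<pi>) \<tau>) + elog (likelihood H D \<theta>)"
    using elog_mult[OF pmf_nonneg likelihood_nonneg, of "episode H \<theta> \<pi>" \<tau> H D \<theta>]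
    by (simp add: x likelihood_def)
  then show ?case using Cons by (simp add: log_likelihood_def x)
qed (simp add: log_likelihood_def likelihood_def elog_def zero_ereal_def)

lemma likelihood_eq_prod: "likelihood H D \<theta> = (\<Prod>t<length D. pmf (episode H \<theta> (fst (D ! t))) (snd (D ! t)))"
  unfolding likelihood_def by (simp add: prod.list_conv_set_nth case_prod_unfold atLeast0LessThan)

lemma prod_list_ennreal:
  "(\<And>x. x \<in> set xs \<Longrightarrow> 0 \<le> f x) \<Longrightarrow>
   prod_list (map (\<lambda>x. ennreal (f x)) xs) = ennreal (prod_list (map f xs)) \<and> 0 \<le> prod_list (map f xs)"
  by (induction xs) (auto simp: ennreal_mult)

definition ratio :: "nat \<Rightarrow> model \<Rightarrow> model \<Rightarrow> policy \<times> trajectory \<Rightarrow> real" where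
  "ratio H \<theta>' \<theta> = (\<lambda>(\<pi>, \<tau>). pmf (episode H \<theta>' \<pi>) \<tau> / pmf (episode H \<theta> \<pi>) \<tau>)"

text \<open>
  The exponential is at most \<open>1 / affinity\<close>, as \<open>x \<le> exp (x - 1)\<close>, but needs no special case for an
  affinity of \<open>0\<close>.
\<close>

definition root_ratio :: "nat \<Rightarrow> nat \<Rightarrow> nat \<Rightarrow> model \<Rightarrow> model \<Rightarrow> policy \<times> trajectory \<Rightarrow> real" where
  "root_ratio A Ob H \<theta>' \<theta> =
     (\<lambda>(\<pi>, \<tau>). sqrt (ratio H \<theta>' \<theta> (\<pi>, \<tau>)) * exp (1 - affinity A Ob H \<theta>' \<theta> \<pi>))"

lemma ratio_nonneg: "0 \<le> ratio H \<theta>' \<theta> x"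
  by (simp add: ratio_def case_prod_unfold)

lemma root_ratio_nonneg: "0 \<le> root_ratio A Ob H \<theta>' \<theta> x"
  by (simp add: root_ratio_def case_prod_unfold ratio_nonneg)

lemma nn_integral_episode:
  assumes "\<theta> \<in> models S A Ob H" "\<pi> \<in> policies A Ob H" "\<And>\<tau>. 0 \<le> f \<tau>"
  shows "(\<integral>\<^sup>+\<tau>. ennreal (f \<tau>) \<partial>measure_pmf (episode H \<theta> \<pi>)) =
    ennreal (\<Sum>\<tau>\<in>trajectories A Ob H. f \<tau> * pmf (episode H \<theta> \<pi>) \<tau>)"
  using set_pmf_episode[OF assms(1,2)] assms(3)
  by (subst nn_integral_measure_pmf_support[of "trajectories A Ob H"])
     (auto simp: ennreal_mult[symmetric] sum_ennreal)

text \<open>Quotients with denominator 0 are 0, so the expectation is the mass that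
  \<open>\<theta>'\<close> puts on the support of \<open>\<theta>\<close>.\<close>

lemma nn_integral_ratio_le:
  assumes \<theta>: "\<theta> \<in> models S A Ob H" and \<theta>': "\<theta>' \<in> models S A Ob H" and \<pi>: "\<pi> \<in> policies A Ob H"
  shows "(\<integral>\<^sup>+\<tau>. ennreal (ratio H \<theta>' \<theta> (\<pi>, \<tau>)) \<partial>measure_pmf (episode H \<theta> \<pi>)) \<le> 1"
proof -
  have "(\<Sum>\<tau>\<in>trajectories A Ob H. ratio H \<theta>' \<theta> (\<pi>, \<tau>) * pmf (episode H \<theta> \<pi>) \<tau>) \<le>
      (\<Sum>\<tau>\<in>trajectories A Ob H. pmf (episode H \<theta>' \<pi>) \<tau>)"
    by (intro sum_mono) (simp add: ratio_def)
  then show ?thesis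
    by (simp add: nn_integral_episode[OF \<theta> \<pi>] ratio_nonneg sum_episode[OF \<theta>' \<pi>])
qed

text \<open>Under \<open>\<theta>\<close> the root of the ratio has expectation \<open>?c\<close>,
  the affinity, and \<open>?c <= exp (?c - 1)\<close>.\<close>

lemma nn_integral_root_ratio_le:
  assumes \<theta>: "\<theta> \<in> models S A Ob H" and \<theta>': "\<theta>' \<in> models S A Ob H" and \<pi>: "\<pi> \<in> policies A Ob H"
  shows "(\<integral>\<^sup>+\<tau>. ennreal (root_ratio A Ob H \<theta>' \<theta> (\<pi>, \<tau>)) \<partial>measure_pmf (episode H \<theta> \<pi>)) \<le> 1"
proof -
  let ?c = "affinity A Ob H \<theta>' \<theta> \<pi>"
  have "sqrt (ratio H \<theta>' \<theta> (\<pi>, \<tau>)) * pmf (episode H \<theta> \<pi>) \<tau> = sqrt (pmf (episode H \<theta>' \<pi>) \<tau> * pmf (episode H \<theta> \<pi>) \<tau>)" for \<tau>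
  proof -
    have "ratio H \<theta>' \<theta> (\<pi>, \<tau>) * (pmf (episode H \<theta> \<pi>) \<tau>)\<^sup>2 = pmf (episode H \<theta>' \<pi>) \<tau> * pmf (episode H \<theta> \<pi>) \<tau>"
      by (cases "pmf (episode H \<theta> \<pi>) \<tau> = 0") (auto simp: ratio_def power2_eq_square)
    then show ?thesis
      using real_sqrt_mult[of "ratio H \<theta>' \<theta> (\<pi>, \<tau>)" "(pmf (episode H \<theta> \<pi>) \<tau>)\<^sup>2"] by simp
  qed
  then have "?c = (\<Sum>\<tau>\<in>trajectories A Ob H. sqrt (ratio H \<theta>' \<theta> (\<pi>, \<tau>)) * pmf (episode H \<theta> \<pi>) \<tau>)"
    by (simp only: affinity_def)
  then have "?c * exp (1 - ?c) = (\<Sum>\<tau>\<in>trajectories A Ob H.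
      sqrt (ratio H \<theta>' \<theta> (\<pi>, \<tau>)) * pmf (episode H \<theta> \<pi>) \<tau> * exp (1 - ?c))"
    by (metis (no_types) sum_distrib_right)
  then have "(\<Sum>\<tau>\<in>trajectories A Ob H. root_ratio A Ob H \<theta>' \<theta> (\<pi>, \<tau>) * pmf (episode H \<theta> \<pi>) \<tau>) = ?c * exp (1 - ?c)"
    by (simp add: root_ratio_def mult_ac)
  also have "\<dots> \<le> exp (?c - 1) * exp (1 - ?c)"
    using exp_ge_add_one_self[of "?c - 1"] by (intro mult_right_mono) auto
  also have "\<dots> = 1" by (simp add: exp_add[symmetric])
  finally show ?thesis
    by (simp add: nn_integral_episode[OF \<theta> \<pi>] root_ratio_nonneg)
qed

section \<open>The law of the data\<close>

locale omle_run =
  fixes S A Ob H :: nat and r :: "nat \<Rightarrow> nat \<Rightarrow> real" and \<alpha> \<beta> :: real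
    and choice :: "dataset \<Rightarrow> model \<times> policy" and \<theta> :: model
  assumes rule: "omle_rule S A Ob H r \<alpha> \<beta> choice" and \<theta>: "\<theta> \<in> models S A Ob H"
begin

lemma choice_policies:
  "D \<in> lists (policies A Ob H \<times> trajectories A Ob H) \<Longrightarrow> snd (choice D) \<in> policies A Ob H"
  using rule unfolding omle_rule_def by (auto simp: mem_Times_iff)

lemma omle_support:
  assumes "D \<in> set_pmf (omle H \<theta> choice k)"
  shows "length D = k \<and> D \<in> lists (policies A Ob H \<times> trajectories A Ob H) \<and>
    (\<forall>t<k. fst (D ! t) = snd (choice (take t D)) \<and> 0 < pmf (episode H \<theta> (fst (D ! t))) (snd (D ! t)))"
  using assms
proof (induction k arbitrary: D)
  case (Suc k)
  then obtain D' \<tau> where D': "D' \<in> set_pmf (omle H \<theta> choice k)"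
    and \<tau>: "\<tau> \<in> set_pmf (episode H \<theta> (snd (choice D')))" and D: "D = D' @ [(snd (choice D'), \<tau>)]"
    by auto
  note IH = Suc.IH[OF D']
  have "snd (choice D') \<in> policies A Ob H" using IH choice_policies by blast
  then have "\<tau> \<in> trajectories A Ob H" using \<tau> set_pmf_episode[OF \<theta>] by blast
  then show ?case
    using IH \<tau> choice_policies[of D'] unfolding D
    by (auto simp: nth_append less_Suc_eq pmf_positive)
qed simp

text \<open>The products form a supermartingale: given the earlier data the policy is fixed, and the
  new factor has expectation at most 1. Episodes beyond the prefix of length \<open>j\<close> leave
  the product unchanged.\<close>

lemma nn_integral_omle_prod_le:
  fixes g :: "policy \<times> trajectory \<Rightarrow> ennreal"
  assumes g: "\<And>\<pi>. \<pi> \<in> policies A Ob H \<Longrightarrow> (\<integral>\<^sup>+\<tau>. g (\<pi>, \<tau>) \<partial>measure_pmf (episode H \<theta> \<pi>)) \<le> 1"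
  shows "(\<integral>\<^sup>+D. prod_list (map g (take j D)) \<partial>measure_pmf (omle H \<theta> choice k)) \<le> 1"
proof (induction k)
  case (Suc k)
  have "(\<integral>\<^sup>+D. prod_list (map g (take j D)) \<partial>measure_pmf (omle H \<theta> choice (Suc k))) =
      (\<integral>\<^sup>+D. (\<integral>\<^sup>+\<tau>. prod_list (map g (take j (D @ [(snd (choice D), \<tau>)])))
        \<partial>measure_pmf (episode H \<theta> (snd (choice D)))) \<partial>measure_pmf (omle H \<theta> choice k))"
    by simp
  also have "\<dots> \<le> (\<integral>\<^sup>+D. prod_list (map g (take j D)) \<partial>measure_pmf (omle H \<theta> choice k))"
  proof (rule nn_integral_mono_AE, unfold AE_measure_pmf_iff, rule ballI)
    fix D assume D: "D \<in> set_pmf (omle H \<theta> choice k)"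
    let ?\<pi> = "snd (choice D)"
    have \<pi>: "?\<pi> \<in> policies A Ob H" using omle_support[OF D] choice_policies by blast
    show "(\<integral>\<^sup>+\<tau>. prod_list (map g (take j (D @ [(?\<pi>, \<tau>)]))) \<partial>measure_pmf (episode H \<theta> ?\<pi>)) \<le>
        prod_list (map g (take j D))"
    proof (cases "j \<le> length D")
      case True
      then show ?thesis by simp
    next
      case False
      then have "(\<integral>\<^sup>+\<tau>. prod_list (map g (take j (D @ [(?\<pi>, \<tau>)]))) \<partial>measure_pmf (episode H \<theta> ?\<pi>)) =
          prod_list (map g (take j D)) * (\<integral>\<^sup>+\<tau>. g (?\<pi>, \<tau>) \<partial>measure_pmf (episode H \<theta> ?\<pi>))"
        by (simp add: nn_integral_cmult take_Cons')
      also have "\<dots> \<le> prod_list (map g (take j D)) * 1" by (intro mult_left_mono g \<pi>) simp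
      finally show ?thesis by simp
    qed
  qed
  also note Suc.IH
  finally show ?case .
qed simp

text \<open>
  Markov's inequality for the sum of all likelihood ratios over the net and over the prefixes of the
  data: no union bound is needed.
\<close>

lemma ratios_bounded:
  assumes N: "finite N" "N \<noteq> {}" "N \<subseteq> models S A Ob H" and K: "K \<ge> 1" and \<delta>: "\<delta> > 0"
  defines "B \<equiv> 2 * real K * real (card N) / \<delta>"
  shows "measure_pmf.prob (omle H \<theta> choice K)
    {D. \<forall>j<K. \<forall>\<theta>'\<in>N. prod_list (map (ratio H \<theta>' \<theta>) (take j D)) \<le> B \<and>
      prod_list (map (root_ratio A Ob H \<theta>' \<theta>) (take j D)) \<le> B} \<ge> 1 - \<delta>"
proof -
  let ?p = "omle H \<theta> choice K"
  let ?G = "\<lambda>\<theta>' j D. prod_list (map (\<lambda>x. ennreal (ratio H \<theta>' \<theta> x)) (take j D))"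
  let ?R = "\<lambda>\<theta>' j D. prod_list (map (\<lambda>x. ennreal (root_ratio A Ob H \<theta>' \<theta> x)) (take j D))"
  \<comment> \<open>Prefix lengths below \<open>K\<close> suffice, since the confidence set of the
    last episode is built from \<open>K - 1\<close> trajectories. There are two ratios per prefix
    and member of the net, whence the expectation bound \<open>2 * K * card N\<close>.\<close>
  define F where "F D = (\<Sum>j<K. \<Sum>\<theta>'\<in>N. ?G \<theta>' j D + ?R \<theta>' j D)" for D
  have cN: "card N > 0" using N by (simp add: card_gt_0_iff)
  have B: "B > 0" using cN K \<delta> by (simp add: B_def)
  have "(\<integral>\<^sup>+D. F D \<partial>measure_pmf ?p) = (\<Sum>j<K. \<Sum>\<theta>'\<in>N.
      (\<integral>\<^sup>+D. ?G \<theta>' j D \<partial>measure_pmf ?p) + (\<integral>\<^sup>+D. ?R \<theta>' j D \<partial>measure_pmf ?p))"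
    unfolding F_def by (simp add: nn_integral_sum nn_integral_add)
  also have "\<dots> \<le> (\<Sum>j<K. \<Sum>\<theta>'\<in>N. 1 + 1)"
    using N(3) nn_integral_ratio_le[OF \<theta>] nn_integral_root_ratio_le[OF \<theta>]
    by (intro sum_mono add_mono nn_integral_omle_prod_le) auto
  also have "\<dots> = ennreal (2 * real K * real (card N))"
    by (simp add: ennreal_mult ennreal_of_nat_eq_real_of_nat mult_ac)
  finally have EF: "(\<integral>\<^sup>+D. F D \<partial>measure_pmf ?p) \<le> ennreal (2 * real K * real (card N))" .
  define bad where "bad = {D. 1 \<le> ennreal (1 / B) * F D}"
  have "emeasure (measure_pmf ?p) bad \<le> ennreal (1 / B) * (\<integral>\<^sup>+D. F D \<partial>measure_pmf ?p)"
    using nn_integral_Markov_inequality[of F UNIV "measure_pmf ?p" "ennreal (1 / B)"]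
    by (simp add: bad_def)
  also have "\<dots> \<le> ennreal (1 / B) * ennreal (2 * real K * real (card N))"
    by (intro mult_left_mono EF) simp
  also have "\<dots> = ennreal \<delta>"
    using B cN K \<delta> by (simp add: ennreal_mult[symmetric] B_def)
  finally have bad: "measure_pmf.prob ?p bad \<le> \<delta>"
    using \<delta> by (simp add: measure_pmf.emeasure_eq_measure)
  have "- bad \<subseteq> {D. \<forall>j<K. \<forall>\<theta>'\<in>N. prod_list (map (ratio H \<theta>' \<theta>) (take j D)) \<le> B \<and>
      prod_list (map (root_ratio A Ob H \<theta>' \<theta>) (take j D)) \<le> B}"
  proof (intro subsetI CollectI allI impI ballI)
    fix D j \<theta>' assume D: "D \<in> - bad" and j: "j < K" and \<theta>': "\<theta>' \<in> N"
    have "F D \<le> ennreal B"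
    proof (rule ccontr)
      assume "\<not> F D \<le> ennreal B"
      then have "ennreal (1 / B) * ennreal B \<le> ennreal (1 / B) * F D" by (intro mult_left_mono) auto
      then show False using D B by (simp add: bad_def ennreal_mult[symmetric])
    qed
    moreover have "?G \<theta>' j D + ?R \<theta>' j D \<le> F D"
    proof -
      have "?G \<theta>' j D + ?R \<theta>' j D \<le> (\<Sum>\<theta>'\<in>N. ?G \<theta>' j D + ?R \<theta>' j D)"
        by (rule member_le_sum) (use \<theta>' N in auto)
      also have "\<dots> \<le> F D" unfolding F_def by (rule member_le_sum) (use j in auto)
      finally show ?thesis .
    qed
    ultimately have le: "?G \<theta>' j D + ?R \<theta>' j D \<le> ennreal B" by (rule order_trans[rotated])
    have "?G \<theta>' j D \<le> ennreal B" by (rule order_trans[OF _ le]) simp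
    moreover have "?R \<theta>' j D \<le> ennreal B" by (rule order_trans[OF _ le]) simp
    ultimately show "prod_list (map (ratio H \<theta>' \<theta>) (take j D)) \<le> B \<and>
      prod_list (map (root_ratio A Ob H \<theta>' \<theta>) (take j D)) \<le> B"
      using B by (simp add: prod_list_ennreal ratio_nonneg root_ratio_nonneg)
  qed
  then have "measure_pmf.prob ?p (- bad) \<le> measure_pmf.prob ?p {D. \<forall>j<K. \<forall>\<theta>'\<in>N.
      prod_list (map (ratio H \<theta>' \<theta>) (take j D)) \<le> B \<and>
      prod_list (map (root_ratio A Ob H \<theta>' \<theta>) (take j D)) \<le> B}"
    by (intro measure_pmf.finite_measure_mono) auto
  moreover have "measure_pmf.prob ?p (- bad) = 1 - measure_pmf.prob ?p bad"
    using measure_pmf.prob_compl[of bad ?p] by (simp add: Compl_eq_Diff_UNIV)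
  ultimately show ?thesis using bad by linarith
qed

end

section \<open>The confidence sets\<close>

lemma prod_list_ratio:
  "prod_list (map (ratio H \<theta>' \<theta>) D) = likelihood H D \<theta>' / likelihood H D \<theta>"
  by (induction D) (auto simp: likelihood_def ratio_def)

lemma prod_list_root_ratio:
  "prod_list (map (root_ratio A Ob H \<theta>' \<theta>) D) =
   sqrt (likelihood H D \<theta>' / likelihood H D \<theta>) * exp (\<Sum>x\<leftarrow>D. 1 - affinity A Ob H \<theta>' \<theta> (fst x))"
  by (induction D)
     (auto simp: likelihood_def root_ratio_def ratio_def real_sqrt_mult real_sqrt_divide exp_add)

lemma likelihood_dominated:
  assumes "D \<in> lists (UNIV \<times> trajectories A Ob H)" "0 \<le> \<kappa>"
    and "\<And>\<pi> \<tau>. \<tau> \<in> trajectories A Ob H \<Longrightarrow> pmf (episode H \<theta> \<pi>) \<tau> \<le> \<kappa> * pmf (episode H \<theta>' \<pi>) \<tau>"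
  shows "likelihood H D \<theta> \<le> \<kappa> ^ length D * likelihood H D \<theta>'"
  using assms(1)
proof (induction D)
  case (Cons x D)
  obtain \<pi> \<tau> where x: "x = (\<pi>, \<tau>)" by fastforce
  have "likelihood H (x # D) \<theta> = pmf (episode H \<theta> \<pi>) \<tau> * likelihood H D \<theta>"
    by (simp add: likelihood_def x)
  also have "\<dots> \<le> (\<kappa> * pmf (episode H \<theta>' \<pi>) \<tau>) * (\<kappa> ^ length D * likelihood H D \<theta>')"
    using Cons assms(2,3) by (intro mult_mono) (auto simp: x likelihood_nonneg)
  also have "\<dots> = \<kappa> ^ length (x # D) * likelihood H (x # D) \<theta>'"
    by (simp add: likelihood_def x mult_ac)
  finally show ?case .
qed (simp add: likelihood_def)

lemma exp_le_1_plus_double: "0 \<le> x \<Longrightarrow> x \<le> 1 \<Longrightarrow> exp x \<le> 1 + 2 * (x::real)"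
  using exp_bound[of x] by (smt (verit) mult_left_le power2_eq_square)

context omle_run
begin

lemma likelihood_pos:
  assumes "D \<in> set_pmf (omle H \<theta> choice K)" "j \<le> K"
  shows "0 < likelihood H (take j D) \<theta>"
  unfolding likelihood_eq_prod
proof (intro prod_pos ballI)
  fix t assume t: "t \<in> {..<length (take j D)}"
  then have "t < K" using omle_support[OF assms(1)] assms(2) by simp
  then have "0 < pmf (episode H \<theta> (fst (D ! t))) (snd (D ! t))" using omle_support[OF assms(1)] by blast
  then show "0 < pmf (episode H \<theta> (fst (take j D ! t))) (snd (take j D ! t))" using t by simp
qed

text \<open>For membership, every likelihood is within the factor \<open>exp 1\<close> of one in the
  net, which is within the factor \<open>B\<close> of the true likelihood. For closeness, a member
  of the confidence set passes its nearly maximal likelihood on to a net model; the bound on the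
  root ratios then limits that model's accumulated \<open>1 - affinity\<close>, and the triangle
  inequality returns to the member.\<close>

lemma confidence_set_properties:
  assumes dims: "S \<ge> 1" "Ob \<ge> 1" "H \<ge> 1" and j: "1 \<le> j" "j < K"
    and D: "D \<in> set_pmf (omle H \<theta> choice K)"
    and N: "N = model_net S A Ob H (2 * (S + Ob) * H * K)"
    and ratio: "\<And>\<theta>'. \<theta>' \<in> N \<Longrightarrow> prod_list (map (ratio H \<theta>' \<theta>) (take j D)) \<le> B"
    and root: "\<And>\<theta>'. \<theta>' \<in> N \<Longrightarrow> prod_list (map (root_ratio A Ob H \<theta>' \<theta>) (take j D)) \<le> B"
    and B: "1 \<le> B" "1 + ln B \<le> \<beta>"
  shows "\<theta> \<in> initial_models S A Ob H \<alpha> \<Longrightarrow> \<theta> \<in> confidence_set S A Ob H \<alpha> \<beta> (take j D)"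
    and "\<theta>' \<in> confidence_set S A Ob H \<alpha> \<beta> (take j D) \<Longrightarrow>
      (\<Sum>t<j. (tv_dist A Ob H (fst (D ! t)) \<theta>' \<theta>)\<^sup>2) \<le> 32 * \<beta> + 32"
proof -
  let ?D = "take j D" and ?l = "likelihood H (take j D)"
  note supp = omle_support[OF D]
  have len: "length ?D = j" using supp j by simp
  then have ne: "?D \<noteq> []" using j by auto
  have K: "K \<ge> 1" using j by simp
  have lists: "?D \<in> lists (UNIV \<times> trajectories A Ob H)"
    using supp by (auto dest!: in_set_takeD simp: mem_Times_iff)
  have l0: "0 < ?l \<theta>" by (rule likelihood_pos[OF D]) (use j in simp)
  have approx: "\<exists>\<theta>\<^sub>1\<in>N. (\<forall>\<pi>. \<forall>\<tau>\<in>trajectories A Ob H.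
      pmf (episode H \<theta>' \<pi>) \<tau> \<le> exp (1 / real K) * pmf (episode H \<theta>\<^sub>1 \<pi>) \<tau>) \<and> ?l \<theta>' \<le> exp 1 * ?l \<theta>\<^sub>1"
    if \<theta>': "\<theta>' \<in> models S A Ob H" for \<theta>'
  proof -
    obtain \<theta>\<^sub>1 where \<theta>\<^sub>1: "\<theta>\<^sub>1 \<in> N" and dom: "\<forall>\<pi>. \<forall>\<tau>\<in>trajectories A Ob H.
        pmf (episode H \<theta>' \<pi>) \<tau> \<le> exp (1 / real K) * pmf (episode H \<theta>\<^sub>1 \<pi>) \<tau>"
      using net_approximation[OF dims K \<theta>'] unfolding N by blast
    have "?l \<theta>' \<le> exp (1 / real K) ^ j * ?l \<theta>\<^sub>1"
      using likelihood_dominated[OF lists, of "exp (1 / real K)" \<theta>' \<theta>\<^sub>1] dom len by simp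
    also have "exp (1 / real K) ^ j = exp (real j / real K)" by (simp add: exp_of_nat_mult[symmetric])
    also have "\<dots> * ?l \<theta>\<^sub>1 \<le> exp 1 * ?l \<theta>\<^sub>1"
      using j by (intro mult_right_mono likelihood_nonneg) auto
    finally show ?thesis using \<theta>\<^sub>1 dom by blast
  qed
  show "\<theta> \<in> confidence_set S A Ob H \<alpha> \<beta> ?D" if init: "\<theta> \<in> initial_models S A Ob H \<alpha>"
  proof -
    have "(SUP \<theta>'\<in>models S A Ob H. log_likelihood H ?D \<theta>') \<le> log_likelihood H ?D \<theta> + ereal \<beta>"
    proof (rule SUP_least)
      fix \<theta>' assume "\<theta>' \<in> models S A Ob H"
      then obtain \<theta>\<^sub>1 where \<theta>\<^sub>1: "\<theta>\<^sub>1 \<in> N" "?l \<theta>' \<le> exp 1 * ?l \<theta>\<^sub>1" using approx by blast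
      have "?l \<theta>\<^sub>1 \<le> B * ?l \<theta>" using ratio[OF \<theta>\<^sub>1(1)] l0 by (simp add: prod_list_ratio pos_divide_le_eq)
      then have "?l \<theta>' \<le> exp 1 * (B * ?l \<theta>)"
        by (intro order_trans[OF \<theta>\<^sub>1(2)] mult_left_mono) simp_all
      also have "\<dots> = exp (1 + ln B) * ?l \<theta>" using B by (simp add: exp_add)
      also have "\<dots> \<le> exp \<beta> * ?l \<theta>" using B l0 by (intro mult_right_mono) auto
      finally show "log_likelihood H ?D \<theta>' \<le> log_likelihood H ?D \<theta> + ereal \<beta>"
        unfolding log_likelihood_eq elog_le_add_iff[OF l0] .
    qed
    then have "(SUP \<theta>'\<in>models S A Ob H. log_likelihood H ?D \<theta>') - ereal \<beta> \<le> log_likelihood H ?D \<theta>"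
      by (simp add: ereal_minus_le)
    then show ?thesis using init \<theta> ne by (simp add: confidence_set_def)
  qed
  show "(\<Sum>t<j. (tv_dist A Ob H (fst (D ! t)) \<theta>' \<theta>)\<^sup>2) \<le> 32 * \<beta> + 32"
    if conf: "\<theta>' \<in> confidence_set S A Ob H \<alpha> \<beta> ?D"
  proof -
    from conf ne have \<theta>': "\<theta>' \<in> models S A Ob H" and
      ge: "(SUP \<theta>'\<in>models S A Ob H. log_likelihood H ?D \<theta>') - ereal \<beta> \<le> log_likelihood H ?D \<theta>'"
      by (auto simp: confidence_set_def)
    have "log_likelihood H ?D \<theta> - ereal \<beta> \<le> log_likelihood H ?D \<theta>'"
      by (rule order_trans[OF ereal_minus_mono[OF SUP_upper[OF \<theta>] order_refl] ge])
    then have ll: "elog (?l \<theta>) \<le> elog (?l \<theta>') + ereal \<beta>"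
      by (simp add: ereal_minus_le log_likelihood_eq)
    have l': "0 < ?l \<theta>'"
    proof (rule ccontr)
      assume "\<not> 0 < ?l \<theta>'"
      then have "elog (?l \<theta>') = -\<infinity>" by (simp add: elog_def)
      with ll l0 show False by (simp add: elog_def)
    qed
    with ll have 1: "?l \<theta> \<le> exp \<beta> * ?l \<theta>'" by (simp add: elog_le_add_iff)
    obtain \<theta>\<^sub>1 where \<theta>\<^sub>1: "\<theta>\<^sub>1 \<in> N" "?l \<theta>' \<le> exp 1 * ?l \<theta>\<^sub>1" and dom: "\<And>\<pi> \<tau>. \<tau> \<in> trajectories A Ob H \<Longrightarrow>
        pmf (episode H \<theta>' \<pi>) \<tau> \<le> exp (1 / real K) * pmf (episode H \<theta>\<^sub>1 \<pi>) \<tau>"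
      using approx[OF \<theta>'] by blast
    have m1: "\<theta>\<^sub>1 \<in> models S A Ob H" using \<theta>\<^sub>1(1) model_net_subset unfolding N by blast
    let ?a = "\<lambda>t. affinity A Ob H \<theta>\<^sub>1 \<theta> (fst (D ! t))"
    have \<pi>: "fst (D ! t) \<in> policies A Ob H" if "t < j" for t
    proof -
      have "D ! t \<in> set D" using supp that j by simp
      then show ?thesis using supp by (auto simp: mem_Times_iff)
    qed
    have sum_eq: "(\<Sum>x\<leftarrow>?D. 1 - affinity A Ob H \<theta>\<^sub>1 \<theta> (fst x)) = (\<Sum>t<j. 1 - ?a t)"
      using len j by (simp add: sum_list_sum_nth atLeast0LessThan)
    have "exp (- (\<beta> + 1)) \<le> ?l \<theta>\<^sub>1 / ?l \<theta>"
    proof -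
      have "?l \<theta> \<le> exp \<beta> * (exp 1 * ?l \<theta>\<^sub>1)"
        by (rule order_trans[OF 1 mult_left_mono[OF \<theta>\<^sub>1(2)]]) simp
      then have "exp (- (\<beta> + 1)) * ?l \<theta> \<le> exp (- (\<beta> + 1)) * (exp (\<beta> + 1) * ?l \<theta>\<^sub>1)"
        by (intro mult_left_mono) (simp_all add: exp_add mult_ac)
      also have "\<dots> = ?l \<theta>\<^sub>1" by (simp add: mult.assoc[symmetric] exp_add[symmetric])
      finally show ?thesis using l0 by (simp add: pos_le_divide_eq)
    qed
    then have "sqrt (exp (- (\<beta> + 1))) \<le> sqrt (?l \<theta>\<^sub>1 / ?l \<theta>)" by (rule real_sqrt_le_mono)
    moreover have "sqrt (exp (- (\<beta> + 1))) = exp (- ((\<beta> + 1) / 2))"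
      by (rule real_sqrt_unique) (simp_all add: exp_double[symmetric] field_simps)
    ultimately have "exp (- ((\<beta> + 1) / 2)) \<le> sqrt (?l \<theta>\<^sub>1 / ?l \<theta>)" by (simp only:)
    then have "exp (- ((\<beta> + 1) / 2)) * exp (\<Sum>t<j. 1 - ?a t) \<le> sqrt (?l \<theta>\<^sub>1 / ?l \<theta>) * exp (\<Sum>t<j. 1 - ?a t)"
      by (intro mult_right_mono) auto
    also have "\<dots> \<le> B" using root[OF \<theta>\<^sub>1(1)] by (simp add: prod_list_root_ratio sum_eq)
    also have "B = exp (ln B)" using B by simp
    finally have "(\<Sum>t<j. 1 - ?a t) - (\<beta> + 1) / 2 \<le> ln B" by (simp add: exp_add[symmetric])
    then have "(\<Sum>t<j. 1 - ?a t) \<le> ln B + (\<beta> + 1) / 2" by (simp only: diff_le_eq)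
    \<comment> \<open>\<open>ln B\<close> is nonnegative and at most
      \<open>\<beta> - 1\<close>.\<close>
    also have "\<dots> \<le> 2 * \<beta>" using B(2) ln_ge_zero[OF B(1)] by (simp add: field_simps)
    finally have aff: "(\<Sum>t<j. 1 - ?a t) \<le> 2 * \<beta>" .
    \<comment> \<open>The distance from \<open>\<theta>'\<close> to the net model is at most
      \<open>4 / K\<close>, so its square contributes at most \<open>32 / K\<close> per episode and
      at most 32 over the run.\<close>
    have tv: "(tv_dist A Ob H (fst (D ! t)) \<theta>' \<theta>)\<^sup>2 \<le> 16 * (1 - ?a t) + 32 / real K" if t: "t < j" for t
    proof -
      let ?\<pi> = "fst (D ! t)"
      have K1: "0 \<le> 1 / real K" "1 / real K \<le> 1" using K by auto
      have "tv_dist A Ob H ?\<pi> \<theta>' \<theta>\<^sub>1 \<le> 2 * (2 * (1 / real K))"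
      proof (rule tv_dist_dominated[OF \<theta>' m1 \<pi>[OF t]])
        fix \<tau> assume "\<tau> \<in> trajectories A Ob H"
        then have "pmf (episode H \<theta>' ?\<pi>) \<tau> \<le> exp (1 / real K) * pmf (episode H \<theta>\<^sub>1 ?\<pi>) \<tau>" by (rule dom)
        also have "\<dots> \<le> (1 + 2 * (1 / real K)) * pmf (episode H \<theta>\<^sub>1 ?\<pi>) \<tau>"
          by (intro mult_right_mono exp_le_1_plus_double K1) simp
        finally show "pmf (episode H \<theta>' ?\<pi>) \<tau> \<le> (1 + 2 * (1 / real K)) * pmf (episode H \<theta>\<^sub>1 ?\<pi>) \<tau>" .
      qed simp
      then have a: "(tv_dist A Ob H ?\<pi> \<theta>' \<theta>\<^sub>1)\<^sup>2 \<le> (4 / real K)\<^sup>2"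
        by (intro power_mono tv_dist_nonneg) simp
      have "(tv_dist A Ob H ?\<pi> \<theta>' \<theta>)\<^sup>2 \<le> (tv_dist A Ob H ?\<pi> \<theta>' \<theta>\<^sub>1 + tv_dist A Ob H ?\<pi> \<theta>\<^sub>1 \<theta>)\<^sup>2"
        by (intro power_mono tv_dist_triangle tv_dist_nonneg)
      also have "\<dots> \<le> 2 * (tv_dist A Ob H ?\<pi> \<theta>' \<theta>\<^sub>1)\<^sup>2 + 2 * (tv_dist A Ob H ?\<pi> \<theta>\<^sub>1 \<theta>)\<^sup>2"
        using sum_squares_bound[of "tv_dist A Ob H ?\<pi> \<theta>' \<theta>\<^sub>1" "tv_dist A Ob H ?\<pi> \<theta>\<^sub>1 \<theta>"]
        by (simp add: power2_sum)
      also have "\<dots> \<le> 2 * (4 / real K)\<^sup>2 + 2 * (8 * (1 - ?a t))"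
        using a tv_dist_affinity(1)[OF m1 \<theta> \<pi>[OF t]] by linarith
      also have "2 * (4 / real K)\<^sup>2 = 32 / real K * (1 / real K)" by (simp add: power2_eq_square)
      also have "\<dots> \<le> 32 / real K * 1" using K by (intro mult_left_mono) auto
      finally show ?thesis by simp
    qed
    have "(\<Sum>t<j. (tv_dist A Ob H (fst (D ! t)) \<theta>' \<theta>)\<^sup>2) \<le> (\<Sum>t<j. 16 * (1 - ?a t) + 32 / real K)"
      by (intro sum_mono tv) auto
    also have "\<dots> = 16 * (\<Sum>t<j. 1 - ?a t) + real j * (32 / real K)"
      by (simp add: sum.distrib sum_distrib_left)
    also have "\<dots> \<le> 16 * (2 * \<beta>) + real K * (32 / real K)"
      using aff j by (intro add_mono mult_left_mono mult_right_mono) auto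
    also have "\<dots> = 32 * \<beta> + 32" using K by simp
    finally show ?thesis .
  qed
qed

end

section \<open>Regret\<close>

lemma policy_value_eq:
  assumes "\<theta> \<in> models S A Ob H" "\<pi> \<in> policies A Ob H"
  shows "policy_value H r \<theta> \<pi> =
    (\<Sum>\<tau>\<in>trajectories A Ob H. pmf (episode H \<theta> \<pi>) \<tau> * (\<Sum>h=1..H. r h (fst (\<tau> ! (h - 1)))))"
  unfolding policy_value_def using set_pmf_episode[OF assms]
  by (subst integral_measure_pmf[of "trajectories A Ob H"]) auto

lemma policy_value_diff_le:
  assumes "\<theta> \<in> models S A Ob H" "\<theta>' \<in> models S A Ob H" "\<pi> \<in> policies A Ob H" "r \<in> rewards Ob H"
  shows "policy_value H r \<theta> \<pi> - policy_value H r \<theta>' \<pi> \<le> real H * tv_dist A Ob H \<pi> \<theta> \<theta>'"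
proof -
  let ?R = "\<lambda>\<tau>. \<Sum>h=1..H. r h (fst (\<tau> ! (h - 1)))"
  have "policy_value H r \<theta> \<pi> - policy_value H r \<theta>' \<pi> =
      (\<Sum>\<tau>\<in>trajectories A Ob H. (pmf (episode H \<theta> \<pi>) \<tau> - pmf (episode H \<theta>' \<pi>) \<tau>) * ?R \<tau>)"
    unfolding policy_value_eq[OF assms(1,3)] policy_value_eq[OF assms(2,3)]
    by (simp only: sum_subtractf left_diff_distrib)
  also have "\<dots> \<le> (\<Sum>\<tau>\<in>trajectories A Ob H. \<bar>pmf (episode H \<theta> \<pi>) \<tau> - pmf (episode H \<theta>' \<pi>) \<tau>\<bar> * real H)"
  proof (rule sum_mono)
    fix \<tau> assume \<tau>: "\<tau> \<in> trajectories A Ob H"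
    have r: "0 \<le> r h (fst (\<tau> ! (h - 1))) \<and> r h (fst (\<tau> ! (h - 1))) \<le> 1" if h: "h \<in> {1..H}" for h
    proof -
      have "\<tau> ! (h - 1) \<in> set \<tau>" using \<tau> h by (auto simp: trajectories_def)
      then have "fst (\<tau> ! (h - 1)) < Ob" using \<tau> by (auto simp: trajectories_def)
      then show ?thesis using assms(4) h by (auto simp: rewards_def)
    qed
    have "0 \<le> ?R \<tau>" using r by (intro sum_nonneg) auto
    moreover have "?R \<tau> \<le> (\<Sum>h=1..H. 1)" using r by (intro sum_mono) auto
    ultimately have "\<bar>?R \<tau>\<bar> \<le> real H" by simp
    then have le: "\<bar>pmf (episode H \<theta> \<pi>) \<tau> - pmf (episode H \<theta>' \<pi>) \<tau>\<bar> * \<bar>?R \<tau>\<bar> \<le>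
        \<bar>pmf (episode H \<theta> \<pi>) \<tau> - pmf (episode H \<theta>' \<pi>) \<tau>\<bar> * real H" by (intro mult_left_mono) auto
    show "(pmf (episode H \<theta> \<pi>) \<tau> - pmf (episode H \<theta>' \<pi>) \<tau>) * ?R \<tau> \<le>
        \<bar>pmf (episode H \<theta> \<pi>) \<tau> - pmf (episode H \<theta>' \<pi>) \<tau>\<bar> * real H"
      by (rule order_trans[OF abs_ge_self]) (simp only: abs_mult le)
  qed
  also have "\<dots> = real H * tv_dist A Ob H \<pi> \<theta> \<theta>'"
    by (simp only: tv_dist_def sum_distrib_right[symmetric] mult.commute[of "real H"])
  finally show ?thesis .
qed

lemma initial_models_left_inverse:
  assumes S: "S \<ge> 1" and H: "H \<ge> 1" and \<alpha>: "\<alpha> > 0" and \<theta>: "\<theta> \<in> initial_models S A Ob H \<alpha>"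
    and \<theta>': "\<theta>' \<in> models S A Ob H"
  shows "\<exists>L. estimation S A Ob H \<theta> \<theta>' L (inverse \<alpha>)"
proof -
  have "\<exists>L. (\<forall>i<S. \<forall>j<S. (\<Sum>k<Ob. L i k * pmf (emit \<theta> h j) k) = (if i = j then 1 else 0)) \<and>
      (\<forall>i<S. \<forall>k<Ob. \<bar>L i k\<bar> \<le> inverse \<alpha>)" if h: "h \<in> {1..H}" for h
  proof (rule left_inverse_exists[OF \<alpha>])
    fix x :: "nat \<Rightarrow> real"
    let ?M = "emission_matrix S Ob \<theta> h"
    have "(MIN h\<in>{1..H}. singular_value S (emission_matrix S Ob \<theta> h)) \<le> singular_value S ?M"
      using h by (intro Min_le) auto
    then have sv: "singular_value S ?M \<ge> \<alpha>" using \<theta> by (simp add: initial_models_def)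
    have "?M \<in> carrier_mat Ob S" by (simp add: emission_matrix_def)
    from singular_value_lower_bound[OF this S \<alpha> sv, of x]
    have "\<alpha>\<^sup>2 * (\<Sum>i<S. (x i)\<^sup>2) \<le> (\<Sum>k<Ob. (\<Sum>i<S. ?M $$ (k, i) * x i)\<^sup>2)" .
    also have "\<dots> = (\<Sum>k<Ob. (\<Sum>i<S. pmf (emit \<theta> h i) k * x i)\<^sup>2)"
      by (simp add: emission_matrix_def)
    finally show "\<alpha>\<^sup>2 * (\<Sum>i<S. (x i)\<^sup>2) \<le> (\<Sum>k<Ob. (\<Sum>i<S. pmf (emit \<theta> h i) k * x i)\<^sup>2)" .
  qed
  then obtain L where "\<forall>h\<in>{1..H}. (\<forall>i<S. \<forall>j<S. (\<Sum>k<Ob. L h i k * pmf (emit \<theta> h j) k) = (if i = j then 1 else 0)) \<and>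
      (\<forall>i<S. \<forall>k<Ob. \<bar>L h i k\<bar> \<le> inverse \<alpha>)" by metis
  then have "estimation S A Ob H \<theta> \<theta>' L (inverse \<alpha>)"
    using H \<alpha> \<theta> \<theta>' by unfold_locales (auto simp: initial_models_def)
  then show ?thesis by blast
qed

lemma confidence_set_subset: "confidence_set S A Ob H \<alpha> \<beta> D \<subseteq> initial_models S A Ob H \<alpha>"
  by (auto simp: confidence_set_def)

context omle_run
begin

lemma optimism:
  assumes D: "D \<in> lists (policies A Ob H \<times> trajectories A Ob H)"
    and conf: "\<theta> \<in> confidence_set S A Ob H \<alpha> \<beta> D" and A: "A \<ge> 1"
  shows "fst (choice D) \<in> confidence_set S A Ob H \<alpha> \<beta> D"
    and "optimal_value A Ob H r \<theta> \<le> policy_value H r (fst (choice D)) (snd (choice D))"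
proof -
  let ?C = "confidence_set S A Ob H \<alpha> \<beta> D \<times> policies A Ob H"
  have max: "is_arg_max (\<lambda>(\<theta>, \<pi>). policy_value H r \<theta> \<pi>) (\<lambda>x. x \<in> ?C) (choice D)"
    using rule D conf unfolding omle_rule_def by blast
  then have mem: "choice D \<in> ?C" by (simp add: is_arg_max_def)
  then show "fst (choice D) \<in> confidence_set S A Ob H \<alpha> \<beta> D" by (simp add: mem_Times_iff)
  show "optimal_value A Ob H r \<theta> \<le> policy_value H r (fst (choice D)) (snd (choice D))"
    unfolding optimal_value_def
  proof (rule cSUP_least)
    have "(\<lambda>_ _. return_pmf 0) \<in> policies A Ob H" using A by (auto simp: policies_def)
    then show "policies A Ob H \<noteq> {}" by blast
  next
    fix \<pi> assume "\<pi> \<in> policies A Ob H"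
    then have "(\<theta>, \<pi>) \<in> ?C" using conf by simp
    then show "policy_value H r \<theta> \<pi> \<le> policy_value H r (fst (choice D)) (snd (choice D))"
      using max unfolding is_arg_max_def by (fastforce simp: case_prod_unfold not_less)
  qed
qed

text \<open>Optimism replaces the optimal value by the value that the optimistic model promises for
  the executed policy. What remains per episode is the difference between the values of one policy
  under two models.\<close>

lemma regret_le_sum_tv_dist:
  assumes D: "D \<in> set_pmf (omle H \<theta> choice K)" and A: "A \<ge> 1" and r: "r \<in> rewards Ob H" and k: "k \<le> K"
    and conf: "\<And>t. t < K \<Longrightarrow> \<theta> \<in> confidence_set S A Ob H \<alpha> \<beta> (take t D)"
  shows "regret A Ob H r \<theta> D k \<le>
    (\<Sum>t<k. real H * tv_dist A Ob H (fst (D ! t)) (fst (choice (take t D))) \<theta>)"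
proof -
  note supp = omle_support[OF D]
  have "regret A Ob H r \<theta> D k = (\<Sum>t<k. optimal_value A Ob H r \<theta> - policy_value H r \<theta> (fst (D ! t)))"
    unfolding regret_def
    by (rule sum.reindex_bij_witness[where i = Suc and j = "\<lambda>t. t - 1"]) auto
  also have "\<dots> \<le> (\<Sum>t<k. real H * tv_dist A Ob H (fst (D ! t)) (fst (choice (take t D))) \<theta>)"
  proof (rule sum_mono)
    fix t assume "t \<in> {..<k}"
    then have t: "t < K" using k by simp
    let ?c = "choice (take t D)"
    have lists: "take t D \<in> lists (policies A Ob H \<times> trajectories A Ob H)"
      using supp by (auto dest!: in_set_takeD)
    have \<pi>: "fst (D ! t) = snd ?c" using supp t by blast
    have "fst ?c \<in> models S A Ob H" using rule lists unfolding omle_rule_def by (auto simp: mem_Times_iff)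
    then have "policy_value H r (fst ?c) (snd ?c) - policy_value H r \<theta> (snd ?c) \<le>
        real H * tv_dist A Ob H (snd ?c) (fst ?c) \<theta>"
      by (rule policy_value_diff_le[OF _ \<theta> choice_policies[OF lists] r])
    with optimism(2)[OF lists conf[OF t] A]
    show "optimal_value A Ob H r \<theta> - policy_value H r \<theta> (fst (D ! t)) \<le>
        real H * tv_dist A Ob H (fst (D ! t)) (fst ?c) \<theta>"
      unfolding \<pi> by linarith
  qed
  finally show ?thesis .
qed

end

section \<open>The explicit polynomial and the final bound\<close>

text \<open>\<open>2 * (s * i) + 1\<close> bounds the coefficients with \<open>i\<close> the inverse
  of \<alpha>. The term ending in \<open>+ 32\<close> is the squared-distance budget
  \<open>32 * \<beta> + 32\<close>, with \<open>s + a + ob + h + l\<close> in place of the logarithm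
  inside \<beta>. The factor \<open>s + 1 + l\<close> bounds the logarithms of the elliptical
  potential, and \<open>1 +\<close> turns a bound under a square root into a polynomial one.\<close>

definition regret_bound :: "real \<Rightarrow> real \<Rightarrow> real \<Rightarrow> real \<Rightarrow> real \<Rightarrow> real \<Rightarrow> real" where
  "regret_bound s a ob h i l =
     h * ((s + h * ob * a * s + ob) *
       (1 + (s * (2 * (s * i) + 1)\<^sup>2 + (2 * (s * i) + 1)\<^sup>2 *
              (32 * (7 * (h * (s\<^sup>2 * a + s * ob) * (s + a + ob + h + l) + l)) + 32)) *
            (2 * s * (s + 1 + l))))"

lemma polynomial_regret_bound:
  "real_polynomial_function (\<lambda>(s, a, ob, h, i, l). regret_bound s a ob h i l)"
proof -
  have lin: "real_polynomial_function f" if "bounded_linear f"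
    for f :: "real \<times> real \<times> real \<times> real \<times> real \<times> real \<Rightarrow> real"
    using that by (rule real_polynomial_function.intros(1))
  have coords: "real_polynomial_function (\<lambda>x :: real \<times> real \<times> real \<times> real \<times> real \<times> real. fst x)"
    "real_polynomial_function (\<lambda>x :: real \<times> real \<times> real \<times> real \<times> real \<times> real. fst (snd x))"
    "real_polynomial_function (\<lambda>x :: real \<times> real \<times> real \<times> real \<times> real \<times> real. fst (snd (snd x)))"
    "real_polynomial_function (\<lambda>x :: real \<times> real \<times> real \<times> real \<times> real \<times> real. fst (snd (snd (snd x))))"
    "real_polynomial_function (\<lambda>x :: real \<times> real \<times> real \<times> real \<times> real \<times> real. fst (snd (snd (snd (snd x)))))"
    "real_polynomial_function (\<lambda>x :: real \<times> real \<times> real \<times> real \<times> real \<times> real. snd (snd (snd (snd (snd x)))))"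
    by (intro lin bounded_linear_fst_comp bounded_linear_snd_comp bounded_linear_ident)+
  show ?thesis
    unfolding case_prod_unfold regret_bound_def power2_eq_square
    by (intro real_polynomial_function.intros(2-4) coords)
qed

lemma (in omle_run) regret_le:
  fixes K :: nat and \<delta> :: real
  defines "\<iota> \<equiv> ln (real S * real A * real Ob * real H * real K)" and "l \<equiv> ln (inverse \<delta> * real K)"
    and "d \<equiv> real H * (real S ^ 2 * real A + real S * real Ob)"
  assumes dims: "S \<ge> 1" "A \<ge> 1" "Ob \<ge> 1" "H \<ge> 1" "K \<ge> 1" and \<alpha>: "\<alpha> > 0" and \<delta>: "0 < \<delta>" "\<delta> \<le> 1"
    and \<beta>: "\<beta> = 7 * (d * \<iota> + l)" and r: "r \<in> rewards Ob H" and init: "\<theta> \<in> initial_models S A Ob H \<alpha>"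
    and D: "D \<in> set_pmf (omle H \<theta> choice K)"
    and N: "N = model_net S A Ob H (2 * (S + Ob) * H * K)" and B: "B = 2 * real K * real (card N) / \<delta>"
    and event: "\<And>j \<theta>'. j < K \<Longrightarrow> \<theta>' \<in> N \<Longrightarrow> prod_list (map (ratio H \<theta>' \<theta>) (take j D)) \<le> B \<and>
      prod_list (map (root_ratio A Ob H \<theta>' \<theta>) (take j D)) \<le> B"
    and n: "n \<le> K"
  shows "regret A Ob H r \<theta> D n \<le>
    regret_bound (real S) (real A) (real Ob) (real H) (inverse \<alpha>) l * sqrt (real n)"
proof -
  let ?P = "real S * real A * real Ob * real H * real K"
  note supp = omle_support[OF D]
  have P1: "?P \<ge> 1"
  proof -
    have "1 * 1 * 1 * 1 * 1 \<le> ?P" using dims by (intro mult_mono) auto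
    then show ?thesis by simp
  qed
  have \<iota>0: "\<iota> \<ge> 0" unfolding \<iota>_def using P1 by (rule ln_ge_zero)
  have lK: "ln (real K) \<le> l"
  proof -
    have "1 * real K \<le> inverse \<delta> * real K" using \<delta> by (intro mult_right_mono) (simp_all add: one_le_inverse)
    then show ?thesis unfolding l_def using dims by (intro ln_mono) auto
  qed
  moreover have "ln (real K) \<ge> 0" using dims by (intro ln_ge_zero) simp
  ultimately have l0: "l \<ge> 0" by linarith
  have d1: "d \<ge> 1"
  proof -
    have "1 * (1 ^ 2 * 1 + 0) \<le> d" unfolding d_def using dims
      by (intro mult_mono add_mono power_mono) auto
    then show ?thesis by simp
  qed
  have \<beta>0: "\<beta> \<ge> 0" using \<iota>0 l0 d1 by (simp add: \<beta>)
  have cN: "card N \<ge> 1"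
    using model_net_nonempty[of S Ob "2 * (S + Ob) * H * K" A H] dims
    by (simp add: N Suc_le_eq card_gt_0_iff)
  have B1: "1 \<le> B"
  proof -
    have "1 * 1 * 1 \<le> 2 * real K * real (card N)"
      using dims cN by (intro mult_mono) auto
    then have "\<delta> \<le> 2 * real K * real (card N)" using \<delta> by linarith
    then show ?thesis using \<delta> by (simp add: B pos_le_divide_eq)
  qed
  \<comment> \<open>\<open>ln B\<close> is \<open>ln 2 + l\<close> plus at most
    \<open>4 * (d * \<iota>)\<close>, and \<open>1 + ln 2 <= 3 * ln 2 <= 3 * \<iota>\<close>. For
    \<open>K = 1\<close> all dimensions may be 1 and then \<beta> can be 0; in that case the only
    confidence set is the initial one, and this estimate is not called upon.\<close>
  have lnB: "1 + ln B \<le> \<beta>" if K2: "K \<ge> 2"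
  proof -
    have "ln 2 \<le> \<iota>"
    proof -
      have "1 * 1 * 1 * 1 * 2 \<le> ?P" using dims K2 by (intro mult_mono) auto
      then show ?thesis unfolding \<iota>_def by (intro ln_mono) auto
    qed
    moreover have "\<iota> \<le> d * \<iota>" using d1 \<iota>0 by (simp add: mult_le_cancel_right1)
    moreover have "ln (real (card N)) \<le> 4 * (d * \<iota>)"
      using ln_card_model_net_le[OF dims(1-4) K2] unfolding N d_def \<iota>_def .
    moreover have "ln B = ln 2 + (l + ln (real (card N)))"
    proof -
      have "B = 2 * ((inverse \<delta> * real K) * real (card N))" by (simp add: B field_simps)
      then show ?thesis unfolding l_def using \<delta> dims cN by (simp add: ln_mult_pos)
    qed
    moreover have "1 \<le> 2 * ln (2::real)" using ln2_ge_two_thirds by simp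
    ultimately have "1 + ln B \<le> 7 * (d * \<iota>) + l" by linarith
    then show ?thesis using l0 by (simp add: \<beta>)
  qed
  have conf: "\<theta> \<in> confidence_set S A Ob H \<alpha> \<beta> (take t D)" if t: "t < K" for t
  proof (cases "t = 0")
    case True
    then show ?thesis using init by (simp add: confidence_set_def)
  next
    case False
    then have "1 \<le> t" "K \<ge> 2" using t by auto
    then show ?thesis
      using confidence_set_properties(1)[OF dims(1,3,4) _ t D N _ _ B1] event[OF t] lnB init by blast
  qed
  \<comment> \<open>Both sequences are continued beyond the run by admissible defaults, since
    \<open>sum_tv_dist_le\<close> assumes a left inverse and a valid policy for every index.\<close>
  define \<theta>s where "\<theta>s t = (if t < K then fst (choice (take t D)) else \<theta>)" for t
  define \<pi>s where "\<pi>s t = fst (D ! (if t < K then t else 0))" for t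
  have \<theta>s_conf: "\<theta>s t \<in> confidence_set S A Ob H \<alpha> \<beta> (take t D)" if t: "t < K" for t
  proof -
    have "take t D \<in> lists (policies A Ob H \<times> trajectories A Ob H)"
      using supp by (auto dest!: in_set_takeD)
    then show ?thesis using optimism(1) conf[OF t] dims t by (simp add: \<theta>s_def)
  qed
  then have "\<theta>s t \<in> initial_models S A Ob H \<alpha>" for t
    using init confidence_set_subset by (cases "t < K") (blast, simp add: \<theta>s_def)
  then have "\<exists>L. estimation S A Ob H (\<theta>s t) \<theta> L (inverse \<alpha>)" for t
    by (intro initial_models_left_inverse[OF dims(1,4) \<alpha> _ \<theta>])
  then obtain L where L: "\<And>t. estimation S A Ob H (\<theta>s t) \<theta> (L t) (inverse \<alpha>)" by metis
  have \<pi>s: "\<pi>s t \<in> policies A Ob H" for t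
  proof -
    have "D ! (if t < K then t else 0) \<in> set D" using supp dims by (intro nth_mem) auto
    moreover have "\<forall>x\<in>set D. fst x \<in> policies A Ob H" using supp by auto
    ultimately show ?thesis unfolding \<pi>s_def by blast
  qed
  define Z where "Z = 32 * \<beta> + 32"
  have Z0: "Z \<ge> 0" using \<beta>0 by (simp add: Z_def)
  have tv: "(\<Sum>t<k. (tv_dist A Ob H (\<pi>s t) (\<theta>s k) \<theta>)\<^sup>2) \<le> Z" if k: "k < n" for k
  proof (cases "k = 0")
    case True
    then show ?thesis using Z0 by simp
  next
    case False
    then have k1: "1 \<le> k" "k < K" "K \<ge> 2" using k n by auto
    have "(\<Sum>t<k. (tv_dist A Ob H (fst (D ! t)) (\<theta>s k) \<theta>)\<^sup>2) \<le> 32 * \<beta> + 32"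
      using confidence_set_properties(2)[OF dims(1,3,4) k1(1,2) D N _ _ B1 lnB[OF k1(3)] \<theta>s_conf[OF k1(2)]]
        event[OF k1(2)] by blast
    also have "(\<Sum>t<k. (tv_dist A Ob H (fst (D ! t)) (\<theta>s k) \<theta>)\<^sup>2) =
        (\<Sum>t<k. (tv_dist A Ob H (\<pi>s t) (\<theta>s k) \<theta>)\<^sup>2)"
      using k1 by (intro sum.cong refl) (simp add: \<pi>s_def)
    finally show ?thesis by (simp add: Z_def)
  qed
  define R where "R = 2 * (real S * inverse \<alpha>) + 1"
  define C where "C = real S + real H * real Ob * real A * real S + real Ob"
  have C0: "C \<ge> 0" by (simp add: C_def)
  define X where "X = (real S * R\<^sup>2 + R\<^sup>2 * Z) * (2 * real S * (ln (real S) + ln (1 + real n)))"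
  define Y where "Y = (real S * R\<^sup>2 + R\<^sup>2 * (32 * (7 * (d * (real S + real A + real Ob + real H + l) + l)) + 32)) *
      (2 * real S * (real S + 1 + l))"
  have \<iota>_le: "\<iota> \<le> real S + real A + real Ob + real H + l"
  proof -
    have "\<iota> = ln (real S) + ln (real A) + ln (real Ob) + ln (real H) + ln (real K)"
      unfolding \<iota>_def using dims by (simp add: ln_mult_pos)
    moreover have "ln (real x) \<le> real x" if "x \<ge> 1" for x using ln_bound[of "real x"] that by simp
    ultimately show ?thesis using dims lK by (smt (verit))
  qed
  have X0: "X \<ge> 0" unfolding X_def using Z0 dims
    by (intro mult_nonneg_nonneg add_nonneg_nonneg ln_ge_zero) auto
  have XY: "X \<le> Y"
    unfolding X_def Y_def
  proof (rule mult_mono)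
    have "7 * (d * \<iota> + l) \<le> 7 * (d * (real S + real A + real Ob + real H + l) + l)"
      using d1 \<iota>_le by simp
    then have Z: "Z \<le> 32 * (7 * (d * (real S + real A + real Ob + real H + l) + l)) + 32"
      unfolding Z_def \<beta> by linarith
    then have "R\<^sup>2 * Z \<le> R\<^sup>2 * (32 * (7 * (d * (real S + real A + real Ob + real H + l) + l)) + 32)"
      by (rule mult_left_mono) simp
    then show "real S * R\<^sup>2 + R\<^sup>2 * Z \<le>
        real S * R\<^sup>2 + R\<^sup>2 * (32 * (7 * (d * (real S + real A + real Ob + real H + l) + l)) + 32)" by simp
    have "ln (real S) \<le> real S" using ln_bound[of "real S"] dims by simp
    moreover have "ln (1 + real n) \<le> 1 + l"
    proof -
      have "ln (1 + real n) \<le> ln (2 * real K)" using n dims by (intro ln_mono) auto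
      also have "\<dots> = ln 2 + ln (real K)" using dims by (simp add: ln_mult_pos)
      also have "\<dots> \<le> 1 + l" using lK ln_2_less_1 by simp
      finally show ?thesis .
    qed
    ultimately have "ln (real S) + ln (1 + real n) \<le> real S + 1 + l" by linarith
    then show "2 * real S * (ln (real S) + ln (1 + real n)) \<le> 2 * real S * (real S + 1 + l)"
      by (rule mult_left_mono) simp
    show "0 \<le> 2 * real S * (ln (real S) + ln (1 + real n))"
      using dims by (intro mult_nonneg_nonneg add_nonneg_nonneg ln_ge_zero) auto
    have "0 \<le> 32 * (7 * (d * (real S + real A + real Ob + real H + l) + l)) + 32" using Z Z0 by linarith
    then show "0 \<le> real S * R\<^sup>2 + R\<^sup>2 * (32 * (7 * (d * (real S + real A + real Ob + real H + l) + l)) + 32)"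
      by (rule add_nonneg_nonneg[OF _ mult_nonneg_nonneg[OF zero_le_power2], rotated]) simp
  qed
  have "regret A Ob H r \<theta> D n \<le> (\<Sum>t<n. real H * tv_dist A Ob H (fst (D ! t)) (fst (choice (take t D))) \<theta>)"
    by (rule regret_le_sum_tv_dist[OF D dims(2) r n conf])
  also have "\<dots> = real H * (\<Sum>t<n. tv_dist A Ob H (\<pi>s t) (\<theta>s t) \<theta>)"
    using n by (simp add: sum_distrib_left \<pi>s_def \<theta>s_def)
  also have "\<dots> \<le> real H * (C * sqrt (real n * X))"
    unfolding C_def X_def R_def
    by (intro mult_left_mono sum_tv_dist_le[OF dims(1) L \<pi>s Z0 tv]) auto
  also have "\<dots> = real H * (C * sqrt X) * sqrt (real n)" by (simp add: real_sqrt_mult)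
  also have "\<dots> \<le> real H * (C * (1 + Y)) * sqrt (real n)"
  proof (intro mult_right_mono mult_left_mono C0)
    \<comment> \<open>The square root of a polynomial is not one; replacing it by
      \<open>1 + X\<close> keeps the bound polynomial.\<close>
    have "X \<le> (1 + X)\<^sup>2" using X0 by (simp add: power2_eq_square algebra_simps)
    then have "sqrt X \<le> 1 + X" using X0 by (intro real_le_lsqrt) auto
    then show "sqrt X \<le> 1 + Y" using XY by simp
  qed auto
  also have "real H * (C * (1 + Y)) = regret_bound (real S) (real A) (real Ob) (real H) (inverse \<alpha>) l"
    unfolding regret_bound_def C_def Y_def R_def d_def ..
  finally show ?thesis .
qed

theorem theorem4:
  shows "\<exists>(c :: real) (p :: real \<times> real \<times> real \<times> real \<times> real \<times> real \<Rightarrow> real).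
    c > 0 \<and> real_polynomial_function p \<and>
    (\<forall>(\<delta> :: real) (S :: nat) (A :: nat) (Ob :: nat) (H :: nat) (K :: nat) (\<alpha> :: real) (\<beta> :: real)
        \<theta> r choice.
      0 < \<delta> \<and> \<delta> \<le> 1 \<and> S \<ge> 1 \<and> A \<ge> 1 \<and> Ob \<ge> 1 \<and> H \<ge> 1 \<and> K \<ge> 1 \<and> \<alpha> > 0 \<and>
      \<beta> = c * (real H * (real S ^ 2 * real A + real S * real Ob)
                  * ln (real S * real A * real Ob * real H * real K)
                + ln (real K / \<delta>)) \<and>
      omle_rule S A Ob H r \<alpha> \<beta> choice \<and>
      \<theta> \<in> models S A Ob H \<and> r \<in> rewards Ob H \<and>
      (MIN h\<in>{1..H}. singular_value S (emission_matrix S Ob \<theta> h)) \<ge> \<alpha> \<longrightarrow>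
      measure_pmf.prob (omle H \<theta> choice K)
        {D. \<forall>k\<in>{1..K}. regret A Ob H r \<theta> D k
              \<le> p (real S, real A, real Ob, real H, inverse \<alpha>, ln (inverse \<delta> * real K)) * sqrt (real k)}
        \<ge> 1 - \<delta>)"
proof (intro exI conjI allI impI)
  show "(7::real) > 0" by simp
  show "real_polynomial_function (\<lambda>(s, a, ob, h, i, l). regret_bound s a ob h i l)"
    by (rule polynomial_regret_bound)
  fix \<delta> :: real and S A Ob H K :: nat and \<alpha> \<beta> :: real and \<theta> r choice
  assume *: "0 < \<delta> \<and> \<delta> \<le> 1 \<and> S \<ge> 1 \<and> A \<ge> 1 \<and> Ob \<ge> 1 \<and> H \<ge> 1 \<and> K \<ge> 1 \<and> \<alpha> > 0 \<and>
      \<beta> = 7 * (real H * (real S ^ 2 * real A + real S * real Ob)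
                  * ln (real S * real A * real Ob * real H * real K)
                + ln (real K / \<delta>)) \<and>
      omle_rule S A Ob H r \<alpha> \<beta> choice \<and>
      \<theta> \<in> models S A Ob H \<and> r \<in> rewards Ob H \<and>
      (MIN h\<in>{1..H}. singular_value S (emission_matrix S Ob \<theta> h)) \<ge> \<alpha>"
  then interpret omle_run S A Ob H r \<alpha> \<beta> choice \<theta> by unfold_locales auto
  let ?p = "omle H \<theta> choice K" and ?N = "model_net S A Ob H (2 * (S + Ob) * H * K)"
  let ?B = "2 * real K * real (card ?N) / \<delta>"
  let ?E = "{D. \<forall>j<K. \<forall>\<theta>'\<in>?N. prod_list (map (ratio H \<theta>' \<theta>) (take j D)) \<le> ?B \<and>
      prod_list (map (root_ratio A Ob H \<theta>' \<theta>) (take j D)) \<le> ?B}"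
  let ?G = "{D. \<forall>k\<in>{1..K}. regret A Ob H r \<theta> D k \<le> (case (real S, real A, real Ob, real H, inverse \<alpha>,
      ln (inverse \<delta> * real K)) of (s, a, ob, h, i, l) \<Rightarrow> regret_bound s a ob h i l) * sqrt (real k)}"
  have init: "\<theta> \<in> initial_models S A Ob H \<alpha>" using * unfolding initial_models_def by blast
  have "?N \<noteq> {}" using * by (intro model_net_nonempty) auto
  then have "1 - \<delta> \<le> measure_pmf.prob ?p ?E"
    using * model_net_subset by (intro ratios_bounded) auto
  \<comment> \<open>The deterministic bound is available only for data in the support of the
    run.\<close>
  also have "\<dots> = measure_pmf.prob ?p (?E \<inter> set_pmf ?p)" by (simp add: measure_Int_set_pmf)
  also have "\<dots> \<le> measure_pmf.prob ?p ?G"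
  proof (rule measure_pmf.finite_measure_mono)
    show "?E \<inter> set_pmf ?p \<subseteq> ?G"
    proof (intro subsetI CollectI ballI)
      fix D k assume D: "D \<in> ?E \<inter> set_pmf ?p" and k: "k \<in> {1..K}"
      have "regret A Ob H r \<theta> D k \<le> regret_bound (real S) (real A) (real Ob) (real H) (inverse \<alpha>)
          (ln (inverse \<delta> * real K)) * sqrt (real k)"
        by (rule regret_le[where N = ?N and B = ?B and K = K])
           (use * D k init in \<open>simp_all add: divide_inverse mult.commute\<close>)
      then show "regret A Ob H r \<theta> D k \<le> (case (real S, real A, real Ob, real H, inverse \<alpha>,
          ln (inverse \<delta> * real K)) of (s, a, ob, h, i, l) \<Rightarrow> regret_bound s a ob h i l) * sqrt (real k)"
        by simp
    qed
  qed simp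
  finally show "1 - \<delta> \<le> measure_pmf.prob ?p ?G" .
qed

end
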